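(* Let $\lambda\in C^1(\mathbb{R};(0,+\infty))$, let $\overline{\rho}\in\mathbb{R}$, and set $d:=\overline{\rho}\,\lambda'(\overline{\rho})/\lambda(\overline{\rho})$. Assume that $d>-1$ and let $k\in(-1,1)$. Then there exist constants $\varepsilon=\varepsilon(\overline{\rho},k)>0$, $C=C(\overline{\rho},k)>0$ and $\alpha=\alpha(\overline{\rho},k)>0$ such that the following holds: for every $\rho_0\in L^2(0,1)$ with $$\|\rho_0(\cdot)-\overline{\rho}\|_{L^2(0,1)}\le\varepsilon,$$ the weak solution $\rho\in C^0([0,+\infty);L^2(0,1))$ of the Cauchy problem $$ \begin{cases} \rho_t(t,x)+(\rho(t,x)\lambda(W(t)))_x=0, & t\in(0,+\infty),\ x\in(0,1),\\ \rho(0,x)=\rho_0(x), & x\in(0,1),\\ u(t)-\overline{\rho}\lambda(\overline{\rho})=k\big(y(t)-\overline{\rho}\lambda(\overline{\rho})\big), & t\in(0,+\infty), \end{cases} $$ where $W(t)=\int_0^1\rho(t,x)\,dx$, $u(t)=\rho(t,0)\lambda(W(t))$ and $y(t)=\rho(t,1)\lambda(W(t))$, satisfies $$\|\rho(t,\cdot)-\overline{\rho}\|_{L^2(0,1)}\le C e^{-\alpha t}\|\rho_0(\cdot)-\overline{\rho}\|_{L^2(0,1)},\qquad\forall t\in[0,+\infty).$$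
   Context: The function $\lambda$ is fixed throughout; the constants $\varepsilon,C,\alpha$ may depend on it. A weak solution of the Cauchy problem is a function $\rho\in C^0([0,+\infty);L^2(0,1))$ for which there is a function $y\in L^2_{loc}([0,+\infty))$ (the outflux, representing $\rho(t,1)\lambda(W(t))$) such that, with $W(t)=\int_0^1\rho(t,x)\,dx$, for every $\tau>0$ and every $\varphi\in C^1([0,\tau]\times[0,1])$ with $\varphi(\tau,x)=0$ for all $x\in[0,1]$, $$-\int_0^\tau\!\!\int_0^1\rho(t,x)\big(\varphi_t(t,x)+\lambda(W(t))\varphi_x(t,x)\big)\,dx\,dt-\int_0^1\rho_0(x)\varphi(0,x)\,dx+\int_0^\tau\Big(y(t)\varphi(t,1)-\big[k\,y(t)+(1-k)\overline{\rho}\lambda(\overline{\rho})\big]\varphi(t,0)\Big)\,dt=0.$$ *)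

theory Defs
  imports "HOL-Analysis.Analysis"
begin

text \<open>
  Elements of \<open>L\<^sup>2\<close> are represented by real functions; two representatives denote the same
  element iff they agree almost everywhere.
\<close>

definition L2_on :: "real set \<Rightarrow> (real \<Rightarrow> real) \<Rightarrow> bool" where
  "L2_on S f \<longleftrightarrow>
     f \<in> borel_measurable (lebesgue_on S) \<and> integrable (lebesgue_on S) (\<lambda>x. (f x)\<^sup>2)"

definition norm_L2 :: "real set \<Rightarrow> (real \<Rightarrow> real) \<Rightarrow> real" where
  "norm_L2 S f = sqrt (LINT x|lebesgue_on S. (f x)\<^sup>2)"

definition L2_loc :: "(real \<Rightarrow> real) \<Rightarrow> bool" where
  "L2_loc y \<longleftrightarrow> (\<forall>T>0. L2_on {0..T} y)"

text \<open>\<open>\<rho> \<in> C\<^sup>0([0,\<infinity>); L\<^sup>2(0,1))\<close>, continuity being with respect to the norm of \<open>L\<^sup>2\<close>.\<close>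

definition C0_L2 :: "(real \<Rightarrow> real \<Rightarrow> real) \<Rightarrow> bool" where
  "C0_L2 \<rho> \<longleftrightarrow>
     (\<forall>t\<ge>0. L2_on {0<..<1} (\<rho> t)) \<and>
     (\<forall>s\<ge>0. ((\<lambda>t. norm_L2 {0<..<1} (\<lambda>x. \<rho> t x - \<rho> s x)) \<longlongrightarrow> 0) (at s within {0..}))"

text \<open>
  \<open>\<phi> \<in> C\<^sup>1([0,\<tau>] \<times> [0,1])\<close> with partial derivatives \<open>\<phi>t\<close>, \<open>\<phi>x\<close>.  The derivative is taken within
  the closed rectangle, so it is one-sided on the boundary; for \<open>\<tau> > 0\<close> it is unique.
\<close>

definition C1_rect ::
  "real \<Rightarrow> (real \<Rightarrow> real \<Rightarrow> real) \<Rightarrow> (real \<Rightarrow> real \<Rightarrow> real) \<Rightarrow> (real \<Rightarrow> real \<Rightarrow> real) \<Rightarrow> bool" where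
  "C1_rect \<tau> \<phi> \<phi>t \<phi>x \<longleftrightarrow>
     continuous_on ({0..\<tau>} \<times> {0..1}) (\<lambda>(t, x). \<phi>t t x) \<and>
     continuous_on ({0..\<tau>} \<times> {0..1}) (\<lambda>(t, x). \<phi>x t x) \<and>
     (\<forall>t\<in>{0..\<tau>}. \<forall>x\<in>{0..1}.
        ((\<lambda>(s, z). \<phi> s z) has_derivative (\<lambda>(h, j). \<phi>t t x * h + \<phi>x t x * j))
          (at (t, x) within {0..\<tau>} \<times> {0..1}))"

definition total_mass :: "(real \<Rightarrow> real \<Rightarrow> real) \<Rightarrow> real \<Rightarrow> real" where
  "total_mass \<rho> t = (LINT x|lebesgue_on {0<..<1}. \<rho> t x)"

text \<open>
  Weak solutions of the closed-loop Cauchy problem with velocity \<open>\<Lambda>\<close>, equilibrium \<open>r\<close>, feedback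
  gain \<open>k\<close> and initial datum \<open>\<rho>0\<close>.  The function \<open>y\<close> is the outflux \<open>\<rho>(t,1) \<Lambda>(W(t))\<close>, which has no
  pointwise meaning for \<open>\<rho>(t,\<cdot>) \<in> L\<^sup>2\<close>; the influx is \<open>k y(t) + (1 - k) r \<Lambda>(r)\<close>.  Values
  \<open>\<rho> t x\<close> for \<open>t < 0\<close> or \<open>x \<notin> (0,1)\<close> are irrelevant.
\<close>

definition weak_solution ::
  "(real \<Rightarrow> real) \<Rightarrow> real \<Rightarrow> real \<Rightarrow> (real \<Rightarrow> real) \<Rightarrow> (real \<Rightarrow> real \<Rightarrow> real) \<Rightarrow> bool" where
  "weak_solution \<Lambda> r k \<rho>0 \<rho> \<longleftrightarrow>
     C0_L2 \<rho> \<and>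
     (\<exists>y. L2_loc y \<and>
       (\<forall>\<tau>>0. \<forall>\<phi> \<phi>t \<phi>x. C1_rect \<tau> \<phi> \<phi>t \<phi>x \<and> (\<forall>x\<in>{0..1}. \<phi> \<tau> x = 0) \<longrightarrow>
          - (LINT t|lebesgue_on {0..\<tau>}. LINT x|lebesgue_on {0<..<1}.
               \<rho> t x * (\<phi>t t x + \<Lambda> (total_mass \<rho> t) * \<phi>x t x))
          - (LINT x|lebesgue_on {0<..<1}. \<rho>0 x * \<phi> 0 x)
          + (LINT t|lebesgue_on {0..\<tau>}.
               y t * \<phi> t 1 - (k * y t + (1 - k) * r * \<Lambda> r) * \<phi> t 0) = 0))"

end

theory Submission
  imports Defs
begin

text \<open>
  The proof follows the density along characteristics.  Let \<open>\<xi> t\<close> be the distance travelled at the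
  common speed \<open>\<Lambda>(W)\<close>.  Measured by \<open>s = \<xi> t\<close> instead of time, the transport has unit speed, and a
  solution has the form \<open>\<rho> t x = r + h (\<xi> t - x)\<close> for one profile \<open>h\<close> on \<open>(-1, \<infinity>)\<close>, whose part on
  \<open>(-1, 0)\<close> is the initial deviation.  The boundary law becomes the delay equation
  \<open>h s = k * h (s - 1) + (1 - k) * F (m s)\<close>, where \<open>m s\<close> is the integral of \<open>h\<close> over \<open>[s - 1, s]\<close>, that is,
  the deviation of the total mass, and \<open>F x = r * (\<Lambda> r / \<Lambda> (r + x) - 1)\<close>.  Here \<open>F 0 = 0\<close> and the
  derivative of \<open>F\<close> at \<open>0\<close> is \<open>- d\<close>, which is less than \<open>1\<close>.

  Decay rests on an exact identity.  For a primitive \<open>\<Phi>\<close> of \<open>F\<close>, the integral of \<open>h\<^sup>2\<close> over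
  \<open>[s - 1, s]\<close> minus \<open>2 * \<Phi> (m s)\<close> changes at the rate \<open>- (1 - k\<^sup>2) * (h (s - 1) - F (m s))\<^sup>2\<close>
  (\<open>delay_dissipation\<close>).  As \<open>- d < 1\<close>, there is \<open>\<theta> < 1\<close> with \<open>x * F x \<le> \<theta> * x\<^sup>2\<close> near \<open>0\<close>; therefore this
  functional is comparable to the squared norm of \<open>h\<close>, and the dissipation over a unit window bounds
  the norm in the window before (\<open>delay_observability\<close>).  The result is geometric decay
  (\<open>delay_decay\<close>).  The function \<open>F\<close> is truncated away from \<open>0\<close>, so that these bounds hold everywhere;
  small initial data never reach the truncation.  Since the speed is bounded below along small
  solutions, decay in \<open>s\<close> is decay in time.

  A solution exists because the delay equation, written for the primitive of \<open>h\<close>, is a contraction in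
  a weighted supremum norm (\<open>delay_solution_exists\<close>), and because its profile solves the weak formulation
  (\<open>weak_solution_of_profile\<close>).  For uniqueness, test functions that are constant along
  characteristics show that every weak solution is determined by its accumulated influx, as a
  function of the distance travelled, and that this function solves a fixed point equation with
  locally Lipschitz right-hand side (\<open>weak_solution_flux_primitive\<close>, \<open>weak_solution_unique\<close>).

  The profile is only square integrable.  What is needed of calculus for such functions, namely the
  chain rule for primitives, continuity of translations, and the transport identity, is proved for
  polynomials or continuous functions and extended by density in the integral norm.
\<close>

section \<open>Absolutely integrable functions on intervals\<close>

lemma absint_mult_continuous:
  fixes f c :: "real \<Rightarrow> real"
  assumes "continuous_on {a..b} c" "f absolutely_integrable_on {a..b}"
  shows "(\<lambda>x. c x * f x) absolutely_integrable_on {a..b}"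
proof (rule absolutely_integrable_bounded_measurable_product_real)
  show "c \<in> borel_measurable (lebesgue_on {a..b})"
    using assms(1) by (simp add: continuous_imp_measurable_on_sets_lebesgue)
  show "bounded (c ` {a..b})"
    by (simp add: assms(1) compact_continuous_image compact_imp_bounded)
qed (use assms in auto)

lemma absint_shift:
  fixes f :: "real \<Rightarrow> real"
  assumes "f absolutely_integrable_on {a + c..b + c}"
  shows "(\<lambda>x. f (x + c)) absolutely_integrable_on {a..b}"
  using assms integrable_shift_real_ivl[of f "a+c" "b+c" c]
    integrable_shift_real_ivl[of "\<lambda>x. norm (f x)" "a+c" "b+c" c]
  unfolding absolutely_integrable_on_def by auto

lemma absint_window:
  fixes f :: "real \<Rightarrow> real"
  assumes "f absolutely_integrable_on {s - 1..s}"
  shows "(\<lambda>x. f (s - x)) absolutely_integrable_on {0..1}"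
proof -
  have "(\<lambda>x. f (x + s)) absolutely_integrable_on {-1..0}"
    by (rule absint_shift) (use assms in simp)
  then have "(\<lambda>x. f (- x + s)) absolutely_integrable_on {-0..-(-1)}"
    by (subst absolutely_integrable_reflect_real)
  then show ?thesis by simp
qed

lemma integral_window:
  fixes f :: "real \<Rightarrow> real"
  shows "integral {0..1} (\<lambda>x. f (s - x)) = integral {s - 1..s} f"
proof -
  have "integral {-0..-(-1)} (\<lambda>x. f (- x + s)) = integral {-1..0} (\<lambda>x. f (x + s))"
    by (rule Henstock_Kurzweil_Integration.integral_reflect_real)
  also have "\<dots> = integral {s - 1..s} f"
    using integral_shift_real_ivl[of "s-1" s s f] by simp
  finally show ?thesis by simp
qed

lemma absint_imp_integrable:
  fixes f :: "real \<Rightarrow> real"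
  shows "f absolutely_integrable_on S \<Longrightarrow> f integrable_on S"
  by (simp add: absolutely_integrable_on_def)

lemma absint_abs:
  fixes f :: "real \<Rightarrow> real"
  shows "f absolutely_integrable_on S \<Longrightarrow> (\<lambda>x. \<bar>f x\<bar>) absolutely_integrable_on S"
  by (simp add: absolutely_integrable_on_def)

lemma integral_split:
  fixes f :: "real \<Rightarrow> real"
  assumes "f integrable_on {a..c}" "a \<le> b" "b \<le> c"
  shows "integral {b..c} f = integral {a..c} f - integral {a..b} f"
  using Henstock_Kurzweil_Integration.integral_combine[OF assms(2,3,1)] by simp

section \<open>Density of polynomials in the integrable functions\<close>

text \<open>
  Functions with large values cut off approximate \<open>f\<close> in the integral norm.  A bounded
  measurable function is an almost everywhere limit of continuous functions, hence, after the same
  cut-off and by dominated convergence, also a limit in the integral norm; and continuous functions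
  are uniform limits of polynomials.
\<close>

lemma absint_dense:
  fixes f :: "real \<Rightarrow> real"
  assumes f: "f absolutely_integrable_on {a..b}" and "e > 0"
  shows "\<exists>p. real_polynomial_function p \<and> integral {a..b} (\<lambda>x. \<bar>f x - p x\<bar>) < e"
proof (cases "a < b")
  case False
  have "integral {a..b} (\<lambda>x. \<bar>f x - 0\<bar>) = 0"
    using False by (cases "a = b") auto
  then show ?thesis
    using \<open>e > 0\<close> by (intro exI[of _ "\<lambda>_. 0"]) (auto intro: real_polynomial_function.intros)
next
  case True
  define T where "T N v = max (- real N) (min (real N) v)" for N v
  have Tcont: "continuous_on UNIV (T N)" for N
    unfolding T_def by (intro continuous_intros)
  have Tb: "\<bar>T N v\<bar> \<le> real N" for N v unfolding T_def by auto
  have Tdiff: "\<bar>v - T N v\<bar> \<le> \<bar>v\<bar>" for N v unfolding T_def by (auto simp: max_def min_def)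
  have fm: "f \<in> borel_measurable (lebesgue_on {a..b})"
    using absolutely_integrable_imp_integrable[OF f] by auto
  have Tai: "(\<lambda>x. T N (f x)) absolutely_integrable_on {a..b}" for N
  proof (rule measurable_bounded_by_integrable_imp_absolutely_integrable[where g="\<lambda>_. real N"])
    show "(\<lambda>x. T N (f x)) \<in> borel_measurable (lebesgue_on {a..b})"
      unfolding T_def using fm by measurable
  qed (use Tb in auto)
  \<comment> \<open>Large values carry little mass, so cutting them off is harmless.\<close>
  have "(\<lambda>N. integral {a..b} (\<lambda>x. \<bar>f x - T N (f x)\<bar>)) \<longlonglongrightarrow> integral {a..b} (\<lambda>x. 0)"
  proof (rule dominated_convergence(2)[where h="\<lambda>x. \<bar>f x\<bar>"])
    show "(\<lambda>x. \<bar>f x - T N (f x)\<bar>) integrable_on {a..b}" for N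
      by (intro absint_imp_integrable absint_abs set_integral_diff f Tai)
    show "(\<lambda>x. \<bar>f x\<bar>) integrable_on {a..b}" using f absint_abs absint_imp_integrable by blast
    show "(\<lambda>N. \<bar>f x - T N (f x)\<bar>) \<longlonglongrightarrow> 0" for x
    proof (rule tendsto_eventually)
      obtain M where M: "\<bar>f x\<bar> \<le> real M" using real_arch_simple by blast
      have "f x = T N (f x)" if "N \<ge> M" for N
        using M that of_nat_mono[OF that, where 'a=real] unfolding T_def by linarith
      then show "\<forall>\<^sub>F N in sequentially. \<bar>f x - T N (f x)\<bar> = 0"
        unfolding eventually_sequentially by (intro exI[of _ M]) simp
    qed
  qed (use Tdiff in auto)
  then have "(\<lambda>N. integral {a..b} (\<lambda>x. \<bar>f x - T N (f x)\<bar>)) \<longlonglongrightarrow> 0" by simp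
  then have "\<forall>\<^sub>F N in sequentially. integral {a..b} (\<lambda>x. \<bar>f x - T N (f x)\<bar>) < e/3"
    using \<open>e > 0\<close> by (intro order_tendstoD) auto
  then obtain N where N: "integral {a..b} (\<lambda>x. \<bar>f x - T N (f x)\<bar>) < e/3"
    using eventually_happens'[OF sequentially_bot] by blast
  have "f measurable_on {a..b}" using fm by (simp add: measurable_on_iff_borel_measurable)
  then obtain Z g where Z: "negligible Z" and gc: "\<And>n. continuous_on UNIV (g n)"
    and glim: "\<And>x. x \<notin> Z \<Longrightarrow> (\<lambda>n. g n x) \<longlonglongrightarrow> (if x \<in> {a..b} then f x else (0::real))"
    unfolding measurable_on_def by blast
  have Tgc: "continuous_on UNIV (\<lambda>x. T N (g n x))" for n
    using continuous_on_compose2[OF Tcont gc] by auto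
  have Tg: "(\<lambda>x. T N (g n x)) absolutely_integrable_on {a..b}" for n
    by (rule absolutely_integrable_continuous_real) (rule continuous_on_subset[OF Tgc], simp)
  define u where "u n x = (if x \<in> Z then 0 else \<bar>T N (f x) - T N (g n x)\<bar>)" for n x
  have int0: "(\<lambda>x. \<bar>T N (f x) - T N (g n x)\<bar>) integrable_on {a..b}" for n
    by (intro absint_imp_integrable absint_abs set_integral_diff Tai Tg)
  have "(\<lambda>n. integral {a..b} (u n)) \<longlonglongrightarrow> integral {a..b} (\<lambda>x. 0)"
  proof (rule dominated_convergence(2)[where h="\<lambda>x. 2 * real N"])
    show "u n integrable_on {a..b}" for n
      by (rule integrable_spike[OF int0 Z]) (simp add: u_def)
    show "norm (u n x) \<le> 2 * real N" for n x
      using Tb[of N "f x"] Tb[of N "g n x"] by (auto simp: u_def)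
    show "(\<lambda>n. u n x) \<longlonglongrightarrow> 0" if x: "x \<in> {a..b}" for x
    proof (cases "x \<in> Z")
      case False
      then have "(\<lambda>n. g n x) \<longlonglongrightarrow> f x" using glim x by metis
      then have "(\<lambda>n. T N (g n x)) \<longlonglongrightarrow> T N (f x)"
        using Tcont continuous_on_tendsto_compose by fastforce
      then have "(\<lambda>n. \<bar>T N (f x) - T N (g n x)\<bar>) \<longlonglongrightarrow> \<bar>T N (f x) - T N (f x)\<bar>"
        by (intro tendsto_intros)
      then show ?thesis using False by (simp add: u_def)
    qed (simp add: u_def)
  qed auto
  then have "(\<lambda>n. integral {a..b} (u n)) \<longlonglongrightarrow> 0" by simp
  then have "\<forall>\<^sub>F n in sequentially. integral {a..b} (u n) < e/3"
    using \<open>e > 0\<close> by (intro order_tendstoD) auto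
  then obtain n where "integral {a..b} (u n) < e/3"
    using eventually_happens'[OF sequentially_bot] by blast
  moreover have "integral {a..b} (u n) = integral {a..b} (\<lambda>x. \<bar>T N (f x) - T N (g n x)\<bar>)"
    by (rule integral_spike[OF Z]) (simp add: u_def)
  ultimately have n: "integral {a..b} (\<lambda>x. \<bar>T N (f x) - T N (g n x)\<bar>) < e/3" by simp
  have "e / (3 * (b - a)) > 0" using \<open>e > 0\<close> True by simp
  from Stone_Weierstrass_real_polynomial_function[OF compact_Icc
      continuous_on_subset[OF Tgc subset_UNIV] this, of a b n]
  obtain p where p: "real_polynomial_function p"
    and pb: "\<And>x. x \<in> {a..b} \<Longrightarrow> \<bar>T N (g n x) - p x\<bar> < e / (3 * (b - a))" by blast
  have pc: "continuous_on {a..b} p"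
    by (rule continuous_on_polymonial_function) (use p real_polynomial_function_eq in blast)
  have pai: "p absolutely_integrable_on {a..b}" by (rule absolutely_integrable_continuous_real[OF pc])
  have i1: "(\<lambda>x. \<bar>f x - T N (f x)\<bar>) integrable_on {a..b}"
    by (intro absint_imp_integrable absint_abs set_integral_diff f Tai)
  have i3: "(\<lambda>x. \<bar>T N (g n x) - p x\<bar>) integrable_on {a..b}"
    by (intro absint_imp_integrable absint_abs set_integral_diff Tg pai)
  have "integral {a..b} (\<lambda>x. \<bar>T N (g n x) - p x\<bar>) \<le> integral {a..b} (\<lambda>x. e / (3 * (b - a)))"
    by (rule integral_le[OF i3]) (use pb less_imp_le in auto)
  also have "\<dots> = e / 3" using True by (simp add: field_simps)
  finally have 3: "integral {a..b} (\<lambda>x. \<bar>T N (g n x) - p x\<bar>) \<le> e / 3" .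
  have "integral {a..b} (\<lambda>x. \<bar>f x - p x\<bar>) \<le>
        integral {a..b} (\<lambda>x. \<bar>f x - T N (f x)\<bar> + \<bar>T N (f x) - T N (g n x)\<bar> + \<bar>T N (g n x) - p x\<bar>)"
  proof (rule integral_le)
    show "(\<lambda>x. \<bar>f x - p x\<bar>) integrable_on {a..b}"
      by (intro absint_imp_integrable absint_abs set_integral_diff f pai)
  qed (intro integrable_add i1 int0 i3, linarith)
  also have "\<dots> = integral {a..b} (\<lambda>x. \<bar>f x - T N (f x)\<bar>)
      + integral {a..b} (\<lambda>x. \<bar>T N (f x) - T N (g n x)\<bar>) + integral {a..b} (\<lambda>x. \<bar>T N (g n x) - p x\<bar>)"
    by (subst integral_add integral_add; (intro integrable_add i1 int0 i3)?)+ simp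
  also have "\<dots> < e" using N n 3 by linarith
  finally show ?thesis using p by blast
qed

lemma absint_dense_C1:
  fixes f :: "real \<Rightarrow> real"
  assumes "f absolutely_integrable_on {a..b}" and "e > 0"
  obtains p p' where "\<And>x. (p has_real_derivative p' x) (at x)" "continuous_on UNIV p"
    "continuous_on UNIV p'" "integral {a..b} (\<lambda>x. \<bar>f x - p x\<bar>) < e"
proof -
  obtain p where p: "real_polynomial_function p" "integral {a..b} (\<lambda>x. \<bar>f x - p x\<bar>) < e"
    using absint_dense[OF assms] by blast
  obtain p' where p': "real_polynomial_function p'" "\<And>x. (p has_real_derivative p' x) (at x)"
    using has_real_derivative_polynomial_function[OF p(1)] by blast
  show thesis
    using p p' continuous_on_polymonial_function[of p UNIV] continuous_on_polymonial_function[of p' UNIV]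
    by (intro that[of p p']) (simp_all add: real_polynomial_function_eq)
qed

section \<open>Chain rule and continuity of translations\<close>

lemma lipschitz_imp_continuous:
  fixes F :: "real \<Rightarrow> real"
  assumes F: "\<And>x y. \<bar>F x - F y\<bar> \<le> L * \<bar>x - y\<bar>"
  shows "continuous_on UNIV F"
proof -
  have "L \<ge> 0" using F[of 1 0] by simp
  then show ?thesis
    using F by (intro lipschitz_on_continuous_on[of L] lipschitz_onI) (auto simp: dist_real_def)
qed

text \<open>
  The chain rule for a function \<open>m\<close> that is merely a primitive of the integrable function \<open>p\<close>.
  For continuous \<open>p\<close> it is the fundamental theorem of calculus; since \<open>F\<close> is Lipschitz, both sides
  pass to the limit when \<open>p\<close> is approached by continuous functions in the integral norm.
\<close>

lemma absint_chain_rule: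
  fixes F \<Phi> p m :: "real \<Rightarrow> real"
  assumes p: "p absolutely_integrable_on {a..b}" and ab: "a \<le> b"
    and \<Phi>: "\<And>x. (\<Phi> has_real_derivative F x) (at x)"
    and F: "\<And>x y. \<bar>F x - F y\<bar> \<le> L * \<bar>x - y\<bar>"
    and m: "\<And>s. s \<in> {a..b} \<Longrightarrow> m s = m a + integral {a..s} p"
  shows "(\<lambda>s. F (m s) * p s) absolutely_integrable_on {a..b}"
    and "integral {a..b} (\<lambda>s. F (m s) * p s) = \<Phi> (m b) - \<Phi> (m a)"
proof -
  have L: "L \<ge> 0" using F[of 1 0] by simp
  have Fc: "continuous_on UNIV F" by (rule lipschitz_imp_continuous[OF F])
  have mc: "continuous_on {a..b} m"
    by (rule continuous_on_eq[where f="\<lambda>s. m a + integral {a..s} p"])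
      (auto simp: m[symmetric] intro!: continuous_intros indefinite_integral_continuous_1 absint_imp_integrable p)
  have Fmc: "continuous_on {a..b} (\<lambda>s. F (m s))"
    by (rule continuous_on_compose2[OF Fc mc]) auto
  show ai: "(\<lambda>s. F (m s) * p s) absolutely_integrable_on {a..b}"
    by (rule absint_mult_continuous[OF Fmc p])
  have "bounded ((\<lambda>s. F (m s)) ` {a..b})"
    by (simp add: Fmc compact_continuous_image compact_imp_bounded)
  then obtain B where B: "\<And>s. s \<in> {a..b} \<Longrightarrow> \<bar>F (m s)\<bar> \<le> B"
    unfolding bounded_iff by (metis imageI real_norm_def)
  have "\<exists>q. continuous_on UNIV q \<and> integral {a..b} (\<lambda>x. \<bar>p x - q x\<bar>) < 1 / Suc n" for n
    by (rule absint_dense_C1[OF p, of "1 / Suc n"]) auto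
  then obtain q where qc: "\<And>n. continuous_on UNIV (q n)"
    and q: "\<And>n. integral {a..b} (\<lambda>x. \<bar>p x - q n x\<bar>) < 1 / Suc n" by metis
  have qai: "q n absolutely_integrable_on {a..b}" for n
    by (rule absolutely_integrable_continuous_real) (rule continuous_on_subset[OF qc], simp)
  have dai: "(\<lambda>x. \<bar>p x - q n x\<bar>) absolutely_integrable_on {a..b}" for n
    by (intro absint_abs set_integral_diff p qai)
  define M where "M n s = m a + integral {a..s} (q n)" for n s
  have Mder: "(M n has_real_derivative q n s) (at s within {a..b})" if "s \<in> {a..b}" for n s
    unfolding M_def
    by (auto intro!: derivative_eq_intros integral_has_real_derivative[OF continuous_on_subset[OF qc]] that)
  have Md: "\<bar>M n s - m s\<bar> \<le> 1 / Suc n" if s: "s \<in> {a..b}" for n s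
  proof -
    have sub: "{a..s} \<subseteq> {a..b}" using s by auto
    note sai = absolutely_integrable_on_subinterval[OF _ sub]
    have "M n s - m s = integral {a..s} (\<lambda>x. q n x - p x)"
      unfolding M_def using m[OF s]
      by (simp add: Henstock_Kurzweil_Integration.integral_diff absint_imp_integrable sai p qai)
    also have "\<bar>\<dots>\<bar> \<le> integral {a..s} (\<lambda>x. \<bar>p x - q n x\<bar>)"
      by (rule integral_norm_bound_integral[where 'a=real, simplified])
        (auto intro!: absint_imp_integrable sai dai set_integral_diff qai p)
    also have "\<dots> \<le> integral {a..b} (\<lambda>x. \<bar>p x - q n x\<bar>)"
      by (rule integral_subset_le[OF sub]) (auto intro!: absint_imp_integrable sai dai)
    finally show ?thesis using q[of n] by linarith
  qed
  have Mc: "continuous_on {a..b} (M n)" for n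
    using Mder by (meson DERIV_continuous continuous_on_eq_continuous_within)
  have FMc: "continuous_on {a..b} (\<lambda>s. F (M n s))" for n
    by (rule continuous_on_compose2[OF Fc Mc]) auto
  have FMai: "(\<lambda>s. F (M n s) * q n s) absolutely_integrable_on {a..b}" for n
    by (rule absint_mult_continuous[OF FMc qai])
  have ftc: "integral {a..b} (\<lambda>s. F (M n s) * q n s) = \<Phi> (M n b) - \<Phi> (M n a)" for n
  proof (rule integral_unique, rule fundamental_theorem_of_calculus[OF ab])
    fix s assume "s \<in> {a..b}"
    then show "((\<lambda>s. \<Phi> (M n s)) has_vector_derivative F (M n s) * q n s) (at s within {a..b})"
      unfolding has_real_derivative_iff_has_vector_derivative[symmetric]
      by (rule DERIV_chain2[OF \<Phi> Mder])
  qed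
  have inv0: "(\<lambda>n. 1 / real (Suc n)) \<longlonglongrightarrow> 0"
    using LIMSEQ_inverse_real_of_nat by (simp add: inverse_eq_divide)
  have "(\<lambda>n. M n b - m b) \<longlonglongrightarrow> 0"
    by (rule Lim_null_comparison[OF _ inv0]) (use Md[of b] ab in \<open>auto intro!: always_eventually\<close>)
  then have "(\<lambda>n. M n b) \<longlonglongrightarrow> m b" by (simp add: LIM_zero_iff)
  then have "(\<lambda>n. \<Phi> (M n b)) \<longlonglongrightarrow> \<Phi> (m b)"
    by (rule isCont_tendsto_compose[OF DERIV_isCont[OF \<Phi>]])
  moreover have "M n a = m a" for n by (simp add: M_def)
  ultimately have lim1: "(\<lambda>n. integral {a..b} (\<lambda>s. F (M n s) * q n s)) \<longlonglongrightarrow> \<Phi> (m b) - \<Phi> (m a)"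
    unfolding ftc by (auto intro!: tendsto_intros)
  define K where "K = L + B + L * integral {a..b} (\<lambda>s. \<bar>p s\<bar>)"
  have diff: "norm (integral {a..b} (\<lambda>s. F (M n s) * q n s) - integral {a..b} (\<lambda>s. F (m s) * p s))
      \<le> K * (1 / Suc n)" for n
  proof -
    have "integral {a..b} (\<lambda>s. F (M n s) * q n s) - integral {a..b} (\<lambda>s. F (m s) * p s)
        = integral {a..b} (\<lambda>s. F (M n s) * q n s - F (m s) * p s)"
      by (simp add: Henstock_Kurzweil_Integration.integral_diff absint_imp_integrable ai FMai)
    also have "\<bar>\<dots>\<bar> \<le> integral {a..b} (\<lambda>s. (L + B) * \<bar>p s - q n s\<bar> + L / Suc n * \<bar>p s\<bar>)"
    proof (rule integral_norm_bound_integral[where 'a=real, simplified])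
      fix s assume s: "s \<in> {a..b}"
      have FF: "\<bar>F (M n s) - F (m s)\<bar> \<le> L / Suc n"
        using F[of "M n s" "m s"] mult_left_mono[OF Md[OF s, of n] L] by simp
      also have "L / Suc n \<le> L" using L by (simp add: divide_le_eq algebra_simps)
      finally have FB: "\<bar>F (M n s)\<bar> \<le> L + B" using B[OF s] by linarith
      have "F (M n s) * q n s - F (m s) * p s = F (M n s) * (q n s - p s) + (F (M n s) - F (m s)) * p s"
        by (simp add: algebra_simps)
      then have "\<bar>F (M n s) * q n s - F (m s) * p s\<bar>
          \<le> \<bar>F (M n s)\<bar> * \<bar>p s - q n s\<bar> + \<bar>F (M n s) - F (m s)\<bar> * \<bar>p s\<bar>"
        using abs_triangle_ineq[of "F (M n s) * (q n s - p s)" "(F (M n s) - F (m s)) * p s"]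
        by (simp add: abs_mult abs_minus_commute)
      also have "\<dots> \<le> (L + B) * \<bar>p s - q n s\<bar> + L / Suc n * \<bar>p s\<bar>"
        by (intro add_mono mult_right_mono FF FB) auto
      finally show "\<bar>F (M n s) * q n s - F (m s) * p s\<bar> \<le> (L + B) * \<bar>p s - q n s\<bar> + L / Suc n * \<bar>p s\<bar>" .
    next
      show "(\<lambda>s. F (M n s) * q n s - F (m s) * p s) integrable_on {a..b}"
        by (rule absint_imp_integrable[OF set_integral_diff(1)[OF FMai ai]])
      show "(\<lambda>s. (L + B) * \<bar>p s - q n s\<bar> + L / Suc n * \<bar>p s\<bar>) integrable_on {a..b}"
        by (intro absint_imp_integrable set_integral_add(1) set_integrable_mult_right dai absint_abs p)
    qed
    also have "\<dots> = (L + B) * integral {a..b} (\<lambda>s. \<bar>p s - q n s\<bar>) + L / Suc n * integral {a..b} (\<lambda>s. \<bar>p s\<bar>)"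
      by (subst Henstock_Kurzweil_Integration.integral_add)
        (auto intro!: absint_imp_integrable set_integrable_mult_right dai absint_abs p)
    also have "\<dots> \<le> (L + B) * (1 / Suc n) + L / Suc n * integral {a..b} (\<lambda>s. \<bar>p s\<bar>)"
    proof -
      have "B \<ge> 0" using B[of a] ab by simp
      then show ?thesis using q[of n] L by (intro add_mono mult_left_mono) auto
    qed
    also have "\<dots> = K * (1 / Suc n)" by (simp add: K_def distrib_right add_divide_distrib)
    finally show ?thesis by simp
  qed
  have K0: "(\<lambda>n. K * (1 / Suc n)) \<longlonglongrightarrow> 0" by (rule tendsto_mult_right_zero[OF inv0])
  have "(\<lambda>n. integral {a..b} (\<lambda>s. F (M n s) * q n s) - integral {a..b} (\<lambda>s. F (m s) * p s)) \<longlonglongrightarrow> 0"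
    by (rule Lim_null_comparison[OF _ K0]) (rule always_eventually, rule allI, rule diff)
  then have "(\<lambda>n. integral {a..b} (\<lambda>s. F (M n s) * q n s)) \<longlonglongrightarrow> integral {a..b} (\<lambda>s. F (m s) * p s)"
    by (simp add: LIM_zero_iff)
  from LIMSEQ_unique[OF this lim1]
  show "integral {a..b} (\<lambda>s. F (m s) * p s) = \<Phi> (m b) - \<Phi> (m a)" .
qed

text \<open>
  This is uniform continuity for a polynomial close to \<open>q\<close> in the integral norm, and a shift does
  not enlarge the error made in replacing \<open>q\<close> by the polynomial.
\<close>

lemma translation_L1:
  fixes q :: "real \<Rightarrow> real"
  assumes q: "q absolutely_integrable_on {A..B}" and "e > 0"
  shows "\<exists>d>0. \<forall>s\<in>{A+1..B}. \<forall>s'\<in>{A+1..B}. \<bar>s - s'\<bar> < d \<longrightarrow>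
           integral {0..1} (\<lambda>x. \<bar>q (s - x) - q (s' - x)\<bar>) < e"
proof -
  obtain p where pc: "continuous_on UNIV p" and p: "integral {A..B} (\<lambda>x. \<bar>q x - p x\<bar>) < e/4"
    using absint_dense_C1[OF q, of "e/4"] \<open>e > 0\<close> by auto
  have "uniformly_continuous_on {A..B} p"
    by (rule compact_uniformly_continuous[OF continuous_on_subset[OF pc]]) auto
  then obtain d where d: "d > 0" "\<And>x y. x \<in> {A..B} \<Longrightarrow> y \<in> {A..B} \<Longrightarrow> \<bar>x - y\<bar> < d \<Longrightarrow> \<bar>p x - p y\<bar> < e/4"
    unfolding uniformly_continuous_on_def dist_real_def using \<open>e > 0\<close> by (metis divide_pos_pos zero_less_numeral)
  have pai: "p absolutely_integrable_on {A..B}"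
    by (rule absolutely_integrable_continuous_real) (rule continuous_on_subset[OF pc], simp)
  have dai: "(\<lambda>x. \<bar>q x - p x\<bar>) absolutely_integrable_on {A..B}"
    by (intro absint_abs set_integral_diff q pai)
  have win: "(\<lambda>x. f (s - x)) absolutely_integrable_on {0..1}"
    if "f absolutely_integrable_on {A..B}" "s \<in> {A+1..B}" for f :: "real \<Rightarrow> real" and s
    by (rule absint_window, rule absolutely_integrable_on_subinterval[OF that(1)]) (use that(2) in auto)
  have near: "integral {0..1} (\<lambda>x. \<bar>q (s - x) - p (s - x)\<bar>) < e/4" if s: "s \<in> {A+1..B}" for s
  proof -
    have "integral {0..1} (\<lambda>x. \<bar>q (s - x) - p (s - x)\<bar>) = integral {s-1..s} (\<lambda>x. \<bar>q x - p x\<bar>)"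
      by (rule integral_window[of "\<lambda>x. \<bar>q x - p x\<bar>"])
    also have "\<dots> \<le> integral {A..B} (\<lambda>x. \<bar>q x - p x\<bar>)"
      by (rule integral_subset_le)
        (use s in \<open>auto intro!: absint_imp_integrable dai absolutely_integrable_on_subinterval[OF dai]\<close>)
    finally show ?thesis using p by simp
  qed
  show ?thesis
  proof (intro exI[of _ d] conjI ballI impI)
    fix s s' assume s: "s \<in> {A+1..B}" "s' \<in> {A+1..B}" "\<bar>s - s'\<bar> < d"
    have i: "(\<lambda>x. \<bar>q (u - x) - p (u - x)\<bar>) integrable_on {0..1}" if "u \<in> {A+1..B}" for u
      by (rule absint_imp_integrable, rule win[OF dai that])
    have "integral {0..1} (\<lambda>x. \<bar>q (s - x) - q (s' - x)\<bar>)
       \<le> integral {0..1} (\<lambda>x. (\<bar>q (s - x) - p (s - x)\<bar> + \<bar>q (s' - x) - p (s' - x)\<bar>) + e/4)"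
    proof (rule integral_le)
      show "(\<lambda>x. \<bar>q (s - x) - q (s' - x)\<bar>) integrable_on {0..1}"
        by (intro absint_imp_integrable absint_abs set_integral_diff win q s)
      fix x :: real assume "x \<in> {0..1}"
      then have "\<bar>p (s - x) - p (s' - x)\<bar> < e/4" using s by (intro d(2)) auto
      then show "\<bar>q (s - x) - q (s' - x)\<bar> \<le> (\<bar>q (s - x) - p (s - x)\<bar> + \<bar>q (s' - x) - p (s' - x)\<bar>) + e/4"
        by linarith
    qed (intro integrable_add i s integrable_const_ivl)
    also have "\<dots> = integral {0..1} (\<lambda>x. \<bar>q (s - x) - p (s - x)\<bar>)
        + integral {0..1} (\<lambda>x. \<bar>q (s' - x) - p (s' - x)\<bar>) + e/4"
  by (simp add: integral_unique[OF has_integral_add[OF has_integral_add[OF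
            integrable_integral[OF i[OF s(1)]] integrable_integral[OF i[OF s(2)]]] has_integral_const_real[of "e/4" 0 1]]])
    also have "\<dots> < e" using near[OF s(1)] near[OF s(2)] \<open>e > 0\<close> by linarith
    finally show "integral {0..1} (\<lambda>x. \<bar>q (s - x) - q (s' - x)\<bar>) < e" .
  qed (use d(1) in simp)
qed

lemma continuous_on_slices:
  fixes f :: "real \<Rightarrow> real \<Rightarrow> real"
  assumes f: "continuous_on (S \<times> X) (\<lambda>(t, x). f t x)"
  shows "t \<in> S \<Longrightarrow> continuous_on X (f t)" and "x \<in> X \<Longrightarrow> continuous_on S (\<lambda>t. f t x)"
proof -
  assume t: "t \<in> S"
  have "continuous_on X (\<lambda>x. (t, x))" by (intro continuous_intros)
  from continuous_on_compose2[OF f this] t show "continuous_on X (f t)" by (simp add: image_subset_iff)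
next
  assume x: "x \<in> X"
  have "continuous_on S (\<lambda>t. (t, x))" by (intro continuous_intros)
  from continuous_on_compose2[OF f this] x show "continuous_on S (\<lambda>t. f t x)" by (simp add: image_subset_iff)
qed

lemma continuous_on_fst_snd:
  fixes f :: "real \<Rightarrow> real" and S X :: "real set"
  shows "continuous_on S f \<Longrightarrow> continuous_on (S \<times> X) (\<lambda>(t, x). f t)"
    and "continuous_on X f \<Longrightarrow> continuous_on (S \<times> X) (\<lambda>(t, x). f x)"
  unfolding split_beta
  by (rule continuous_on_compose2[of S f _ fst] continuous_on_compose2[of X f _ snd];
      auto intro!: continuous_intros)+

lemma continuous_on_rect_bounded:
  fixes f :: "real \<Rightarrow> real \<Rightarrow> real"
  assumes "continuous_on ({a..b} \<times> {c..d}) (\<lambda>(t, x). f t x)"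
  shows "\<exists>M>0. \<forall>t\<in>{a..b}. \<forall>x\<in>{c..d}. \<bar>f t x\<bar> \<le> M"
proof -
  have "bounded ((\<lambda>(t, x). f t x) ` ({a..b} \<times> {c..d}))"
    by (intro compact_imp_bounded compact_continuous_image assms compact_Times compact_Icc)
  then obtain M where M: "M > 0" "\<And>z. z \<in> (\<lambda>(t, x). f t x) ` ({a..b} \<times> {c..d}) \<Longrightarrow> norm z \<le> M"
    unfolding bounded_pos by blast
  have "\<bar>f t x\<bar> \<le> M" if "t \<in> {a..b}" "x \<in> {c..d}" for t x
    using M(2)[OF image_eqI[of _ _ "(t, x)"]] that by simp
  with M(1) show ?thesis by blast
qed

text \<open>
  A small change of \<open>R t\<close> in the integral norm is harmless because \<open>f\<close> is bounded, and the change
  of \<open>f t\<close> is uniformly small by uniform continuity on the rectangle.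
\<close>

lemma L1_continuous_pairing:
  fixes R f :: "real \<Rightarrow> real \<Rightarrow> real"
  assumes R: "\<And>t. t \<in> {0..T} \<Longrightarrow> R t absolutely_integrable_on {0..1}"
    and cont: "\<And>s e. s \<in> {0..T} \<Longrightarrow> e > 0 \<Longrightarrow>
      \<exists>d>0. \<forall>t\<in>{0..T}. \<bar>t - s\<bar> < d \<longrightarrow> integral {0..1} (\<lambda>x. \<bar>R t x - R s x\<bar>) < e"
    and f: "continuous_on ({0..T} \<times> {0..1}) (\<lambda>(t, x). f t x)"
  shows "continuous_on {0..T} (\<lambda>t. integral {0..1} (\<lambda>x. R t x * f t x))"
    and "\<And>t. t \<in> {0..T} \<Longrightarrow> (\<lambda>x. R t x * f t x) absolutely_integrable_on {0..1}"
proof -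
  have prod: "(\<lambda>x. R s x * f t x) absolutely_integrable_on {0..1}" if "s \<in> {0..T}" "t \<in> {0..T}" for s t
    using absint_mult_continuous[OF continuous_on_slices(1)[OF f that(2)] R[OF that(1)]] by (simp add: mult.commute)
  show "(\<lambda>x. R t x * f t x) absolutely_integrable_on {0..1}" if "t \<in> {0..T}" for t
    using prod that by blast
  obtain M where M: "M > 0" "\<And>t x. t \<in> {0..T} \<Longrightarrow> x \<in> {0..1} \<Longrightarrow> \<bar>f t x\<bar> \<le> M"
    using continuous_on_rect_bounded[OF f] by blast
  have uc: "uniformly_continuous_on ({0..T} \<times> {0..1}) (\<lambda>(t, x). f t x)"
    by (intro compact_uniformly_continuous f compact_Times compact_Icc)
  show "continuous_on {0..T} (\<lambda>t. integral {0..1} (\<lambda>x. R t x * f t x))"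
    unfolding continuous_on_iff
  proof (intro ballI allI impI)
    fix s e :: real assume s: "s \<in> {0..T}" and e: "e > 0"
    define I where "I = integral {0..1} (\<lambda>x. \<bar>R s x\<bar>)"
    have I0: "I \<ge> 0"
      unfolding I_def using absint_imp_integrable[OF absint_abs[OF R[OF s]]] by (intro integral_nonneg) auto
    define c where "c = e / (2 * (I + 1))"
    have c: "c > 0" using e I0 by (simp add: c_def)
    then obtain d1 where d1: "d1 > 0" "\<And>z z'. z \<in> {0..T} \<times> {0..1} \<Longrightarrow> z' \<in> {0..T} \<times> {0..1} \<Longrightarrow>
        dist z' z < d1 \<Longrightarrow> dist (case z' of (t, x) \<Rightarrow> f t x) (case z of (t, x) \<Rightarrow> f t x) < c"
      using uc unfolding uniformly_continuous_on_def by metis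
    have "e / (2 * M) > 0" using e M by simp
    from cont[OF s this] obtain d2 where d2: "d2 > 0" "\<And>t. t \<in> {0..T} \<Longrightarrow> \<bar>t - s\<bar> < d2 \<Longrightarrow>
        integral {0..1} (\<lambda>x. \<bar>R t x - R s x\<bar>) < e / (2 * M)"
      by blast
    show "\<exists>d>0. \<forall>t\<in>{0..T}. dist t s < d \<longrightarrow>
        dist (integral {0..1} (\<lambda>x. R t x * f t x)) (integral {0..1} (\<lambda>x. R s x * f s x)) < e"
    proof (intro exI[of _ "min d1 d2"] conjI ballI impI)
      fix t assume t: "t \<in> {0..T}" "dist t s < min d1 d2"
      define D where "D = integral {0..1} (\<lambda>x. \<bar>R t x - R s x\<bar>)"
      have D: "D < e / (2 * M)" unfolding D_def using t by (intro d2(2)) (auto simp: dist_real_def)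
      have dabs: "(\<lambda>x. \<bar>R t x - R s x\<bar>) absolutely_integrable_on {0..1}"
        by (intro absint_abs set_integral_diff(1) R s t)
      have diff: "integral {0..1} (\<lambda>x. R t x * f t x) - integral {0..1} (\<lambda>x. R s x * f s x)
          = integral {0..1} (\<lambda>x. R t x * f t x - R s x * f s x)"
        by (rule Henstock_Kurzweil_Integration.integral_diff[symmetric]; intro absint_imp_integrable prod s t)
      have "\<bar>integral {0..1} (\<lambda>x. R t x * f t x - R s x * f s x)\<bar>
          \<le> integral {0..1} (\<lambda>x. M * \<bar>R t x - R s x\<bar> + c * \<bar>R s x\<bar>)"
      proof (rule integral_norm_bound_integral[where 'a=real, simplified])
        show "(\<lambda>x. R t x * f t x - R s x * f s x) integrable_on {0..1}"
          by (rule absint_imp_integrable[OF set_integral_diff(1)[OF prod[OF t(1) t(1)] prod[OF s s]]])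
        show "(\<lambda>x. M * \<bar>R t x - R s x\<bar> + c * \<bar>R s x\<bar>) integrable_on {0..1}"
          by (intro integrable_add integrable_on_mult_right absint_imp_integrable dabs absint_abs R s)
        fix x :: real assume x: "x \<in> {0..1}"
        have "\<bar>f t x - f s x\<bar> < c"
          using d1(2)[of "(s, x)" "(t, x)"] s t x by (auto simp: dist_Pair_Pair dist_real_def)
        then have 1: "\<bar>f t x - f s x\<bar> * \<bar>R s x\<bar> \<le> c * \<bar>R s x\<bar>"
          by (intro mult_right_mono) auto
        have 2: "\<bar>f t x\<bar> * \<bar>R t x - R s x\<bar> \<le> M * \<bar>R t x - R s x\<bar>"
          by (intro mult_right_mono M t x) auto
        have "R t x * f t x - R s x * f s x = f t x * (R t x - R s x) + (f t x - f s x) * R s x"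
          by (simp add: algebra_simps)
        then have "\<bar>R t x * f t x - R s x * f s x\<bar> \<le> \<bar>f t x\<bar> * \<bar>R t x - R s x\<bar> + \<bar>f t x - f s x\<bar> * \<bar>R s x\<bar>"
          by (metis abs_mult abs_triangle_ineq)
        then show "\<bar>R t x * f t x - R s x * f s x\<bar> \<le> M * \<bar>R t x - R s x\<bar> + c * \<bar>R s x\<bar>"
          using 1 2 by linarith
      qed
      moreover have "integral {0..1} (\<lambda>x. M * \<bar>R t x - R s x\<bar> + c * \<bar>R s x\<bar>) = M * D + c * I"
        unfolding D_def I_def
        by (intro integral_unique has_integral_add has_integral_mult_right integrable_integral absint_imp_integrable
            dabs absint_abs R s)
      moreover have "M * D + c * I < M * (e / (2 * M)) + c * (I + 1)"
        using D M(1) c by (intro add_less_le_mono mult_strict_left_mono mult_left_mono) auto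
      moreover have "M * (e / (2 * M)) + c * (I + 1) = e"
        using M(1) I0 by (simp add: c_def field_simps)
      ultimately show "dist (integral {0..1} (\<lambda>x. R t x * f t x)) (integral {0..1} (\<lambda>x. R s x * f s x)) < e"
        by (simp add: dist_real_def diff)
    qed (use d1(1) d2(1) in simp)
  qed
qed

lemma transport_integral_continuous:
  fixes q \<xi> :: "real \<Rightarrow> real" and f :: "real \<Rightarrow> real \<Rightarrow> real"
  assumes q: "q absolutely_integrable_on {A..B}"
    and \<xi>: "continuous_on {0..T} \<xi>" "\<And>t. t \<in> {0..T} \<Longrightarrow> \<xi> t \<in> {A+1..B}"
    and f: "continuous_on ({0..T} \<times> {0..1}) (\<lambda>(t, x). f t x)"
  shows "continuous_on {0..T} (\<lambda>t. integral {0..1} (\<lambda>x. q (\<xi> t - x) * f t x))"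
    and "\<And>t. t \<in> {0..T} \<Longrightarrow> (\<lambda>x. q (\<xi> t - x) * f t x) absolutely_integrable_on {0..1}"
proof -
  have R: "(\<lambda>x. q (\<xi> t - x)) absolutely_integrable_on {0..1}" if "t \<in> {0..T}" for t
    by (rule absint_window, rule absolutely_integrable_on_subinterval[OF q]) (use \<xi>(2)[OF that] in auto)
  have cont: "\<exists>d>0. \<forall>t\<in>{0..T}. \<bar>t - s\<bar> < d \<longrightarrow> integral {0..1} (\<lambda>x. \<bar>q (\<xi> t - x) - q (\<xi> s - x)\<bar>) < e"
    if s: "s \<in> {0..T}" and e: "e > 0" for s e
  proof -
    obtain d1 where d1: "d1 > 0"
      "\<And>u u'. u \<in> {A+1..B} \<Longrightarrow> u' \<in> {A+1..B} \<Longrightarrow> \<bar>u - u'\<bar> < d1 \<Longrightarrow>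
         integral {0..1} (\<lambda>x. \<bar>q (u - x) - q (u' - x)\<bar>) < e" using translation_L1[OF q e] by blast
    obtain d2 where d2: "d2 > 0" "\<And>t. t \<in> {0..T} \<Longrightarrow> \<bar>t - s\<bar> < d2 \<Longrightarrow> \<bar>\<xi> t - \<xi> s\<bar> < d1"
      using \<xi>(1) s d1(1) unfolding continuous_on_iff dist_real_def by metis
    show ?thesis
      by (rule exI[of _ d2], rule conjI[OF d2(1)], intro ballI impI d1(2) \<xi>(2) d2(2) s)
  qed
  show "continuous_on {0..T} (\<lambda>t. integral {0..1} (\<lambda>x. q (\<xi> t - x) * f t x))"
    by (rule L1_continuous_pairing(1)[OF _ _ f]) (fact R cont)+
  show "(\<lambda>x. q (\<xi> t - x) * f t x) absolutely_integrable_on {0..1}" if "t \<in> {0..T}" for t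
    by (rule L1_continuous_pairing(2)[OF _ _ f that]) (fact R cont)+
qed

section \<open>Transport of an integrable profile\<close>

lemma positive_derivative_bijection:
  fixes \<xi> v :: "real \<Rightarrow> real"
  assumes \<xi>: "\<And>t. t \<in> {0..T} \<Longrightarrow> (\<xi> has_real_derivative v t) (at t within {0..T})"
    and v: "\<And>t. t \<in> {0..T} \<Longrightarrow> v t > 0" and T: "0 \<le> T"
  shows "inj_on \<xi> {0..T}" "\<xi> ` {0..T} = {\<xi> 0..\<xi> T}" "continuous_on {0..T} \<xi>"
proof -
  have mono: "\<xi> s < \<xi> t" if "0 \<le> s" "s < t" "t \<le> T" for s t
  proof (rule DERIV_pos_imp_increasing_open[OF that(2)])
    fix x assume x: "s < x" "x < t"
    have "(\<xi> has_real_derivative v x) (at x)"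
      using \<xi>[of x] x that at_within_interior[of x "{0..T}"] by (auto simp: interior_atLeastAtMost_real)
    then show "\<exists>y. (\<xi> has_real_derivative y) (at x) \<and> 0 < y" using v x that by auto
  next
    have "continuous_on {0..T} \<xi>" using \<xi> by (meson DERIV_continuous continuous_on_eq_continuous_within)
    then show "continuous_on {s..t} \<xi>" by (rule continuous_on_subset) (use that in auto)
  qed
  have inj: "inj_on \<xi> {0..T}"
    unfolding inj_on_def by (metis mono atLeastAtMost_iff linorder_neqE less_irrefl)
  have \<xi>c: "continuous_on {0..T} \<xi>" using \<xi> by (meson DERIV_continuous continuous_on_eq_continuous_within)
  have img: "\<xi> ` {0..T} = {\<xi> 0..\<xi> T}"
  proof
    show "\<xi> ` {0..T} \<subseteq> {\<xi> 0..\<xi> T}"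
      using mono T by (force simp: le_less)
    show "{\<xi> 0..\<xi> T} \<subseteq> \<xi> ` {0..T}"
      using IVT'[of \<xi> 0 _ T, OF _ _ T \<xi>c] by force
  qed
  show "inj_on \<xi> {0..T}" "\<xi> ` {0..T} = {\<xi> 0..\<xi> T}" "continuous_on {0..T} \<xi>" by fact+
qed

lemma absint_increasing_substitution:
  fixes q \<xi> v :: "real \<Rightarrow> real"
  assumes \<xi>: "\<And>t. t \<in> {0..T} \<Longrightarrow> (\<xi> has_real_derivative v t) (at t within {0..T})"
    and v: "\<And>t. t \<in> {0..T} \<Longrightarrow> v t > 0" and T: "0 \<le> T"
    and q: "q absolutely_integrable_on {\<xi> 0..\<xi> T}"
  shows "(\<lambda>t. v t * q (\<xi> t)) absolutely_integrable_on {0..T}"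
    and "integral {0..T} (\<lambda>t. v t * q (\<xi> t)) = integral {\<xi> 0..\<xi> T} q"
proof -
  have inj: "inj_on \<xi> {0..T}" and img: "\<xi> ` {0..T} = {\<xi> 0..\<xi> T}"
    by (rule positive_derivative_bijection[of T \<xi> v]; fact assms)+
  have der: "(\<xi> has_real_derivative v t) (at t within {0..T})" if "t \<in> {0..T}" for t
    by (rule \<xi>[OF that])
  have "(\<lambda>t. \<bar>v t\<bar> * q (\<xi> t)) absolutely_integrable_on {0..T} \<and>
      integral {0..T} (\<lambda>t. \<bar>v t\<bar> * q (\<xi> t)) = integral {\<xi> 0..\<xi> T} q"
    using has_absolute_integral_change_of_variables_1'[of "{0..T}" \<xi> v q "integral {\<xi> 0..\<xi> T} q", OF _ der inj] q
    by (simp add: img)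
  moreover have "\<And>t. t \<in> {0..T} \<Longrightarrow> \<bar>v t\<bar> * q (\<xi> t) = v t * q (\<xi> t)" using v by (simp add: less_imp_le)
  moreover have "integral {0..T} (\<lambda>t. \<bar>v t\<bar> * q (\<xi> t)) = integral {0..T} (\<lambda>t. v t * q (\<xi> t))"
    using calculation(2) by (intro integral_cong)
  moreover have "(\<lambda>t. \<bar>v t\<bar> * q (\<xi> t)) absolutely_integrable_on {0..T} \<longleftrightarrow>
      (\<lambda>t. v t * q (\<xi> t)) absolutely_integrable_on {0..T}"
    using calculation(2) by (intro set_integrable_cong refl)
  ultimately show "(\<lambda>t. v t * q (\<xi> t)) absolutely_integrable_on {0..T}"
    and "integral {0..T} (\<lambda>t. v t * q (\<xi> t)) = integral {\<xi> 0..\<xi> T} q"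
    by simp_all
qed

lemma C1_rectD:
  assumes "C1_rect \<tau> \<phi> \<phi>t \<phi>x"
  shows "continuous_on ({0..\<tau>} \<times> {0..1}) (\<lambda>(t, x). \<phi> t x)"
    and "\<And>t x. t \<in> {0..\<tau>} \<Longrightarrow> x \<in> {0..1} \<Longrightarrow> ((\<lambda>s. \<phi> s x) has_real_derivative \<phi>t t x) (at t within {0..\<tau>})"
    and "\<And>t x. t \<in> {0..\<tau>} \<Longrightarrow> x \<in> {0..1} \<Longrightarrow> (\<phi> t has_real_derivative \<phi>x t x) (at x within {0..1})"
proof -
  have d: "((\<lambda>(s, z). \<phi> s z) has_derivative (\<lambda>(h, j). \<phi>t t x * h + \<phi>x t x * j))
          (at (t, x) within {0..\<tau>} \<times> {0..1})" if "t \<in> {0..\<tau>}" "x \<in> {0..1}" for t x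
    using assms that unfolding C1_rect_def by auto
  show "continuous_on ({0..\<tau>} \<times> {0..1}) (\<lambda>(t, x). \<phi> t x)"
    unfolding continuous_on_eq_continuous_within using d has_derivative_continuous by fast
  fix t x :: real assume tx: "t \<in> {0..\<tau>}" "x \<in> {0..1}"
  have "((\<lambda>s. (s, x)) has_derivative (\<lambda>h. (h, 0))) (at t within {0..\<tau>})"
    by (auto intro!: derivative_eq_intros)
  moreover have "((\<lambda>(s, z). \<phi> s z) has_derivative (\<lambda>(h, j). \<phi>t t x * h + \<phi>x t x * j))
          (at (t, x) within (\<lambda>s. (s, x)) ` {0..\<tau>})"
    by (rule has_derivative_subset[OF d[OF tx]]) (use tx in auto)
  ultimately show "((\<lambda>s. \<phi> s x) has_real_derivative \<phi>t t x) (at t within {0..\<tau>})"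
    unfolding has_field_derivative_def
    by (rule has_derivative_in_compose[THEN has_derivative_eq_rhs, of "\<lambda>s. (s, x)" _ t "{0..\<tau>}" "\<lambda>(s, z). \<phi> s z", unfolded prod.case])
      (auto simp: mult.commute)
  have "((\<lambda>z. (t, z)) has_derivative (\<lambda>h. (0, h))) (at x within {0..1})"
    by (auto intro!: derivative_eq_intros)
  moreover have "((\<lambda>(s, z). \<phi> s z) has_derivative (\<lambda>(h, j). \<phi>t t x * h + \<phi>x t x * j))
          (at (t, x) within (\<lambda>z. (t, z)) ` {0..1})"
    by (rule has_derivative_subset[OF d[OF tx]]) (use tx in auto)
  ultimately show "(\<phi> t has_real_derivative \<phi>x t x) (at x within {0..1})"
    unfolding has_field_derivative_def
    by (rule has_derivative_in_compose[THEN has_derivative_eq_rhs, of "\<lambda>z. (t, z)" _ x "{0..1}" "\<lambda>(s, z). \<phi> s z", unfolded prod.case])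
      (auto simp: mult.commute)
qed

text \<open>
  For a differentiable profile \<open>p\<close>, the function \<open>p (\<xi> t - x)\<close> solves the transport equation with
  velocity \<open>v\<close>.  Its integral against \<open>\<phi> t\<close> is differentiated in time by the Leibniz rule, and an
  integration by parts in space produces the boundary terms.
\<close>

lemma transport_identity_smooth:
  fixes p p' \<xi> v :: "real \<Rightarrow> real" and \<phi> \<phi>t \<phi>x :: "real \<Rightarrow> real \<Rightarrow> real"
  assumes T: "0 \<le> \<tau>" and \<xi>0: "\<xi> 0 = 0"
    and \<xi>: "\<And>t. t \<in> {0..\<tau>} \<Longrightarrow> (\<xi> has_real_derivative v t) (at t within {0..\<tau>})"
    and v: "continuous_on {0..\<tau>} v"
    and p: "\<And>x. (p has_real_derivative p' x) (at x)" "continuous_on UNIV p" "continuous_on UNIV p'"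
    and C1: "C1_rect \<tau> \<phi> \<phi>t \<phi>x" and end0: "\<And>x. x \<in> {0..1} \<Longrightarrow> \<phi> \<tau> x = 0"
  shows "integral {0..\<tau>} (\<lambda>t. integral {0..1} (\<lambda>x. p (\<xi> t - x) * (\<phi>t t x + v t * \<phi>x t x)))
      + integral {0..1} (\<lambda>x. p (- x) * \<phi> 0 x)
      = integral {0..\<tau>} (\<lambda>t. v t * (p (\<xi> t - 1) * \<phi> t 1 - p (\<xi> t) * \<phi> t 0))"
proof -
  let ?R = "{0..\<tau>} \<times> {0..1::real}"
  note \<phi>c = C1_rectD(1)[OF C1]
  have tc: "continuous_on ?R (\<lambda>(t, x). \<phi>t t x)" and xc: "continuous_on ?R (\<lambda>(t, x). \<phi>x t x)"
    using C1 unfolding C1_rect_def by auto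
  have \<xi>c: "continuous_on {0..\<tau>} \<xi>" using \<xi> by (meson DERIV_continuous continuous_on_eq_continuous_within)
  have \<xi>c2: "continuous_on ?R (\<lambda>z. \<xi> (fst z))" and vc2: "continuous_on ?R (\<lambda>z. v (fst z))"
    using continuous_on_fst_snd(1)[OF \<xi>c] continuous_on_fst_snd(1)[OF v] by (simp_all add: split_beta)
  have pc2: "continuous_on ?R (\<lambda>z. p (\<xi> (fst z) - snd z))"
    by (rule continuous_on_compose2[OF p(2)]) (auto intro!: continuous_intros \<xi>c2)
  have pc2': "continuous_on ?R (\<lambda>z. p' (\<xi> (fst z) - snd z))"
    by (rule continuous_on_compose2[OF p(3)]) (auto intro!: continuous_intros \<xi>c2)
  define fx where "fx t x = p' (\<xi> t - x) * v t * \<phi> t x + p (\<xi> t - x) * \<phi>t t x" for t x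
  have fxc: "continuous_on ?R (\<lambda>(t, x). fx t x)"
    using \<phi>c tc pc2 pc2' vc2 unfolding fx_def split_beta by (intro continuous_intros) auto
  define N where "N t = integral {0..1} (\<lambda>x. p (\<xi> t - x) * \<phi> t x)" for t
  have pcx: "continuous_on X (\<lambda>x. p (s - x))" "continuous_on X (\<lambda>x. p' (s - x))" for s X
    by (rule continuous_on_compose2[OF p(2)] continuous_on_compose2[OF p(3)]; auto intro!: continuous_intros)+
  have Nder: "(N has_vector_derivative integral {0..1} (fx t)) (at t within {0..\<tau>})"
    if t: "t \<in> {0..\<tau>}" for t
  proof -
    have "((\<lambda>t. integral (cbox 0 1) (\<lambda>x. p (\<xi> t - x) * \<phi> t x)) has_field_derivative
        integral (cbox 0 1) (fx t)) (at t within {0..\<tau>})"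
    proof (rule leibniz_rule_field_derivative)
      fix s x :: real assume "s \<in> {0..\<tau>}" "x \<in> cbox 0 1"
      then show "((\<lambda>s. p (\<xi> s - x) * \<phi> s x) has_real_derivative fx s x) (at s within {0..\<tau>})"
        unfolding fx_def
        by (auto intro!: derivative_eq_intros DERIV_chain2[OF p(1)] \<xi> C1_rectD(2)[OF C1])
    next
      fix s :: real assume "s \<in> {0..\<tau>}"
      then show "(\<lambda>x. p (\<xi> s - x) * \<phi> s x) integrable_on cbox 0 1"
        using continuous_on_slices(1)[OF \<phi>c] pcx
        by (intro integrable_continuous continuous_intros) auto
    qed (use fxc t in auto)
    then show ?thesis by (simp add: N_def[abs_def] has_real_derivative_iff_has_vector_derivative)
  qed
  have "integral {0..\<tau>} (\<lambda>t. integral {0..1} (fx t)) = N \<tau> - N 0"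
    by (rule integral_unique, rule fundamental_theorem_of_calculus[OF T Nder])
  moreover have "N \<tau> = integral {0..1} (\<lambda>x::real. 0)"
    unfolding N_def using end0 by (intro integral_cong) simp
  ultimately have 1: "integral {0..\<tau>} (\<lambda>t. integral {0..1} (fx t)) = - integral {0..1} (\<lambda>x. p (- x) * \<phi> 0 x)"
    by (simp add: N_def \<xi>0)
  define J where "J t = integral {0..1} (\<lambda>x. p (\<xi> t - x) * (\<phi>t t x + v t * \<phi>x t x))" for t
  define b where "b t = v t * (p (\<xi> t - 1) * \<phi> t 1 - p (\<xi> t) * \<phi> t 0)" for t
  have Jc: "continuous_on {0..\<tau>} J"
  proof -
    have "continuous_on (cbox 0 \<tau>) (\<lambda>t. integral (cbox 0 1) (\<lambda>x. p (\<xi> t - x) * (\<phi>t t x + v t * \<phi>x t x)))"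
      by (rule integral_continuous_on_param)
        (use tc xc pc2 vc2 in \<open>auto simp: split_beta intro!: continuous_intros\<close>)
    then show ?thesis by (simp add: J_def)
  qed
  have bc: "continuous_on {0..\<tau>} b"
    unfolding b_def
    by (intro continuous_intros v continuous_on_slices(2)[OF \<phi>c] continuous_on_compose2[OF p(2)] \<xi>c) auto
  have "integral {0..1} (fx t) = J t - b t" if t: "t \<in> {0..\<tau>}" for t
  proof -
    have ftc: "((\<lambda>x. - p' (\<xi> t - x) * \<phi> t x + p (\<xi> t - x) * \<phi>x t x) has_integral
        (p (\<xi> t - 1) * \<phi> t 1 - p (\<xi> t - 0) * \<phi> t 0)) {0..1}"
      by (rule fundamental_theorem_of_calculus[where f="\<lambda>x. p (\<xi> t - x) * \<phi> t x"], simp,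
          unfold has_real_derivative_iff_has_vector_derivative[symmetric])
        (auto intro!: derivative_eq_intros DERIV_chain2[OF p(1)] C1_rectD(3)[OF C1] t)
    have iJ: "(\<lambda>x. p (\<xi> t - x) * (\<phi>t t x + v t * \<phi>x t x)) integrable_on {0..1}"
      by (intro integrable_continuous_interval continuous_intros pcx
          continuous_on_slices(1)[OF tc] continuous_on_slices(1)[OF xc] t)
    have "((\<lambda>x. p (\<xi> t - x) * (\<phi>t t x + v t * \<phi>x t x)
        - v t * (- p' (\<xi> t - x) * \<phi> t x + p (\<xi> t - x) * \<phi>x t x)) has_integral
        J t - v t * (p (\<xi> t - 1) * \<phi> t 1 - p (\<xi> t - 0) * \<phi> t 0)) {0..1}"
      unfolding J_def by (intro has_integral_diff has_integral_mult_right integrable_integral iJ ftc)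
    moreover have "(\<lambda>x. p (\<xi> t - x) * (\<phi>t t x + v t * \<phi>x t x)
        - v t * (- p' (\<xi> t - x) * \<phi> t x + p (\<xi> t - x) * \<phi>x t x)) = fx t"
      by (auto simp: fx_def algebra_simps)
    ultimately show ?thesis by (simp add: b_def integral_unique)
  qed
  then have "integral {0..\<tau>} (\<lambda>t. integral {0..1} (fx t)) = integral {0..\<tau>} (\<lambda>t. J t - b t)"
    by (intro integral_cong) simp
  also have "\<dots> = integral {0..\<tau>} J - integral {0..\<tau>} b"
    by (intro Henstock_Kurzweil_Integration.integral_diff integrable_continuous_interval Jc bc)
  finally show ?thesis using 1 unfolding J_def b_def by simp
qed

text \<open>
  An integrable profile has neither a derivative nor values at single points, but all terms of
  the identity are linear in the profile and bounded by a multiple of its integral norm over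
  \<open>[-1, \<xi> \<tau>]\<close>, so the identity carries over from smooth profiles.  For the boundary terms the bound is
  the substitution \<open>s = \<xi> t\<close>: the velocity in front of them is its Jacobian.
\<close>

lemma transport_identity:
  fixes g \<xi> v :: "real \<Rightarrow> real" and \<phi> \<phi>t \<phi>x :: "real \<Rightarrow> real \<Rightarrow> real"
  assumes T: "0 \<le> \<tau>" and \<xi>0: "\<xi> 0 = 0"
    and \<xi>: "\<And>t. t \<in> {0..\<tau>} \<Longrightarrow> (\<xi> has_real_derivative v t) (at t within {0..\<tau>})"
    and v: "continuous_on {0..\<tau>} v" "\<And>t. t \<in> {0..\<tau>} \<Longrightarrow> v t > 0"
    and g: "g absolutely_integrable_on {-1..\<xi> \<tau>}"
    and C1: "C1_rect \<tau> \<phi> \<phi>t \<phi>x" and end0: "\<And>x. x \<in> {0..1} \<Longrightarrow> \<phi> \<tau> x = 0"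
  shows "integral {0..\<tau>} (\<lambda>t. integral {0..1} (\<lambda>x. g (\<xi> t - x) * (\<phi>t t x + v t * \<phi>x t x)))
      + integral {0..1} (\<lambda>x. g (- x) * \<phi> 0 x)
      = integral {0..\<tau>} (\<lambda>t. v t * (g (\<xi> t - 1) * \<phi> t 1 - g (\<xi> t) * \<phi> t 0))"
proof -
  let ?R = "{0..\<tau>} \<times> {0..1::real}"
  define f where "f t x = \<phi>t t x + v t * \<phi>x t x" for t x
  note \<phi>c = C1_rectD(1)[OF C1]
  have tc: "continuous_on ?R (\<lambda>(t, x). \<phi>t t x)" and xc: "continuous_on ?R (\<lambda>(t, x). \<phi>x t x)"
    using C1 unfolding C1_rect_def by auto
  have vc2: "continuous_on ?R (\<lambda>z. v (fst z))"
    using continuous_on_fst_snd(1)[OF v(1)] by (simp add: split_beta)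
  have fc: "continuous_on ?R (\<lambda>(t, x). f t x)"
    unfolding f_def using tc xc vc2 by (auto simp: split_beta intro!: continuous_intros)
  note bij = positive_derivative_bijection[OF \<xi> v(2) T]
  have \<xi>r: "\<xi> t \<in> {-1 + 1..\<xi> \<tau>}" if "t \<in> {0..\<tau>}" for t
    using bij(2) that \<xi>0 by auto
  have S0: "\<xi> \<tau> \<ge> 0" using \<xi>r[of \<tau>] T by auto
  obtain M where M: "M > 0" "\<And>t x. t \<in> {0..\<tau>} \<Longrightarrow> x \<in> {0..1} \<Longrightarrow> \<bar>f t x\<bar> \<le> M" using continuous_on_rect_bounded[OF fc] by blast
  obtain P where P: "P > 0" "\<And>t x. t \<in> {0..\<tau>} \<Longrightarrow> x \<in> {0..1} \<Longrightarrow> \<bar>\<phi> t x\<bar> \<le> P" using continuous_on_rect_bounded[OF \<phi>c] by blast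
  define J where "J q t = integral {0..1} (\<lambda>x. q (\<xi> t - x) * f t x)" for q t
  define b where "b q t = v t * (q (\<xi> t - 1) * \<phi> t 1 - q (\<xi> t) * \<phi> t 0)" for q t
  \<comment> \<open>The defect of the identity as a functional of the profile: it is linear, bounded, and zero on smooth profiles.\<close>
  define E where "E q = integral {0..\<tau>} (J q) + integral {0..1} (\<lambda>x. q (- x) * \<phi> 0 x) - integral {0..\<tau>} (b q)" for q
  define I where "I = {-1..\<xi> \<tau>}"
  have sub: "q absolutely_integrable_on {c..d}" if "q absolutely_integrable_on I" "-1 \<le> c" "d \<le> \<xi> \<tau>"
    for q :: "real \<Rightarrow> real" and c d
    by (rule absolutely_integrable_on_subinterval[OF that(1)]) (use that in \<open>auto simp: I_def\<close>)
  have subst: "(\<lambda>t. v t * q (\<xi> t - c)) absolutely_integrable_on {0..\<tau>}"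
    "integral {0..\<tau>} (\<lambda>t. v t * q (\<xi> t - c)) = integral {- c..\<xi> \<tau> - c} q"
    if "q absolutely_integrable_on I" "c \<in> {0, 1}" for q :: "real \<Rightarrow> real" and c
  proof -
    have d: "((\<lambda>t. \<xi> t - c) has_real_derivative v t) (at t within {0..\<tau>})" if "t \<in> {0..\<tau>}" for t
      using \<xi>[OF that] by (auto intro!: derivative_eq_intros)
    have q: "q absolutely_integrable_on {\<xi> 0 - c..\<xi> \<tau> - c}"
      by (rule sub[OF that(1)]) (use that(2) \<xi>0 in auto)
    show "(\<lambda>t. v t * q (\<xi> t - c)) absolutely_integrable_on {0..\<tau>}"
      "integral {0..\<tau>} (\<lambda>t. v t * q (\<xi> t - c)) = integral {- c..\<xi> \<tau> - c} q"
      using absint_increasing_substitution[OF d v(2) T q] by (simp_all add: \<xi>0)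
  qed
  have J: "continuous_on {0..\<tau>} (J q)" "\<And>t. t \<in> {0..\<tau>} \<Longrightarrow> (\<lambda>x. q (\<xi> t - x) * f t x) absolutely_integrable_on {0..1}"
    if "q absolutely_integrable_on I" for q :: "real \<Rightarrow> real"
    using transport_integral_continuous[OF that[unfolded I_def] bij(3) \<xi>r fc] unfolding J_def by auto
  have Jai: "J q absolutely_integrable_on {0..\<tau>}" if "q absolutely_integrable_on I" for q
    by (rule absolutely_integrable_continuous_real[OF J(1)[OF that]])
  have Dai: "(\<lambda>x. q (- x) * \<phi> 0 x) absolutely_integrable_on {0..1}" if q: "q absolutely_integrable_on I" for q :: "real \<Rightarrow> real"
  proof -
    have "(\<lambda>x. \<phi> 0 x * q (0 - x)) absolutely_integrable_on {0..1}"
      by (intro absint_mult_continuous continuous_on_slices(1)[OF \<phi>c] absint_window sub[OF q]) (use S0 T in auto)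
    then show ?thesis by (simp add: mult.commute)
  qed
  have bai1: "(\<lambda>t. \<phi> t c * (v t * q (\<xi> t - c))) absolutely_integrable_on {0..\<tau>}"
    if "q absolutely_integrable_on I" "c \<in> {0, 1}" for q :: "real \<Rightarrow> real" and c
    by (intro absint_mult_continuous continuous_on_slices(2)[OF \<phi>c] subst that) (use that in auto)
  have b_eq: "b q = (\<lambda>t. \<phi> t 1 * (v t * q (\<xi> t - 1)) - \<phi> t 0 * (v t * q (\<xi> t - 0)))" for q
    by (auto simp: b_def algebra_simps)
  have bai: "b q absolutely_integrable_on {0..\<tau>}" if "q absolutely_integrable_on I" for q
    unfolding b_eq by (intro set_integral_diff bai1 that) auto
  have lin: "E (\<lambda>x. q x - p x) = E q - E p"
    if q: "q absolutely_integrable_on I" and p: "p absolutely_integrable_on I" for p q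
  proof -
    have "integral {0..\<tau>} (J (\<lambda>x. q x - p x)) = integral {0..\<tau>} (\<lambda>t. J q t - J p t)"
    proof (rule integral_cong)
      fix t assume t: "t \<in> {0..\<tau>}"
      show "J (\<lambda>x. q x - p x) t = J q t - J p t"
        unfolding J_def left_diff_distrib
        by (intro Henstock_Kurzweil_Integration.integral_diff absint_imp_integrable J(2) p q t)
    qed
    moreover have "integral {0..1} (\<lambda>x. (q (- x) - p (- x)) * \<phi> 0 x)
       = integral {0..1} (\<lambda>x. q (- x) * \<phi> 0 x) - integral {0..1} (\<lambda>x. p (- x) * \<phi> 0 x)"
      unfolding left_diff_distrib
      by (intro Henstock_Kurzweil_Integration.integral_diff absint_imp_integrable Dai p q)
    moreover have "b (\<lambda>x. q x - p x) = (\<lambda>t. b q t - b p t)"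
      by (auto simp: b_def algebra_simps)
    ultimately show ?thesis
      unfolding E_def
      by (simp add: Henstock_Kurzweil_Integration.integral_diff absint_imp_integrable Jai bai p q)
  qed
  define K where "K = \<tau> * M + P + (P + P)"
  have bound: "\<bar>E q\<bar> \<le> K * integral I (\<lambda>x. \<bar>q x\<bar>)" if q: "q absolutely_integrable_on I" for q
  proof -
    define Q where "Q = integral I (\<lambda>x. \<bar>q x\<bar>)"
    have aq: "(\<lambda>x. \<bar>q x\<bar>) absolutely_integrable_on I" by (rule absint_abs[OF q])
    have Qs: "integral {c..d} (\<lambda>x. \<bar>q x\<bar>) \<le> Q" if "-1 \<le> c" "d \<le> \<xi> \<tau>" for c d
      unfolding Q_def
      by (rule integral_subset_le) (use that aq sub[OF aq] in \<open>auto simp: I_def intro!: absint_imp_integrable\<close>)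
    have Q0: "Q \<ge> 0" unfolding Q_def by (rule integral_nonneg) (auto intro!: absint_imp_integrable aq)
    have J1: "\<bar>J q t\<bar> \<le> M * Q" if t: "t \<in> {0..\<tau>}" for t
    proof -
      have aw: "(\<lambda>x. \<bar>q (\<xi> t - x)\<bar>) absolutely_integrable_on {0..1}"
        using \<xi>r[OF t] by (intro absint_window[where f="\<lambda>x. \<bar>q x\<bar>"] sub[OF aq]) auto
      have "\<bar>J q t\<bar> \<le> integral {0..1} (\<lambda>x. M * \<bar>q (\<xi> t - x)\<bar>)"
        unfolding J_def
      proof (rule integral_norm_bound_integral[where 'a=real, simplified])
        fix x :: real assume "x \<in> {0..1}"
        then show "\<bar>q (\<xi> t - x) * f t x\<bar> \<le> M * \<bar>q (\<xi> t - x)\<bar>"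
          using mult_right_mono[OF M(2)[OF t], of x "\<bar>q (\<xi> t - x)\<bar>"] by (simp add: abs_mult mult.commute)
      qed (use aw J(2)[OF q t] absint_imp_integrable in auto)
      also have "\<dots> = M * integral {\<xi> t - 1..\<xi> t} (\<lambda>x. \<bar>q x\<bar>)"
        using integral_window[of "\<lambda>x. \<bar>q x\<bar>" "\<xi> t"] by simp
      also have "\<dots> \<le> M * Q" using \<xi>r[OF t] M(1) by (intro mult_left_mono Qs) auto
      finally show ?thesis .
    qed
    have "\<bar>integral {0..\<tau>} (J q)\<bar> \<le> integral {0..\<tau>} (\<lambda>t. M * Q)"
      by (rule integral_norm_bound_integral[where 'a=real, simplified])
        (use J1 in \<open>auto intro!: absint_imp_integrable Jai q\<close>)
    then have b1: "\<bar>integral {0..\<tau>} (J q)\<bar> \<le> \<tau> * M * Q" using T by (simp add: mult_ac)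
    have "\<bar>integral {0..1} (\<lambda>x. q (- x) * \<phi> 0 x)\<bar> \<le> integral {0..1} (\<lambda>x. P * \<bar>q (- x)\<bar>)"
    proof (rule integral_norm_bound_integral[where 'a=real, simplified])
      fix x :: real assume "x \<in> {0..1}"
      then show "\<bar>q (- x) * \<phi> 0 x\<bar> \<le> P * \<bar>q (- x)\<bar>"
        using mult_right_mono[OF P(2), of 0 x "\<bar>q (- x)\<bar>"] T by (simp add: abs_mult mult.commute)
    next
      show "(\<lambda>x. P * \<bar>q (- x)\<bar>) integrable_on {0..1}"
        using absint_window[OF sub[OF aq], of 0] S0 by (auto intro!: absint_imp_integrable)
    qed (use Dai[OF q] absint_imp_integrable in auto)
    also have "\<dots> = P * integral {0 - 1..0} (\<lambda>x. \<bar>q x\<bar>)"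
      using integral_window[of "\<lambda>x. \<bar>q x\<bar>" 0] by simp
    also have "\<dots> \<le> P * Q" using S0 P(1) by (intro mult_left_mono Qs) auto
    finally have b2: "\<bar>integral {0..1} (\<lambda>x. q (- x) * \<phi> 0 x)\<bar> \<le> P * Q" .
    have b3: "\<bar>integral {0..\<tau>} (\<lambda>t. \<phi> t c * (v t * q (\<xi> t - c)))\<bar> \<le> P * Q" if c: "c \<in> {0, 1}" for c
    proof -
      have "\<bar>integral {0..\<tau>} (\<lambda>t. \<phi> t c * (v t * q (\<xi> t - c)))\<bar> \<le> integral {0..\<tau>} (\<lambda>t. P * (v t * \<bar>q (\<xi> t - c)\<bar>))"
      proof (rule integral_norm_bound_integral[where 'a=real, simplified])
        fix t :: real assume t: "t \<in> {0..\<tau>}"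
        have "\<bar>\<phi> t c\<bar> * (v t * \<bar>q (\<xi> t - c)\<bar>) \<le> P * (v t * \<bar>q (\<xi> t - c)\<bar>)"
          using v(2)[OF t] c by (intro mult_right_mono P(2) t) auto
        then show "\<bar>\<phi> t c * (v t * q (\<xi> t - c))\<bar> \<le> P * (v t * \<bar>q (\<xi> t - c)\<bar>)"
          using v(2)[OF t] by (simp add: abs_mult)
      qed (use bai1[OF q c] subst(1)[OF aq c] absint_imp_integrable in auto)
      also have "\<dots> = P * integral {- c..\<xi> \<tau> - c} (\<lambda>x. \<bar>q x\<bar>)"
        using subst(2)[OF aq c] by simp
      also have "\<dots> \<le> P * Q" using c P(1) by (intro mult_left_mono Qs) auto
      finally show ?thesis .
    qed
    have "integral {0..\<tau>} (b q) = integral {0..\<tau>} (\<lambda>t. \<phi> t 1 * (v t * q (\<xi> t - 1)))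
        - integral {0..\<tau>} (\<lambda>t. \<phi> t 0 * (v t * q (\<xi> t - 0)))"
      unfolding b_eq
      by (intro Henstock_Kurzweil_Integration.integral_diff absint_imp_integrable bai1 q) auto
    then have "\<bar>integral {0..\<tau>} (b q)\<bar> \<le> P * Q + P * Q" using b3[of 0] b3[of 1] by auto
    then show ?thesis using b1 b2 unfolding E_def K_def Q_def[symmetric] by (simp add: distrib_right)
  qed
  have smooth: "E p = 0" if "\<And>x. (p has_real_derivative p' x) (at x)" "continuous_on UNIV p" "continuous_on UNIV p'" for p p'
    using transport_identity_smooth[OF T \<xi>0 \<xi> v(1) that C1 end0] unfolding E_def J_def b_def f_def by simp
  have gI: "g absolutely_integrable_on I" using g by (simp add: I_def)
  have K0: "K > 0" using M(1) P(1) T mult_nonneg_nonneg[of \<tau> M] unfolding K_def by linarith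
  have "\<bar>E g\<bar> \<le> e" if "e > 0" for e
  proof -
    have "e / K > 0" using that K0 by simp
    from absint_dense_C1[OF gI[unfolded I_def] this]
    obtain p p' where p: "\<And>x. (p has_real_derivative p' x) (at x)" "continuous_on UNIV p" "continuous_on UNIV p'"
      "integral I (\<lambda>x. \<bar>g x - p x\<bar>) < e / K" unfolding I_def by metis
    have pI: "p absolutely_integrable_on I"
      unfolding I_def by (rule absolutely_integrable_continuous_real) (rule continuous_on_subset[OF p(2)], simp)
    have "\<bar>E g\<bar> = \<bar>E (\<lambda>x. g x - p x)\<bar>" using lin[OF gI pI] smooth[OF p(1-3)] by simp
    also have "\<dots> \<le> K * integral I (\<lambda>x. \<bar>g x - p x\<bar>)" by (intro bound set_integral_diff gI pI)
    also have "\<dots> \<le> K * (e / K)" using p(4) K0 by (intro mult_left_mono) auto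
    finally show ?thesis using K0 by simp
  qed
  then have "\<bar>E g\<bar> \<le> 0" using field_le_epsilon by (metis add.left_neutral)
  then show ?thesis unfolding E_def J_def b_def f_def by simp
qed

section \<open>Square integrable functions on intervals\<close>

definition sqint :: "real set \<Rightarrow> (real \<Rightarrow> real) \<Rightarrow> bool" where
  "sqint S f \<longleftrightarrow> f absolutely_integrable_on S \<and> (\<lambda>x. (f x)\<^sup>2) absolutely_integrable_on S"

lemma sqint_mult:
  assumes "sqint {a..b} f" "sqint {a..b} g"
  shows "(\<lambda>x. f x * g x) absolutely_integrable_on {a..b}"
proof (rule measurable_bounded_by_integrable_imp_absolutely_integrable[where g="\<lambda>x. (f x)\<^sup>2 + (g x)\<^sup>2"])
  have "f \<in> borel_measurable (lebesgue_on {a..b})" "g \<in> borel_measurable (lebesgue_on {a..b})"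
    using assms absolutely_integrable_imp_integrable[where f=f and S="{a..b}"]
      absolutely_integrable_imp_integrable[where f=g and S="{a..b}"] unfolding sqint_def by auto
  then show "(\<lambda>x. f x * g x) \<in> borel_measurable (lebesgue_on {a..b})" by measurable
  show "(\<lambda>x. (f x)\<^sup>2 + (g x)\<^sup>2) integrable_on {a..b}"
    using assms unfolding sqint_def by (intro integrable_add absint_imp_integrable) auto
  show "norm (f x * g x) \<le> (f x)\<^sup>2 + (g x)\<^sup>2" for x
  proof -
    have "2 * \<bar>f x\<bar> * \<bar>g x\<bar> \<le> (f x)\<^sup>2 + (g x)\<^sup>2"
      using sum_squares_bound[of "\<bar>f x\<bar>" "\<bar>g x\<bar>"] by simp
    moreover have "0 \<le> \<bar>f x\<bar> * \<bar>g x\<bar>" by simp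
    ultimately show ?thesis unfolding real_norm_def abs_mult by linarith
  qed
qed simp

lemma sqint_cmult:
  assumes "sqint S f"
  shows "sqint S (\<lambda>x. c * f x)"
  using assms unfolding sqint_def power_mult_distrib by simp

lemma sqint_add:
  assumes "sqint {a..b} f" "sqint {a..b} g"
  shows "sqint {a..b} (\<lambda>x. f x + g x)"
proof -
  have "(\<lambda>x. ((f x)\<^sup>2 + (g x)\<^sup>2) + 2 * (f x * g x)) absolutely_integrable_on {a..b}"
    using sqint_mult[OF assms] assms unfolding sqint_def by (intro set_integral_add(1)) auto
  moreover have "(\<lambda>x. ((f x)\<^sup>2 + (g x)\<^sup>2) + 2 * (f x * g x)) = (\<lambda>x. (f x + g x)\<^sup>2)"
    by (auto simp: power2_sum)
  ultimately show ?thesis using assms unfolding sqint_def by auto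
qed

lemma sqint_diff:
  assumes "sqint {a..b} f" "sqint {a..b} g"
  shows "sqint {a..b} (\<lambda>x. f x - g x)"
  using sqint_add[OF assms(1) sqint_cmult[OF assms(2), of "-1"]] by simp

lemma sqint_continuous:
  assumes "continuous_on {a..b} f"
  shows "sqint {a..b} f"
  unfolding sqint_def using assms
  by (auto intro!: absolutely_integrable_continuous_real continuous_intros)

lemma sqint_subinterval:
  assumes "sqint {a..b} f" "a \<le> c" "d \<le> b"
  shows "sqint {c..d} f"
  using assms absolutely_integrable_on_subinterval[where S="{a..b}" and a=c and b=d]
  unfolding sqint_def by auto

lemma sqint_combine:
  assumes "sqint {a..b} f" "sqint {b..c} f" "a \<le> b" "b \<le> c"
  shows "sqint {a..c} f"
  using assms absolutely_integrable_on_combine[where a=a and c=b and b=c] unfolding sqint_def by auto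

lemma sqint_shift:
  assumes "sqint {a + c..b + c} f"
  shows "sqint {a..b} (\<lambda>x. f (x + c))"
  using assms absint_shift[where f=f and a=a and b=b] absint_shift[where f="\<lambda>x. (f x)\<^sup>2" and a=a and b=b] unfolding sqint_def by auto

lemma sqint_spike:
  assumes "sqint T f" "finite N" "\<And>x. x \<in> T - N \<Longrightarrow> g x = f x"
  shows "sqint T g"
proof -
  have N: "negligible N" by (rule negligible_finite[OF assms(2)])
  show ?thesis
    using absolutely_integrable_spike[OF _ N, where f=f and T=T and g=g]
      absolutely_integrable_spike[OF _ N, where f="\<lambda>x. (f x)\<^sup>2" and T=T and g="\<lambda>x. (g x)\<^sup>2"] assms
    unfolding sqint_def by auto
qed

lemma sqint_window:
  assumes "sqint {s - 1..s} f"
  shows "sqint {0..1} (\<lambda>x. f (s - x))"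
  using assms absint_window[where f=f] absint_window[where f="\<lambda>x. (f x)\<^sup>2"] unfolding sqint_def by auto

section \<open>The delay equation\<close>

lemma integral_exp:
  fixes K s :: real
  assumes "K > 0" "0 \<le> s"
  shows "integral {0..s} (\<lambda>\<sigma>. exp (K * \<sigma>)) = (exp (K * s) - 1) / K"
proof -
  have "((\<lambda>\<sigma>. exp (K * \<sigma>)) has_integral exp (K * s) / K - exp (K * 0) / K) {0..s}"
    by (rule fundamental_theorem_of_calculus[OF assms(2)])
      (use assms in \<open>auto intro!: derivative_eq_intros simp flip: has_real_derivative_iff_has_vector_derivative\<close>)
  then show ?thesis by (simp add: integral_unique diff_divide_distrib)
qed

text \<open>
  With the weight \<open>exp (- K * s)\<close>, a unit delay gains the factor \<open>exp (- K)\<close>, which is at most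
  \<open>1 / K\<close>, and an integration gains the factor \<open>1 / K\<close>.  For large \<open>K\<close> the right-hand side of the
  delay equation is therefore a contraction in the weighted supremum norm.
\<close>

lemma delay_estimate:
  fixes D f g :: "real \<Rightarrow> real"
  assumes f: "continuous_on {0..s} f" and g: "continuous_on {0..s} g" and s: "0 \<le> s"
    and D: "\<And>\<sigma>. -1 \<le> \<sigma> \<Longrightarrow> \<sigma> \<le> s \<Longrightarrow> \<bar>D \<sigma>\<bar> \<le> M * exp (K * \<sigma>)"
    and Lip: "\<And>\<sigma>. 0 \<le> \<sigma> \<Longrightarrow> \<sigma> \<le> s \<Longrightarrow> \<bar>f \<sigma> - g \<sigma>\<bar> \<le> L * (\<bar>D \<sigma>\<bar> + \<bar>D (\<sigma> - 1)\<bar>)"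
    and k: "\<bar>k\<bar> \<le> 1" and L: "0 \<le> L" and K: "K > 0"
  shows "\<bar>k * D (s - 1) + (1 - k) * (integral {0..s} f - integral {0..s} g)\<bar>
           \<le> (1 + 4 * L) / K * (M * exp (K * s))"
proof -
  have M: "M \<ge> 0" using D[of 0] s by (simp add: zero_le_mult_iff order_trans[OF abs_ge_zero])
  have shift: "M * exp (K * (\<sigma> - 1)) \<le> M * exp (K * \<sigma>)" for \<sigma>
    using M K by (intro mult_left_mono) auto
  have "integral {0..s} f - integral {0..s} g = integral {0..s} (\<lambda>\<sigma>. f \<sigma> - g \<sigma>)"
    by (rule Henstock_Kurzweil_Integration.integral_diff[symmetric];
        intro integrable_continuous_interval f g)
  moreover have "\<bar>integral {0..s} (\<lambda>\<sigma>. f \<sigma> - g \<sigma>)\<bar> \<le> integral {0..s} (\<lambda>\<sigma>. 2 * L * M * exp (K * \<sigma>))"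
  proof (rule integral_norm_bound_integral[where 'a=real, simplified])
    fix \<sigma> assume \<sigma>: "\<sigma> \<in> {0..s}"
    have "\<bar>f \<sigma> - g \<sigma>\<bar> \<le> L * (\<bar>D \<sigma>\<bar> + \<bar>D (\<sigma> - 1)\<bar>)" using \<sigma> by (intro Lip) auto
    also have "\<dots> \<le> L * (M * exp (K * \<sigma>) + M * exp (K * \<sigma>))"
      using \<sigma> L D[of \<sigma>] order_trans[OF D[of "\<sigma> - 1"] shift] by (intro mult_left_mono add_mono) auto
    finally show "\<bar>f \<sigma> - g \<sigma>\<bar> \<le> 2 * L * M * exp (K * \<sigma>)" by (simp add: algebra_simps)
  qed (intro integrable_continuous_interval continuous_intros f g)+
  moreover have "integral {0..s} (\<lambda>\<sigma>. 2 * L * M * exp (K * \<sigma>)) = 2 * L * M * ((exp (K * s) - 1) / K)"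
    using integral_exp[OF K s] by simp
  moreover have "\<dots> \<le> 2 * L * M * (exp (K * s) / K)"
    using L M K by (intro mult_left_mono divide_right_mono) auto
  ultimately have I: "\<bar>integral {0..s} f - integral {0..s} g\<bar> \<le> 2 * L * M * exp (K * s) / K" by simp
  have eK: "exp (- K) \<le> 1 / K"
  proof -
    have "K \<le> exp K" using exp_ge_add_one_self[of K] by linarith
    then show ?thesis using K by (simp add: exp_minus field_simps)
  qed
  have "\<bar>D (s - 1)\<bar> \<le> M * exp (K * (s - 1))" using D s by simp
  also have "\<dots> = M * exp (K * s) * exp (- K)" by (simp add: algebra_simps flip: exp_add)
  also have "\<dots> \<le> M * exp (K * s) * (1 / K)" using M by (intro mult_left_mono eK) auto
  finally have D1: "\<bar>D (s - 1)\<bar> \<le> M * exp (K * s) * (1 / K)" .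
  have "\<bar>k * D (s - 1)\<bar> \<le> 1 * \<bar>D (s - 1)\<bar>" unfolding abs_mult using k by (intro mult_right_mono) auto
  moreover have "\<bar>(1 - k) * (integral {0..s} f - integral {0..s} g)\<bar> \<le> 2 * (2 * L * M * exp (K * s) / K)"
    unfolding abs_mult using k I by (intro mult_mono) auto
  ultimately have "\<bar>k * D (s - 1) + (1 - k) * (integral {0..s} f - integral {0..s} g)\<bar>
      \<le> M * exp (K * s) * (1 / K) + 2 * (2 * L * M * exp (K * s) / K)"
    using D1 by linarith
  also have "\<dots> = (1 + 4 * L) / K * (M * exp (K * s))" using K by (simp add: field_simps)
  finally show ?thesis .
qed

text \<open>
  Where the weighted difference of \<open>G\<close> and \<open>H\<close> is largest, the preceding estimate bounds the
  maximum by half of itself.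
\<close>

lemma delay_primitive_unique:
  fixes G H f g :: "real \<Rightarrow> real"
  assumes GH: "continuous_on {-1..S} G" "continuous_on {-1..S} H"
    and init: "\<And>s. -1 \<le> s \<Longrightarrow> s \<le> 0 \<Longrightarrow> G s = H s"
    and f: "continuous_on {0..S} f" and g: "continuous_on {0..S} g"
    and Lip: "\<And>\<sigma>. 0 \<le> \<sigma> \<Longrightarrow> \<sigma> \<le> S \<Longrightarrow> \<bar>f \<sigma> - g \<sigma>\<bar> \<le> L * (\<bar>G \<sigma> - H \<sigma>\<bar> + \<bar>G (\<sigma> - 1) - H (\<sigma> - 1)\<bar>)"
    and k: "\<bar>k\<bar> \<le> 1" and L: "0 \<le> L"
    and G: "\<And>s. 0 \<le> s \<Longrightarrow> s \<le> S \<Longrightarrow> G s = k * (G (s - 1) - G (-1)) + (1 - k) * integral {0..s} f"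
    and H: "\<And>s. 0 \<le> s \<Longrightarrow> s \<le> S \<Longrightarrow> H s = k * (H (s - 1) - H (-1)) + (1 - k) * integral {0..s} g"
    and s: "-1 \<le> s" "s \<le> S"
  shows "G s = H s"
proof (cases "s \<le> 0")
  case False
  then have S: "0 \<le> S" using s by simp
  define K where "K = 2 * (1 + 4 * L)"
  have K: "K > 0" using L by (simp add: K_def)
  define D where "D \<sigma> = G \<sigma> - H \<sigma>" for \<sigma>
  have "continuous_on {-1..S} (\<lambda>\<sigma>. \<bar>D \<sigma>\<bar> * exp (- K * \<sigma>))"
    unfolding D_def by (intro continuous_intros GH)
  then obtain m where m: "m \<in> {-1..S}"
    "\<And>\<sigma>. \<sigma> \<in> {-1..S} \<Longrightarrow> \<bar>D \<sigma>\<bar> * exp (- K * \<sigma>) \<le> \<bar>D m\<bar> * exp (- K * m)"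
    using continuous_attains_sup[OF compact_Icc, of "-1" S] S
    by (metis (no_types, lifting) atLeastAtMost_iff empty_iff neg_le_0_iff_le order_trans zero_le_one)
  define M where "M = \<bar>D m\<bar> * exp (- K * m)"
  have D: "\<bar>D \<sigma>\<bar> \<le> M * exp (K * \<sigma>)" if "-1 \<le> \<sigma>" "\<sigma> \<le> S" for \<sigma>
  proof -
    have "\<bar>D \<sigma>\<bar> = \<bar>D \<sigma>\<bar> * exp (- K * \<sigma>) * exp (K * \<sigma>)" by (simp add: mult.assoc flip: exp_add)
    also have "\<dots> \<le> M * exp (K * \<sigma>)" unfolding M_def by (intro mult_right_mono m(2)) (use that in auto)
    finally show ?thesis .
  qed
  have M0: "M \<ge> 0" by (simp add: M_def)
  have "M \<le> 0"
  proof (cases "m \<le> 0")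
    case True
    then show ?thesis using init[of m] m(1) by (simp add: M_def D_def)
  next
    case False
    then have mS: "0 \<le> m" "m \<le> S" using m(1) by auto
    have "D m = k * D (m - 1) + (1 - k) * (integral {0..m} f - integral {0..m} g)"
      unfolding D_def using G[OF mS] H[OF mS] init[of "-1"] by (simp add: algebra_simps)
    moreover have "\<bar>k * D (m - 1) + (1 - k) * (integral {0..m} f - integral {0..m} g)\<bar>
        \<le> (1 + 4 * L) / K * (M * exp (K * m))"
      by (rule delay_estimate[OF _ _ mS(1) D _ k L K])
        (use mS Lip in \<open>auto simp: D_def intro: continuous_on_subset[OF f] continuous_on_subset[OF g]\<close>)
    moreover have "(1 + 4 * L) / K = 1 / 2" using L by (simp add: K_def)
    ultimately have "\<bar>D m\<bar> \<le> 1 / 2 * (M * exp (K * m))" by simp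
    then have "\<bar>D m\<bar> * exp (- K * m) \<le> 1 / 2 * (M * exp (K * m)) * exp (- K * m)"
      by (intro mult_right_mono) auto
    also have "\<dots> = M / 2" by (simp add: mult.assoc flip: exp_add)
    finally show ?thesis by (simp add: M_def)
  qed
  then have "\<bar>D s\<bar> \<le> 0" using D[OF s] M0 by simp
  then show ?thesis by (simp add: D_def)
qed (use init s in auto)

lemma continuous_on_halflineI:
  fixes f :: "real \<Rightarrow> real"
  assumes "\<And>b. continuous_on {0..b} f"
  shows "continuous_on {0..} f"
  unfolding continuous_on_eq_continuous_within
proof
  fix s :: real assume s: "s \<in> {0..}"
  have "continuous (at s within {0..s+1}) f"
    using assms[of "s + 1"] s by (simp add: continuous_on_eq_continuous_within)
  moreover have "at s within {0..s+1} = at s within {0..}"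
    by (rule at_within_nhd[of _ "{..<s+1}"]) (use s in auto)
  ultimately show "continuous (at s within {0..}) f" by simp
qed

text \<open>
  A fixed point in the space of bounded continuous functions \<open>v\<close>, where \<open>G\<close> is written as
  \<open>exp (K * s) * (v s - v 0)\<close> for positive \<open>s\<close>.  The weight turns the equation into a contraction, and
  subtracting \<open>v 0\<close> makes \<open>G\<close> continuous at \<open>0\<close> for every \<open>v\<close>.
\<close>

lemma delay_primitive_exists:
  fixes F G0 :: "real \<Rightarrow> real"
  assumes G0: "continuous_on UNIV G0" "\<And>s. s \<ge> 0 \<Longrightarrow> G0 s = 0" "\<And>s. \<bar>G0 s\<bar> \<le> b"
    and F: "\<And>x y. \<bar>F x - F y\<bar> \<le> L * \<bar>x - y\<bar>" and FB: "\<And>x. \<bar>F x\<bar> \<le> B"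
    and k: "\<bar>k\<bar> \<le> 1"
  obtains G where "continuous_on UNIV G" "\<And>s. s \<le> 0 \<Longrightarrow> G s = G0 s"
    "\<And>s. 0 \<le> s \<Longrightarrow> G s = k * (G (s - 1) - G (-1)) + (1 - k) * integral {0..s} (\<lambda>\<sigma>. F (G \<sigma> - G (\<sigma> - 1)))"
proof -
  have L: "L \<ge> 0" using F[of 1 0] by simp
  have B: "B \<ge> 0" using FB[of 0] by simp
  have Fc: "continuous_on UNIV F" by (rule lipschitz_imp_continuous[OF F])
  \<comment> \<open>The weighted estimate then gains the factor \<open>1 / 4\<close>, of which subtracting \<open>v 0\<close> costs a factor \<open>2\<close>.\<close>
  define K where "K = 4 * (1 + 4 * L)"
  have K: "K > 0" using L by (simp add: K_def)
  define E where "E v s = G0 s + exp (K * s) * (apply_bcontfun v (max s 0) - apply_bcontfun v 0)"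
    for v :: "real \<Rightarrow>\<^sub>C real" and s
  define I where "I v s = integral {0..s} (\<lambda>\<sigma>. F (E v \<sigma> - E v (\<sigma> - 1)))" for v s
  define T where "T v s = exp (- K * max s 0) *
      (k * (E v (max s 0 - 1) - E v (-1)) + (1 - k) * I v (max s 0))" for v s
  have Ec: "continuous_on X (E v)" for v X
    unfolding E_def
    by (intro continuous_intros continuous_on_subset[OF G0(1)] continuous_on_compose2[OF continuous_on_apply_bcontfun[of UNIV v]]) auto
  have Wc: "continuous_on X (\<lambda>\<sigma>. F (E v \<sigma> - E v (\<sigma> - 1)))" for v X
    by (rule continuous_on_compose2[OF Fc]) (auto intro!: continuous_intros Ec continuous_on_compose2[OF Ec[of UNIV]])
  have Ineg: "E v s = G0 s" if "s \<le> 0" for v s using that by (simp add: E_def max_def)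
  have Tb: "T v \<in> bcontfun" for v
  proof -
    have "continuous_on UNIV (\<lambda>s. I v (max s 0))"
    proof (rule continuous_on_compose2[of "{0..}" "I v"])
      show "continuous_on {0..} (I v)"
        unfolding I_def
        by (intro continuous_on_halflineI indefinite_integral_continuous_1 integrable_continuous_interval Wc)
    qed (auto intro!: continuous_intros)
    then have Tc: "continuous_on UNIV (T v)"
      unfolding T_def
      by (intro continuous_intros continuous_on_compose2[OF Ec[of UNIV]]) auto
    obtain V where V: "\<And>x. \<bar>apply_bcontfun v x\<bar> \<le> V"
      using bounded_apply_bcontfun[of v] unfolding bounded_iff by auto
    have b: "b \<ge> 0" using G0(3)[of 0] by simp
    have V0: "V \<ge> 0" using V[of 0] by simp
    have Eb: "exp (- K * s) * \<bar>E v \<sigma>\<bar> \<le> b + 2 * V" if "\<sigma> \<le> s" "s \<ge> 0" for s \<sigma>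
    proof -
      have "\<bar>E v \<sigma>\<bar> \<le> \<bar>G0 \<sigma>\<bar> + exp (K * \<sigma>) * \<bar>apply_bcontfun v (max \<sigma> 0) - apply_bcontfun v 0\<bar>"
        unfolding E_def
        using abs_triangle_ineq[of "G0 \<sigma>" "exp (K * \<sigma>) * (apply_bcontfun v (max \<sigma> 0) - apply_bcontfun v 0)"]
        by (simp add: abs_mult)
      also have "\<dots> \<le> b + exp (K * s) * (2 * V)"
        using V[of "max \<sigma> 0"] V[of 0] V0 that K by (intro add_mono G0(3) mult_mono) auto
      finally have "exp (- K * s) * \<bar>E v \<sigma>\<bar> \<le> exp (- K * s) * (b + exp (K * s) * (2 * V))"
        by (intro mult_left_mono) auto
      also have "\<dots> = exp (- K * s) * b + 2 * V" by (simp add: distrib_left flip: exp_add mult.assoc)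
      also have "\<dots> \<le> 1 * b + 2 * V" using K that b V0 by (intro add_mono mult_right_mono) auto
      finally show ?thesis by simp
    qed
    have Tn: "norm (T v s) \<le> 2 * (b + 2 * V) + 2 * (B / K)" for s :: real
    proof -
      define u where "u = max s 0"
      have u: "u \<ge> 0" by (simp add: u_def)
      have "\<bar>I v u\<bar> \<le> integral {0..u} (\<lambda>_. B)"
        unfolding I_def by (rule integral_norm_bound_integral[where 'a=real, simplified])
          (auto intro!: integrable_continuous_interval Wc FB)
      then have Ib: "\<bar>I v u\<bar> \<le> B * u" using u by (simp add: mult.commute)
      have "K * u \<le> exp (K * u)" using exp_ge_add_one_self[of "K * u"] by linarith
      then have "exp (- K * u) * (K * u) \<le> exp (- K * u) * exp (K * u)"
        by (intro mult_left_mono) auto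
      then have "exp (- K * u) * u \<le> 1 / K" using K by (simp add: field_simps flip: exp_add)
      then have "B * (exp (- K * u) * u) \<le> B * (1 / K)" using B by (intro mult_left_mono)
      moreover have "exp (- K * u) * \<bar>I v u\<bar> \<le> exp (- K * u) * (B * u)" using Ib by (intro mult_left_mono) auto
      moreover have "exp (- K * u) * (B * u) = B * (exp (- K * u) * u)" "B * (1 / K) = B / K" by simp_all
      ultimately have Ib2: "exp (- K * u) * \<bar>I v u\<bar> \<le> B / K" by linarith
      have "\<bar>k * (E v (u - 1) - E v (-1)) + (1 - k) * I v u\<bar>
          \<le> \<bar>k * (E v (u - 1) - E v (-1))\<bar> + \<bar>(1 - k) * I v u\<bar>" by (rule abs_triangle_ineq)
      also have "\<dots> \<le> 1 * (\<bar>E v (u - 1)\<bar> + \<bar>E v (-1)\<bar>) + 2 * \<bar>I v u\<bar>"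
        unfolding abs_mult using k by (intro add_mono mult_mono) auto
      finally have "exp (- K * u) * \<bar>k * (E v (u - 1) - E v (-1)) + (1 - k) * I v u\<bar>
          \<le> exp (- K * u) * (1 * (\<bar>E v (u - 1)\<bar> + \<bar>E v (-1)\<bar>) + 2 * \<bar>I v u\<bar>)"
        by (intro mult_left_mono) auto
      also have "\<dots> = exp (- K * u) * \<bar>E v (u - 1)\<bar> + exp (- K * u) * \<bar>E v (-1)\<bar> + 2 * (exp (- K * u) * \<bar>I v u\<bar>)"
        by (simp add: algebra_simps)
      also have "\<dots> \<le> (b + 2 * V) + (b + 2 * V) + 2 * (B / K)"
        using u by (intro add_mono Eb mult_left_mono Ib2) auto
      finally show ?thesis unfolding T_def u_def[symmetric] by (simp add: abs_mult)
    qed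
    show ?thesis by (rule bcontfun_normI[OF Tc Tn])
  qed
  have "\<exists>!v. Bcontfun (T v) = v"
  proof (rule banach_fix_type[of "1/2"]; (intro allI)?)
    fix v w :: "real \<Rightarrow>\<^sub>C real"
    show "dist (Bcontfun (T v)) (Bcontfun (T w)) \<le> 1 / 2 * dist v w"
    proof (rule dist_bound)
      fix s :: real
      define u where "u = max s 0"
      have u: "u \<ge> 0" by (simp add: u_def)
      define D where "D \<sigma> = E v \<sigma> - E w \<sigma>" for \<sigma>
      have D: "\<bar>D \<sigma>\<bar> \<le> 2 * dist v w * exp (K * \<sigma>)" for \<sigma>
      proof -
        have "D \<sigma> = exp (K * \<sigma>) * ((apply_bcontfun v (max \<sigma> 0) - apply_bcontfun w (max \<sigma> 0))
             - (apply_bcontfun v 0 - apply_bcontfun w 0))"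
          by (simp add: D_def E_def algebra_simps)
        moreover have "\<bar>(apply_bcontfun v (max \<sigma> 0) - apply_bcontfun w (max \<sigma> 0))
             - (apply_bcontfun v 0 - apply_bcontfun w 0)\<bar> \<le> 2 * dist v w"
          using dist_bounded[of v "max \<sigma> 0" w] dist_bounded[of v 0 w] by (simp add: dist_real_def)
        ultimately show ?thesis by (simp add: abs_mult mult.commute)
      qed
      have "T v s - T w s = exp (- K * u) * (k * D (u - 1) + (1 - k) * (I v u - I w u))"
        unfolding T_def u_def[symmetric] using Ineg[of "-1"] by (simp add: D_def algebra_simps)
      then have "\<bar>T v s - T w s\<bar> = exp (- K * u) * \<bar>k * D (u - 1) + (1 - k) * (I v u - I w u)\<bar>"
        by (simp add: abs_mult)
      also have "\<dots> \<le> exp (- K * u) * ((1 + 4 * L) / K * (2 * dist v w * exp (K * u)))"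
        unfolding I_def
      proof (intro mult_left_mono delay_estimate[OF Wc Wc u D _ k L K])
        fix \<sigma>
        have "\<bar>F (E v \<sigma> - E v (\<sigma> - 1)) - F (E w \<sigma> - E w (\<sigma> - 1))\<bar> \<le> L * \<bar>D \<sigma> - D (\<sigma> - 1)\<bar>"
          using F[of "E v \<sigma> - E v (\<sigma> - 1)" "E w \<sigma> - E w (\<sigma> - 1)"] by (simp add: D_def algebra_simps)
        also have "\<dots> \<le> L * (\<bar>D \<sigma>\<bar> + \<bar>D (\<sigma> - 1)\<bar>)" using L by (intro mult_left_mono) auto
        finally show "\<bar>F (E v \<sigma> - E v (\<sigma> - 1)) - F (E w \<sigma> - E w (\<sigma> - 1))\<bar> \<le> L * (\<bar>D \<sigma>\<bar> + \<bar>D (\<sigma> - 1)\<bar>)" .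
      qed auto
      also have "\<dots> = 2 * ((1 + 4 * L) / K) * dist v w * (exp (- K * u) * exp (K * u))"
        by (simp only: mult_ac)
      also have "\<dots> = 2 * ((1 + 4 * L) / K) * dist v w" by (simp flip: exp_add)
      also have "(1 + 4 * L) / K = 1 / 4" using L by (simp add: K_def)
      also have "2 * (1 / 4) * dist v w = 1 / 2 * dist v w" by simp
      finally show "dist (Bcontfun (T v) s) (Bcontfun (T w) s) \<le> 1 / 2 * dist v w"
        by (simp add: Bcontfun_inverse[OF Tb] dist_real_def)
    qed
  qed auto
  then obtain v where "Bcontfun (T v) = v" by blast
  then have v: "apply_bcontfun v = T v" by (metis Bcontfun_inverse[OF Tb])
  have v0: "apply_bcontfun v 0 = 0"
    unfolding v by (simp add: T_def I_def)
  show thesis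
  proof (rule that[of "E v"])
    show "continuous_on UNIV (E v)" by (rule Ec)
    show "E v s = G0 s" if "s \<le> 0" for s by (rule Ineg[OF that])
    show "E v s = k * (E v (s - 1) - E v (-1)) + (1 - k) * integral {0..s} (\<lambda>\<sigma>. F (E v \<sigma> - E v (\<sigma> - 1)))"
      if s: "0 \<le> s" for s
    proof -
      have "E v s = exp (K * s) * T v s" using s G0(2)[OF s] v0 v by (simp add: E_def[of v s] max_def)
      also have "\<dots> = k * (E v (s - 1) - E v (-1)) + (1 - k) * I v s"
      proof -
        have "exp (K * s) * (exp (- K * s) * x) = x" for x
          by (simp flip: mult.assoc exp_add)
        then show ?thesis using s by (simp add: T_def max_def)
      qed
      finally show ?thesis by (simp add: I_def)
    qed
  qed
qed

text \<open>
  The values on \<open>[n, n + 1)\<close> are determined by those one unit earlier, until the recursion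
  reaches the history \<open>h0\<close> on the negative axis.
\<close>

function delay_profile :: "(real \<Rightarrow> real) \<Rightarrow> real \<Rightarrow> (real \<Rightarrow> real) \<Rightarrow> real \<Rightarrow> real" where
  "delay_profile h0 k w s = (if s < 0 then h0 s else k * delay_profile h0 k w (s - 1) + (1 - k) * w s)"
  by auto
termination
  by (relation "Wellfounded.measure (\<lambda>(h0, k, w, s). nat \<lfloor>s + 1\<rfloor>)") (auto simp: nat_less_eq_zless)

declare delay_profile.simps[simp del]

lemma delay_profile_sqint:
  assumes h0: "sqint {-1..0} h0" and w: "continuous_on {0..} w"
  shows "sqint {-1..S} (delay_profile h0 k w)"
proof -
  let ?h = "delay_profile h0 k w"
  have "sqint {-1..real n} ?h" for n
  proof (induction n)
    case 0
    show ?case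
      by (rule sqint_spike[OF _ finite.insertI[OF finite.emptyI, of 0], of _ h0])
        (use h0 in \<open>auto simp: delay_profile.simps\<close>)
  next
    case (Suc n)
    have "sqint {0..real (Suc n)} (\<lambda>s. k * ?h (s + - 1) + (1 - k) * w s)"
    proof (intro sqint_add sqint_cmult)
      show "sqint {0..real (Suc n)} (\<lambda>s. ?h (s + - 1))" by (rule sqint_shift) (use Suc in simp)
      show "sqint {0..real (Suc n)} w" by (rule sqint_continuous, rule continuous_on_subset[OF w]) auto
    qed
    then have "sqint {0..real (Suc n)} ?h"
      by (rule sqint_spike[OF _ finite.emptyI]) (auto simp: delay_profile.simps[of _ _ _ "_::real"])
    then show ?case
      using sqint_combine[OF sqint_subinterval[OF Suc, of "-1" 0]] by simp
  qed
  then show ?thesis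
    using sqint_subinterval[of "-1" _ ?h "-1" S] real_arch_simple[of S] by force
qed

text \<open>
  The primitive of the profile and \<open>G\<close> agree on the history and obey the same recursion from
  one unit interval to the next.
\<close>

lemma delay_profile_integral:
  assumes h0: "sqint {-1..0} h0" and w: "continuous_on {0..} w"
    and G0: "\<And>s. -1 \<le> s \<Longrightarrow> s \<le> 0 \<Longrightarrow> G s = G (-1) + integral {-1..s} h0" and G00: "G 0 = 0"
    and G: "\<And>s. 0 \<le> s \<Longrightarrow> G s = k * (G (s - 1) - G (-1)) + (1 - k) * integral {0..s} w"
    and s: "-1 \<le> s"
  shows "integral {-1..s} (delay_profile h0 k w) = G s - G (-1)"
proof -
  let ?h = "delay_profile h0 k w"
  note sq = delay_profile_sqint[OF h0 w]
  have ai: "?h absolutely_integrable_on {a..b}" if "-1 \<le> a" for a b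
    using sqint_subinterval[OF sq that order_refl] unfolding sqint_def by auto
  have neg: "integral {-1..s} ?h = G s - G (-1)" if "-1 \<le> s" "s \<le> 0" for s
  proof -
    have "integral {-1..s} ?h = integral {-1..s} h0"
      by (rule integral_spike[of "{0}"]) (use that in \<open>auto simp: delay_profile.simps\<close>)
    then show ?thesis using G0[OF that] by simp
  qed
  have "\<forall>s. -1 \<le> s \<and> s \<le> real n \<longrightarrow> integral {-1..s} ?h = G s - G (-1)" for n
  proof (induction n)
    case 0
    then show ?case using neg by simp
  next
    case (Suc n)
    show ?case
    proof (intro allI impI)
      fix s assume s: "-1 \<le> s \<and> s \<le> real (Suc n)"
      show "integral {-1..s} ?h = G s - G (-1)"
      proof (cases "s \<le> 0")
        case False
        have sh: "(\<lambda>\<sigma>. ?h (\<sigma> + - 1)) integrable_on {0..s}"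
          by (rule absint_imp_integrable, rule absint_shift, rule ai) simp
        have wi: "w integrable_on {0..s}"
          by (intro integrable_continuous_interval continuous_on_subset[OF w]) auto
        have "integral {0..s} ?h = integral {0..s} (\<lambda>\<sigma>. k * ?h (\<sigma> + - 1) + (1 - k) * w \<sigma>)"
          by (rule integral_cong) (auto simp: delay_profile.simps[of _ _ _ "_::real"])
        moreover have "\<dots> = k * integral {0..s} (\<lambda>\<sigma>. ?h (\<sigma> + - 1)) + (1 - k) * integral {0..s} w"
          by (intro integral_unique has_integral_add has_integral_mult_right integrable_integral sh wi)
        moreover have "integral {0..s} (\<lambda>\<sigma>. ?h (\<sigma> + - 1)) = integral {-1..s-1} ?h"
          using integral_shift_real_ivl[of "-1" "-1" "s - 1" ?h] by simp
        moreover have "integral {-1..s-1} ?h = G (s - 1) - G (-1)" using Suc s False by simp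
        ultimately have "integral {0..s} ?h = G s" using G[of s] False by simp
        moreover have "integral {0..s} ?h = integral {-1..s} ?h - integral {-1..0} ?h"
          by (rule integral_split) (use False in \<open>auto intro!: absint_imp_integrable ai\<close>)
        ultimately show ?thesis using neg[of 0] G00 by simp
      qed (use neg s in simp)
    qed
  qed
  then show ?thesis using s real_arch_simple[of s] by blast
qed

section \<open>Exponential decay for the delay equation\<close>

lemma continuous_antiderivative:
  fixes p :: "real \<Rightarrow> real"
  assumes "continuous_on UNIV p"
  obtains A where "A 0 = 0" "\<And>s. (A has_real_derivative p s) (at s)"
proof -
  obtain A where A: "\<And>x. (A has_vector_derivative p x) (at x)"
    using einterval_antiderivative[of "-\<infinity>" \<infinity> p] assms by (auto simp: continuous_on_eq_continuous_at)
  show thesis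
    by (rule that[of "\<lambda>s. A s - A 0"])
      (auto intro!: derivative_eq_intros A[folded has_real_derivative_iff_has_vector_derivative])
qed

lemma nonneg_of_derivative_sign:
  fixes u u' :: "real \<Rightarrow> real"
  assumes "u 0 = 0" and d: "\<And>x. (u has_real_derivative u' x) (at x)" and sg: "\<And>x. 0 \<le> x * u' x"
  shows "0 \<le> u x"
proof (cases x "0::real" rule: linorder_cases)
  case greater
  then obtain z where "0 < z" "z < x" "u x - u 0 = (x - 0) * u' z" using MVT2[of 0 x u u'] d by blast
  then show ?thesis using sg[of z] assms(1) by (simp add: zero_le_mult_iff)
next
  case less
  then obtain z where z: "x < z" "z < 0" "u 0 - u x = (0 - x) * u' z" using MVT2[of x 0 u u'] d by blast
  then have "u' z \<le> 0" using sg[of z] by (simp add: zero_le_mult_iff)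
  then have "x * u' z \<ge> 0" using less by (simp add: mult_nonpos_nonpos)
  then show ?thesis using z(3) assms(1) by simp
qed (use assms in simp)

text \<open>
  Expand the integral of \<open>(f x - I)\<^sup>2\<close>, where \<open>I\<close> is the mean of \<open>f\<close>.
\<close>

lemma cauchy_schwarz_unit:
  assumes "sqint {a..a + 1} f"
  shows "(integral {a..a + 1} f)\<^sup>2 \<le> integral {a..a + 1} (\<lambda>x. (f x)\<^sup>2)"
proof -
  define I where "I = integral {a..a + 1} f"
  have f: "f integrable_on {a..a + 1}" "(\<lambda>x. (f x)\<^sup>2) integrable_on {a..a + 1}"
    using assms unfolding sqint_def by (auto intro: absint_imp_integrable)
  have "((\<lambda>x. (f x)\<^sup>2 - 2 * I * f x + I\<^sup>2) has_integral
      integral {a..a + 1} (\<lambda>x. (f x)\<^sup>2) - 2 * I * I + I\<^sup>2) {a..a + 1}"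
    using has_integral_const_real[of "I\<^sup>2" a "a + 1"]
      has_integral_diff[OF integrable_integral[OF f(2)] has_integral_mult_right[OF integrable_integral[OF f(1)], of "2 * I"]]
    unfolding I_def[symmetric] by (intro has_integral_add) auto
  moreover have "0 \<le> (f x)\<^sup>2 - 2 * I * f x + I\<^sup>2" for x
    using zero_le_power2[of "f x - I"] by (simp add: power2_diff algebra_simps)
  ultimately have "0 \<le> integral {a..a + 1} (\<lambda>x. (f x)\<^sup>2) - 2 * I * I + I\<^sup>2"
    by (rule has_integral_nonneg)
  then show ?thesis by (simp add: I_def power2_eq_square)
qed

lemma window_increment:
  fixes f :: "real \<Rightarrow> real"
  assumes f: "\<And>S. f absolutely_integrable_on {-1..S}" and ab: "0 \<le> a" "a \<le> b"
  shows "integral {b - 1..b} f = integral {a - 1..a} f + integral {a..b} (\<lambda>\<sigma>. f \<sigma> - f (\<sigma> - 1))"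
    and "(\<lambda>\<sigma>. f \<sigma> - f (\<sigma> - 1)) absolutely_integrable_on {a..b}"
proof -
  have sub: "f absolutely_integrable_on {c..d}" if "-1 \<le> c" for c d
    by (rule absolutely_integrable_on_subinterval[OF f[of d]]) (use that in auto)
  have sh: "(\<lambda>\<sigma>. f (\<sigma> - 1)) absolutely_integrable_on {a..b}"
    using absint_shift[where f=f and c="-1" and a=a and b=b] sub ab by auto
  show "(\<lambda>\<sigma>. f \<sigma> - f (\<sigma> - 1)) absolutely_integrable_on {a..b}"
    by (intro set_integral_diff(1) sh sub) (use ab in auto)
  have split: "integral {c..d} f = integral {-1..d} f - integral {-1..c} f" if "-1 \<le> c" "c \<le> d" for c d
    by (rule integral_split) (use that in \<open>auto intro!: absint_imp_integrable f\<close>)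
  have "integral {a..b} (\<lambda>\<sigma>. f \<sigma> - f (\<sigma> - 1)) = integral {a..b} f - integral {a..b} (\<lambda>\<sigma>. f (\<sigma> - 1))"
    by (rule Henstock_Kurzweil_Integration.integral_diff; rule absint_imp_integrable; rule sh sub; use ab in simp)
  also have "integral {a..b} (\<lambda>\<sigma>. f (\<sigma> - 1)) = integral {a - 1..b - 1} f"
    using integral_shift_real_ivl[of "a - 1" "-1" "b - 1" f] by simp
  finally show "integral {b - 1..b} f = integral {a - 1..a} f + integral {a..b} (\<lambda>\<sigma>. f \<sigma> - f (\<sigma> - 1))"
    using split[of "b - 1" b] split[of "a - 1" a] split[of a b] split[of "a - 1" "b - 1"] ab by simp
qed

text \<open>
  The Lyapunov functional is the integral of \<open>h\<^sup>2\<close> over the last unit interval minus \<open>2 * \<Phi> (m s)\<close>.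
  With \<open>h'\<close> for the value of \<open>h\<close> one unit earlier, \<open>m\<close> grows at the rate \<open>h - h'\<close>, so the functional
  grows at the rate \<open>h\<^sup>2 - h'\<^sup>2 - 2 * F m * (h - h') = (h - F m)\<^sup>2 - (h' - F m)\<^sup>2\<close>.  The delay equation says
  precisely that \<open>h - F m = k * (h' - F m)\<close>.  Thus the linear computation survives exactly in the
  nonlinear equation.
\<close>

lemma delay_dissipation:
  fixes h F \<Phi> m :: "real \<Rightarrow> real"
  assumes h: "\<And>S. sqint {-1..S} h" and m: "\<And>s. m s = integral {s - 1..s} h"
    and eq: "\<And>s. 0 \<le> s \<Longrightarrow> h s = k * h (s - 1) + (1 - k) * F (m s)"
    and F: "\<And>x y. \<bar>F x - F y\<bar> \<le> L * \<bar>x - y\<bar>"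
    and \<Phi>: "\<And>x. (\<Phi> has_real_derivative F x) (at x)" and ab: "0 \<le> a" "a \<le> b"
  shows "(integral {b - 1..b} (\<lambda>x. (h x)\<^sup>2) - 2 * \<Phi> (m b)) - (integral {a - 1..a} (\<lambda>x. (h x)\<^sup>2) - 2 * \<Phi> (m a))
      = - (1 - k\<^sup>2) * integral {a..b} (\<lambda>\<sigma>. (h (\<sigma> - 1) - F (m \<sigma>))\<^sup>2)"
proof -
  have hai: "h absolutely_integrable_on {-1..S}" "(\<lambda>x. (h x)\<^sup>2) absolutely_integrable_on {-1..S}" for S
    using h unfolding sqint_def by auto
  define p where "p \<sigma> = h \<sigma> - h (\<sigma> - 1)" for \<sigma>
  have "m s = m a + integral {a..s} p" if "s \<in> {a..b}" for s
    using window_increment(1)[OF hai(1) ab(1), of s] that unfolding m p_def by auto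
  note chain = absint_chain_rule[where p=p and a=a and b=b and \<Phi>=\<Phi> and F=F and L=L and m=m, OF _ ab(2) \<Phi> F this]
  have p: "p absolutely_integrable_on {a..b}"
    using window_increment(2)[OF hai(1) ab] unfolding p_def .
  have E: "integral {b - 1..b} (\<lambda>x. (h x)\<^sup>2) - integral {a - 1..a} (\<lambda>x. (h x)\<^sup>2)
      = integral {a..b} (\<lambda>\<sigma>. (h \<sigma>)\<^sup>2 - (h (\<sigma> - 1))\<^sup>2)"
    using window_increment(1)[OF hai(2) ab] by simp
  have "integral {a..b} (\<lambda>\<sigma>. ((h \<sigma>)\<^sup>2 - (h (\<sigma> - 1))\<^sup>2) - 2 * (F (m \<sigma>) * p \<sigma>))
     = integral {a..b} (\<lambda>\<sigma>. (h \<sigma>)\<^sup>2 - (h (\<sigma> - 1))\<^sup>2) - 2 * integral {a..b} (\<lambda>\<sigma>. F (m \<sigma>) * p \<sigma>)"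
    by (intro integral_unique has_integral_diff has_integral_mult_right integrable_integral
        absint_imp_integrable window_increment(2)[OF hai(2) ab] chain(1)[OF p])
  moreover have "integral {a..b} (\<lambda>\<sigma>. ((h \<sigma>)\<^sup>2 - (h (\<sigma> - 1))\<^sup>2) - 2 * (F (m \<sigma>) * p \<sigma>))
      = integral {a..b} (\<lambda>\<sigma>. - (1 - k\<^sup>2) * (h (\<sigma> - 1) - F (m \<sigma>))\<^sup>2)"
  proof (rule integral_cong)
    fix \<sigma> assume "\<sigma> \<in> {a..b}"
    then have "h \<sigma> - F (m \<sigma>) = k * (h (\<sigma> - 1) - F (m \<sigma>))" using eq[of \<sigma>] ab by (simp add: algebra_simps)
    then have "(h \<sigma> - F (m \<sigma>))\<^sup>2 = k\<^sup>2 * (h (\<sigma> - 1) - F (m \<sigma>))\<^sup>2" by (simp add: power_mult_distrib)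
    moreover have "((h \<sigma>)\<^sup>2 - (h (\<sigma> - 1))\<^sup>2) - 2 * (F (m \<sigma>) * p \<sigma>)
        = (h \<sigma> - F (m \<sigma>))\<^sup>2 - (h (\<sigma> - 1) - F (m \<sigma>))\<^sup>2"
      by (simp add: p_def power2_eq_square algebra_simps)
    ultimately show "((h \<sigma>)\<^sup>2 - (h (\<sigma> - 1))\<^sup>2) - 2 * (F (m \<sigma>) * p \<sigma>) = - (1 - k\<^sup>2) * (h (\<sigma> - 1) - F (m \<sigma>))\<^sup>2"
      by (simp add: algebra_simps)
  qed
  ultimately show ?thesis using E chain(2)[OF p] by simp
qed

text \<open>
  Write \<open>z\<close> for the quantity whose square is dissipated.  Since \<open>m\<close> grows at the rate \<open>(k - 1) * z\<close>,
  it is nearly constant over the window if \<open>z\<close> is small there; and \<open>h\<close>, one unit earlier, is close to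
  \<open>F m\<close>.  Averaging the latter over the window shows that \<open>m s\<close> is close to \<open>F (m s)\<close>, which for
  \<open>\<theta> < 1\<close> is possible only if \<open>m s\<close> is itself small.  So a small dissipation in one window means
  that \<open>h\<close> was small in the window before.
\<close>

lemma delay_observability:
  fixes h F m :: "real \<Rightarrow> real"
  assumes h: "\<And>S. sqint {-1..S} h" and m: "\<And>s. m s = integral {s - 1..s} h"
    and eq: "\<And>s. 0 \<le> s \<Longrightarrow> h s = k * h (s - 1) + (1 - k) * F (m s)"
    and F: "\<And>x y. \<bar>F x - F y\<bar> \<le> L * \<bar>x - y\<bar>" and F0: "F 0 = 0"
    and sector: "\<And>x. x * F x \<le> \<theta> * x\<^sup>2" and \<theta>: "\<theta> < 1" and k: "\<bar>k\<bar> \<le> 1" and s: "0 \<le> s"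
    and N: "N = (1 + 2 * L) / (1 - \<theta>) + 2"
  shows "integral {s - 1..s} (\<lambda>x. (h x)\<^sup>2)
      \<le> (2 + 2 * (L * N)\<^sup>2) * integral {s..s + 1} (\<lambda>\<sigma>. (h (\<sigma> - 1) - F (m \<sigma>))\<^sup>2)"
proof -
  have L: "L \<ge> 0" using F[of 1 0] by simp
  have Fc: "continuous_on UNIV F" by (rule lipschitz_imp_continuous[OF F])
  have hai: "h absolutely_integrable_on {-1..S}" for S using h unfolding sqint_def by auto
  have inc: "m \<sigma> = m s + integral {s..\<sigma>} (\<lambda>\<sigma>. h \<sigma> - h (\<sigma> - 1))" if "s \<le> \<sigma>" for \<sigma>
    using window_increment(1)[OF hai s that] unfolding m by simp
  have pai: "(\<lambda>\<sigma>. h \<sigma> - h (\<sigma> - 1)) absolutely_integrable_on {s..\<sigma>}" if "s \<le> \<sigma>" for \<sigma>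
    by (rule window_increment(2)[OF hai s that])
  have mc: "continuous_on {s..s + 1} m"
  proof (rule continuous_on_eq[where f="\<lambda>\<sigma>. m s + integral {s..\<sigma>} (\<lambda>\<sigma>. h \<sigma> - h (\<sigma> - 1))"])
    show "continuous_on {s..s + 1} (\<lambda>\<sigma>. m s + integral {s..\<sigma>} (\<lambda>\<sigma>. h \<sigma> - h (\<sigma> - 1)))"
      by (intro continuous_intros indefinite_integral_continuous_1 absint_imp_integrable pai) simp
  qed (rule inc[symmetric], simp)
  have Fmc: "continuous_on {s..s + 1} (\<lambda>\<sigma>. F (m \<sigma>))"
    by (rule continuous_on_compose2[OF Fc mc]) auto
  define z where "z \<sigma> = h (\<sigma> - 1) - F (m \<sigma>)" for \<sigma>
  have hs: "sqint {s..s + 1} (\<lambda>\<sigma>. h (\<sigma> - 1))"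
    using sqint_shift[of s "-1" "s + 1" h] sqint_subinterval[OF h, of "s - 1" s s] s by simp
  have zs: "sqint {s..s + 1} z"
    unfolding z_def by (intro sqint_diff hs sqint_continuous Fmc)
  have zai: "z absolutely_integrable_on {s..s + 1}" and z2: "(\<lambda>\<sigma>. (z \<sigma>)\<^sup>2) absolutely_integrable_on {s..s + 1}"
    using zs unfolding sqint_def by auto
  define Y where "Y = integral {s..s + 1} (\<lambda>\<sigma>. \<bar>z \<sigma>\<bar>)"
  have Y0: "Y \<ge> 0" unfolding Y_def by (rule integral_nonneg) (auto intro: absint_imp_integrable absint_abs zai)
  have Yz: "Y\<^sup>2 \<le> integral {s..s + 1} (\<lambda>\<sigma>. (z \<sigma>)\<^sup>2)"
  proof -
    have "sqint {s..s + 1} (\<lambda>\<sigma>. \<bar>z \<sigma>\<bar>)" using zs absint_abs[OF zai] unfolding sqint_def by simp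
    from cauchy_schwarz_unit[OF this] show ?thesis by (simp add: Y_def)
  qed
  have dm: "\<bar>m \<sigma> - m s\<bar> \<le> 2 * Y" if \<sigma>: "\<sigma> \<in> {s..s + 1}" for \<sigma>
  proof -
    have sub: "z absolutely_integrable_on {s..\<sigma>}"
      by (rule absolutely_integrable_on_subinterval[OF zai]) (use \<sigma> in auto)
    have "integral {s..\<sigma>} (\<lambda>\<sigma>. h \<sigma> - h (\<sigma> - 1)) = integral {s..\<sigma>} (\<lambda>\<sigma>. (k - 1) * z \<sigma>)"
      by (rule integral_cong) (use eq s in \<open>auto simp: z_def algebra_simps\<close>)
    then have "m \<sigma> - m s = (k - 1) * integral {s..\<sigma>} z" using inc[of \<sigma>] \<sigma> by simp
    then have "\<bar>m \<sigma> - m s\<bar> = \<bar>k - 1\<bar> * \<bar>integral {s..\<sigma>} z\<bar>" by (simp add: abs_mult)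
    also have "\<dots> \<le> 2 * Y"
    proof (intro mult_mono)
      have "\<bar>integral {s..\<sigma>} z\<bar> \<le> integral {s..\<sigma>} (\<lambda>\<sigma>. \<bar>z \<sigma>\<bar>)"
        by (rule integral_norm_bound_integral[where 'a=real, simplified])
          (use absint_imp_integrable[OF sub] absint_imp_integrable[OF absint_abs[OF sub]] in auto)
      also have "\<dots> \<le> Y" unfolding Y_def
        by (rule integral_subset_le)
          (use \<sigma> absint_imp_integrable[OF absint_abs[OF sub]] absint_imp_integrable[OF absint_abs[OF zai]] in auto)
      finally show "\<bar>integral {s..\<sigma>} z\<bar> \<le> Y" .
    qed (use k in auto)
    finally show ?thesis .
  qed
  have mF: "m s - F (m s) = integral {s..s + 1} (\<lambda>\<sigma>. z \<sigma> + (F (m \<sigma>) - F (m s)))"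
  proof -
    have "m s = integral {s..s + 1} (\<lambda>\<sigma>. h (\<sigma> - 1))"
      unfolding m using integral_shift_real_ivl[of "s - 1" "-1" s h] by simp
    moreover have "((\<lambda>\<sigma>. h (\<sigma> - 1) - F (m s)) has_integral integral {s..s + 1} (\<lambda>\<sigma>. h (\<sigma> - 1)) - F (m s)) {s..s + 1}"
      using has_integral_const_real[of "F (m s)" s "s + 1"] hs unfolding sqint_def
      by (intro has_integral_diff integrable_integral absint_imp_integrable) auto
    ultimately show ?thesis by (simp add: z_def integral_unique)
  qed
  have FmL: "\<bar>F (m \<sigma>) - F (m s)\<bar> \<le> 2 * L * Y" if "\<sigma> \<in> {s..s + 1}" for \<sigma>
    using order_trans[OF F[of "m \<sigma>" "m s"] mult_left_mono[OF dm[OF that] L]] by simp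
  have "\<bar>m s - F (m s)\<bar> \<le> integral {s..s + 1} (\<lambda>\<sigma>. \<bar>z \<sigma>\<bar> + 2 * L * Y)"
    unfolding mF
  proof (rule integral_norm_bound_integral[where 'a=real, simplified])
    show "(\<lambda>\<sigma>. z \<sigma> + (F (m \<sigma>) - F (m s))) integrable_on {s..s + 1}"
      by (intro integrable_add absint_imp_integrable[OF zai] integrable_continuous_interval continuous_intros Fmc)
    show "(\<lambda>\<sigma>. \<bar>z \<sigma>\<bar> + 2 * L * Y) integrable_on {s..s + 1}"
      by (intro integrable_add absint_imp_integrable[OF absint_abs[OF zai]] integrable_const_ivl)
    fix \<sigma> assume "\<sigma> \<in> {s..s + 1}"
    from FmL[OF this] show "\<bar>z \<sigma> + (F (m \<sigma>) - F (m s))\<bar> \<le> \<bar>z \<sigma>\<bar> + 2 * L * Y" by linarith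
  qed
  also have "integral {s..s + 1} (\<lambda>\<sigma>. \<bar>z \<sigma>\<bar> + 2 * L * Y) = Y + 2 * L * Y"
    using has_integral_const_real[of "2 * L * Y" s "s + 1"] integrable_integral[OF absint_imp_integrable[OF absint_abs[OF zai]]]
    unfolding Y_def[symmetric] by (intro integral_unique has_integral_add) auto
  finally have mF1: "\<bar>m s - F (m s)\<bar> \<le> (1 + 2 * L) * Y" by (simp add: algebra_simps)
  have "(1 - \<theta>) * \<bar>m s\<bar> \<le> \<bar>m s - F (m s)\<bar>"
  proof (cases "m s = 0")
    case False
    have "(1 - \<theta>) * \<bar>m s\<bar> * \<bar>m s\<bar> = (1 - \<theta>) * (m s)\<^sup>2" by (simp add: power2_eq_square)
    also have "\<dots> \<le> m s * (m s - F (m s))"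
      using sector[of "m s"] by (simp add: algebra_simps power2_eq_square)
    also have "\<dots> \<le> \<bar>m s - F (m s)\<bar> * \<bar>m s\<bar>" using abs_ge_self[of "m s * (m s - F (m s))"] by (simp add: abs_mult mult.commute)
    finally show ?thesis using False by simp
  qed simp
  then have "\<bar>m s\<bar> \<le> (1 + 2 * L) / (1 - \<theta>) * Y"
    using mF1 \<theta> by (simp add: field_simps)
  then have mb: "\<bar>m \<sigma>\<bar> \<le> N * Y" if "\<sigma> \<in> {s..s + 1}" for \<sigma>
    using dm[OF that] unfolding N by (simp add: distrib_right)
  have "integral {s - 1..s} (\<lambda>x. (h x)\<^sup>2) = integral {s..s + 1} (\<lambda>\<sigma>. (h (\<sigma> - 1))\<^sup>2)"
    using integral_shift_real_ivl[of "s - 1" "-1" s "\<lambda>x. (h x)\<^sup>2"] by simp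
  also have "\<dots> \<le> integral {s..s + 1} (\<lambda>\<sigma>. 2 * (z \<sigma>)\<^sup>2 + 2 * (L * N)\<^sup>2 * Y\<^sup>2)"
  proof (rule integral_le)
    show "(\<lambda>\<sigma>. (h (\<sigma> - 1))\<^sup>2) integrable_on {s..s + 1}"
      using hs unfolding sqint_def by (auto intro: absint_imp_integrable)
    show "(\<lambda>\<sigma>. 2 * (z \<sigma>)\<^sup>2 + 2 * (L * N)\<^sup>2 * Y\<^sup>2) integrable_on {s..s + 1}"
      using absint_imp_integrable[OF z2] by (intro integrable_add integrable_const_ivl integrable_on_mult_right)
    fix \<sigma> assume \<sigma>: "\<sigma> \<in> {s..s + 1}"
    have "\<bar>F (m \<sigma>)\<bar> \<le> L * (N * Y)"
      using F[of "m \<sigma>" 0] F0 mult_left_mono[OF mb[OF \<sigma>] L] by simp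
    then have "(F (m \<sigma>))\<^sup>2 \<le> (L * N)\<^sup>2 * Y\<^sup>2"
      using power_mono[of "\<bar>F (m \<sigma>)\<bar>" "L * (N * Y)" 2] by (simp add: power_mult_distrib mult.assoc)
    moreover have "(h (\<sigma> - 1))\<^sup>2 \<le> 2 * (z \<sigma>)\<^sup>2 + 2 * (F (m \<sigma>))\<^sup>2"
      using sum_squares_bound[of "z \<sigma>" "F (m \<sigma>)"] by (simp add: z_def power2_eq_square algebra_simps)
    ultimately show "(h (\<sigma> - 1))\<^sup>2 \<le> 2 * (z \<sigma>)\<^sup>2 + 2 * (L * N)\<^sup>2 * Y\<^sup>2" by simp
  qed
  also have "\<dots> = 2 * integral {s..s + 1} (\<lambda>\<sigma>. (z \<sigma>)\<^sup>2) + 2 * (L * N)\<^sup>2 * Y\<^sup>2"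
    using has_integral_const_real[of "2 * (L * N)\<^sup>2 * Y\<^sup>2" s "s + 1"]
      has_integral_mult_right[OF integrable_integral[OF absint_imp_integrable[OF z2]], of 2]
    by (intro integral_unique has_integral_add) auto
  also have "\<dots> \<le> 2 * integral {s..s + 1} (\<lambda>\<sigma>. (z \<sigma>)\<^sup>2) + 2 * (L * N)\<^sup>2 * integral {s..s + 1} (\<lambda>\<sigma>. (z \<sigma>)\<^sup>2)"
    using Yz by (intro add_left_mono mult_left_mono) auto
  finally show ?thesis by (simp add: z_def distrib_right)
qed

text \<open>
  The sector condition makes the Lyapunov functional comparable to the integral of \<open>h\<^sup>2\<close>, because
  \<open>m\<^sup>2\<close> is bounded by that integral.  By observability the functional loses a fixed fraction of its
  value over every unit window.
\<close>

lemma delay_decay: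
  fixes F :: "real \<Rightarrow> real"
  assumes F: "\<And>x y. \<bar>F x - F y\<bar> \<le> L * \<bar>x - y\<bar>" and F0: "F 0 = 0"
    and sector: "\<And>x. x * F x \<le> \<theta> * x\<^sup>2" and \<theta>: "0 \<le> \<theta>" "\<theta> < 1" and k: "\<bar>k\<bar> < 1"
  shows "\<exists>C>0. \<exists>\<alpha>>0. \<forall>h. (\<forall>S. sqint {-1..S} h) \<and>
      (\<forall>s\<ge>0. h s = k * h (s - 1) + (1 - k) * F (integral {s - 1..s} h)) \<longrightarrow>
      (\<forall>s\<ge>0. integral {s - 1..s} (\<lambda>x. (h x)\<^sup>2) \<le> C * exp (- \<alpha> * s) * integral {-1..0} (\<lambda>x. (h x)\<^sup>2))"
proof -
  have L: "L \<ge> 0" using F[of 1 0] by simp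
  have Fc: "continuous_on UNIV F" by (rule lipschitz_imp_continuous[OF F])
  obtain \<Phi> where \<Phi>0: "\<Phi> 0 = 0" and \<Phi>: "\<And>x. (\<Phi> has_real_derivative F x) (at x)"
    using continuous_antiderivative[OF Fc] by blast
  have \<Phi>u: "2 * \<Phi> x \<le> \<theta> * x\<^sup>2" for x
  proof -
    have "((\<lambda>x. \<theta> * x\<^sup>2 - 2 * \<Phi> x) has_real_derivative 2 * (\<theta> * x - F x)) (at x)" for x
      by (auto intro!: derivative_eq_intros \<Phi> simp: algebra_simps)
    moreover have "0 \<le> x * (2 * (\<theta> * x - F x))" for x
      using sector[of x] by (simp add: algebra_simps power2_eq_square)
    ultimately have "0 \<le> \<theta> * x\<^sup>2 - 2 * \<Phi> x" by (intro nonneg_of_derivative_sign[where u="\<lambda>x. \<theta> * x\<^sup>2 - 2 * \<Phi> x"]) (auto simp: \<Phi>0)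
    then show ?thesis by simp
  qed
  have Fs: "0 \<le> x * (L * x + F x)" for x
  proof -
    have "\<bar>x * F x\<bar> \<le> L * \<bar>x\<bar> * \<bar>x\<bar>"
      using mult_left_mono[OF F[of x 0], of "\<bar>x\<bar>"] by (simp add: F0 abs_mult mult_ac)
    then have "\<bar>x * F x\<bar> \<le> x * (L * x)" by (simp add: mult_ac)
    then show ?thesis unfolding distrib_left by linarith
  qed
  have \<Phi>l: "- 2 * \<Phi> x \<le> L * x\<^sup>2" for x
  proof -
    have "((\<lambda>x. L * x\<^sup>2 + 2 * \<Phi> x) has_real_derivative 2 * (L * x + F x)) (at x)" for x
      by (auto intro!: derivative_eq_intros \<Phi> simp: algebra_simps)
    moreover have "0 \<le> x * (2 * (L * x + F x))" for x using Fs[of x] by (simp add: algebra_simps)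
    ultimately have "0 \<le> L * x\<^sup>2 + 2 * \<Phi> x" by (intro nonneg_of_derivative_sign[where u="\<lambda>x. L * x\<^sup>2 + 2 * \<Phi> x"]) (auto simp: \<Phi>0)
    then show ?thesis by simp
  qed
  define N where "N = (1 + 2 * L) / (1 - \<theta>) + 2"
  define A where "A = 2 + 2 * (L * N)\<^sup>2"
  have A: "A \<ge> 2" by (simp add: A_def)
  define c where "c = (1 - k\<^sup>2) / ((1 + L) * A)"
  have k2: "k\<^sup>2 < 1" using k by (simp add: abs_square_less_1)
  have c: "0 < c" unfolding c_def using k2 L A by simp
  have LA: "(1 + L) * A \<ge> 2" using mult_mono[of 1 "1 + L" 2 A] L A by simp
  have c1: "c < 1" unfolding c_def using k2 LA zero_le_power2[of k]
    by (subst divide_less_eq_1_pos) linarith+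
  \<comment> \<open>The factor \<open>exp c\<close> accounts for the incomplete last window.\<close>
  define C where "C = exp c * (1 + L) / (1 - \<theta>)"
  have C: "C > 0" unfolding C_def using L \<theta> by simp
  show ?thesis
  proof (rule exI[of _ C], rule conjI[OF C], rule exI[of _ c], rule conjI[OF c], intro allI impI)
    fix h s assume h': "(\<forall>S. sqint {-1..S} h) \<and>
      (\<forall>s\<ge>0. h s = k * h (s - 1) + (1 - k) * F (integral {s - 1..s} h))" and s: "(0::real) \<le> s"
    define m where "m s = integral {s - 1..s} h" for s
    define E where "E s = integral {s - 1..s} (\<lambda>x. (h x)\<^sup>2)" for s
    define V where "V s = E s - 2 * \<Phi> (m s)" for s
    define Z where "Z a b = integral {a..b} (\<lambda>\<sigma>. (h (\<sigma> - 1) - F (m \<sigma>))\<^sup>2)" for a b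
    have h: "\<And>S. sqint {-1..S} h" and eq: "\<And>s. 0 \<le> s \<Longrightarrow> h s = k * h (s - 1) + (1 - k) * F (m s)"
      using h' by (auto simp: m_def)
    have diss: "V b = V a - (1 - k\<^sup>2) * Z a b" if "0 \<le> a" "a \<le> b" for a b
    proof -
      have "V b - V a = - (1 - k\<^sup>2) * Z a b"
        unfolding V_def E_def Z_def by (rule delay_dissipation[OF h m_def eq F \<Phi> that])
      then show ?thesis unfolding mult_minus_left by linarith
    qed
    have Z0: "Z a b \<ge> 0" for a b
      unfolding Z_def by (cases "(\<lambda>\<sigma>. (h (\<sigma> - 1) - F (m \<sigma>))\<^sup>2) integrable_on {a..b}")
        (auto intro: integral_nonneg simp: not_integrable_integral)
    have mono: "V b \<le> V a" if "0 \<le> a" "a \<le> b" for a b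
      using diss[OF that] mult_nonneg_nonneg[OF _ Z0[of a b], of "1 - k\<^sup>2"] k2 by linarith
    have obs: "E s \<le> A * Z s (s + 1)" if "0 \<le> s" for s
      unfolding E_def Z_def A_def
      by (rule delay_observability[OF h m_def eq F F0 sector \<theta>(2) less_imp_le[OF k] that N_def])
    have mE: "(m s)\<^sup>2 \<le> E s" if "0 \<le> s" for s
      using cauchy_schwarz_unit[of "s - 1" h] sqint_subinterval[OF h, of "s - 1" s s] that
      by (simp add: m_def E_def)
    have E0: "E s \<ge> 0" if "0 \<le> s" for s using mE[OF that] zero_le_power2[of "m s"] by linarith
    have Vl: "(1 - \<theta>) * E s \<le> V s" if "0 \<le> s" for s
      using \<Phi>u[of "m s"] mult_left_mono[OF mE[OF that] \<theta>(1)] by (simp add: V_def algebra_simps)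
    have Vu: "V s \<le> (1 + L) * E s" if "0 \<le> s" for s
      using \<Phi>l[of "m s"] mult_left_mono[OF mE[OF that] L] by (simp add: V_def algebra_simps)
    have step: "V (s + 1) \<le> (1 - c) * V s" if "0 \<le> s" for s
    proof -
      have "V s \<le> (1 + L) * (A * Z s (s + 1))"
        by (rule order_trans[OF Vu[OF that] mult_left_mono[OF obs[OF that]]]) (use L in simp)
      then have "c * V s \<le> c * ((1 + L) * (A * Z s (s + 1)))" using c by (intro mult_left_mono) auto
      also have "\<dots> = (1 - k\<^sup>2) * Z s (s + 1)" 
      proof -
        have "1 + L \<noteq> 0" "A \<noteq> 0" using L A by auto
        then show ?thesis by (simp add: c_def)
      qed
      finally show ?thesis using diss[of s "s + 1"] that unfolding left_diff_distrib by linarith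
    qed
    have geo: "V (real n) \<le> (1 - c) ^ n * V 0" for n
    proof (induction n)
      case (Suc n)
      have "V (real (Suc n)) \<le> (1 - c) * V (real n)" using step[of "real n"] by (simp add: add.commute)
      also have "\<dots> \<le> (1 - c) * ((1 - c) ^ n * V 0)" using Suc c1 by (intro mult_left_mono) auto
      finally show ?case by simp
    qed simp
    define n where "n = nat \<lfloor>s\<rfloor>"
    have n: "real n \<le> s" "s \<le> real n + 1" using s by (auto simp: n_def)
    have V0: "V 0 \<ge> 0" 
      by (rule order_trans[OF mult_nonneg_nonneg Vl]) (use E0[of 0] \<theta> in auto)
    have "(1 - c) ^ n \<le> exp (- c) ^ n"
      using exp_ge_add_one_self[of "- c"] c1 by (intro power_mono) auto
    also have "\<dots> = exp (- c * real n)" by (rule exp_of_nat2_mult[symmetric])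
    also have "\<dots> \<le> exp (c - c * s)" using n(2) c mult_left_mono[OF n(2), of c] by (simp add: algebra_simps)
    finally have e: "(1 - c) ^ n \<le> exp c * exp (- c * s)" by (simp flip: exp_add)
    have "(1 - \<theta>) * E s \<le> V s" by (rule Vl[OF s])
    also have "\<dots> \<le> V (real n)" by (rule mono) (use n in auto)
    also have "\<dots> \<le> (1 - c) ^ n * V 0" by (rule geo)
    also have "\<dots> \<le> (exp c * exp (- c * s)) * ((1 + L) * E 0)"
      by (intro mult_mono e Vu V0) auto
    finally have "E s \<le> (exp c * exp (- c * s)) * ((1 + L) * E 0) / (1 - \<theta>)"
      using \<theta> by (subst pos_le_divide_eq) (simp_all add: mult.commute)
    then have "E s \<le> C * exp (- c * s) * E 0" by (simp add: C_def mult_ac)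
    then show "integral {s - 1..s} (\<lambda>x. (h x)\<^sup>2) \<le> C * exp (- c * s) * integral {-1..0} (\<lambda>x. (h x)\<^sup>2)"
      by (simp add: E_def)
  qed
qed

section \<open>Elements of the Lebesgue space and their translations\<close>

lemma absint_iff_integrable:
  fixes f :: "real \<Rightarrow> real"
  assumes "S \<in> sets lebesgue"
  shows "f absolutely_integrable_on S \<longleftrightarrow> integrable (lebesgue_on S) f"
  using assms by (simp add: set_integrable_def integrable_restrict_space)

lemma LINT_eq_integral:
  fixes f :: "real \<Rightarrow> real"
  assumes "f absolutely_integrable_on {a..b}"
  shows "(LINT x|lebesgue_on {a..b}. f x) = integral {a..b} f"
  using assms by (intro lebesgue_integral_eq_integral) (auto simp: absint_iff_integrable)

lemma LINT_eq_integral_open: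
  fixes f :: "real \<Rightarrow> real"
  assumes "f absolutely_integrable_on {a..b}"
  shows "(LINT x|lebesgue_on {a<..<b}. f x) = integral {a..b} f"
proof -
  have "integrable (lebesgue_on {a<..<b}) f"
    using assms by (simp add: absint_iff_integrable[symmetric] absolutely_integrable_on_Icc_iff_Ioo[symmetric])
  then show ?thesis
    by (simp add: lebesgue_integral_eq_integral integral_open_interval_real)
qed

lemma L2_on_iff_sqint:
  shows "L2_on {a..b} f \<longleftrightarrow> sqint {a..b} f"
proof
  assume f: "L2_on {a..b} f"
  then have sq: "(\<lambda>x. (f x)\<^sup>2) absolutely_integrable_on {a..b}"
    unfolding L2_on_def by (simp add: absint_iff_integrable)
  have "f absolutely_integrable_on {a..b}"
  proof (rule measurable_bounded_by_integrable_imp_absolutely_integrable[where g="\<lambda>x. 1 + (f x)\<^sup>2"])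
    show "f \<in> borel_measurable (lebesgue_on {a..b})" using f by (simp add: L2_on_def)
    show "(\<lambda>x. 1 + (f x)\<^sup>2) integrable_on {a..b}"
      by (intro integrable_add integrable_const_ivl absint_imp_integrable sq)
    show "norm (f x) \<le> 1 + (f x)\<^sup>2" for x
      using sum_squares_bound[of 1 "\<bar>f x\<bar>"] by simp
  qed simp
  with sq show "sqint {a..b} f" by (simp add: sqint_def)
next
  assume "sqint {a..b} f"
  then show "L2_on {a..b} f" unfolding L2_on_def sqint_def by (auto simp: absint_iff_integrable)
qed

lemma L2_on_open_iff_sqint:
  shows "L2_on {a<..<b} f \<longleftrightarrow> sqint {a..b} f"
proof -
  have "f \<in> borel_measurable (lebesgue_on {a..b})" if "f \<in> borel_measurable (lebesgue_on {a<..<b})"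
  proof (cases "a \<le> b")
    case True
    have "f measurable_on {a<..<b}" using that by (simp add: measurable_on_iff_borel_measurable)
    then have "f measurable_on {a..b}"
      unfolding measurable_on_UNIV[symmetric, of f]
      by (rule measurable_on_spike[where S="{a, b}"]) auto
    then show ?thesis by (simp add: measurable_on_iff_borel_measurable)
  qed (use that in simp)
  moreover have "f \<in> borel_measurable (lebesgue_on {a<..<b})" if "f \<in> borel_measurable (lebesgue_on {a..b})"
    using that by (rule measurable_restrict_mono) auto
  ultimately have meas: "f \<in> borel_measurable (lebesgue_on {a<..<b}) \<longleftrightarrow> f \<in> borel_measurable (lebesgue_on {a..b})"
    by blast
  have S: "{a<..<b} \<in> sets lebesgue" "{a..b} \<in> sets lebesgue" by auto
  have "L2_on {a<..<b} f \<longleftrightarrow> L2_on {a..b} f"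
    unfolding L2_on_def meas S[THEN absint_iff_integrable, symmetric] absolutely_integrable_on_Icc_iff_Ioo ..
  then show ?thesis by (simp add: L2_on_iff_sqint)
qed

lemma norm_L2_eq:
  assumes "sqint {0..1} f"
  shows "norm_L2 {0<..<1} f = sqrt (integral {0..1} (\<lambda>x. (f x)\<^sup>2))"
  using assms unfolding norm_L2_def sqint_def by (simp add: LINT_eq_integral_open)

text \<open>
  By this inequality, translations of \<open>h\<close> are compared in the square norm through translations of
  the integrable function \<open>h * \<bar>h\<bar>\<close> in the integral norm.
\<close>

lemma square_diff_le:
  fixes a b :: real
  shows "(a - b)\<^sup>2 \<le> 2 * \<bar>a * \<bar>a\<bar> - b * \<bar>b\<bar>\<bar>"
proof -
  have same: "(a - b)\<^sup>2 \<le> \<bar>a * a - b * b\<bar>" if "0 \<le> a" "0 \<le> b" for a b :: real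
  proof -
    have "\<bar>a - b\<bar> * \<bar>a - b\<bar> \<le> \<bar>a - b\<bar> * \<bar>a + b\<bar>" using that by (intro mult_left_mono) auto
    moreover have "\<bar>a - b\<bar> * \<bar>a + b\<bar> = \<bar>a * a - b * b\<bar>" by (simp add: algebra_simps flip: abs_mult)
    ultimately show ?thesis by (simp add: power2_eq_square flip: abs_mult)
  qed
  have opp: "(a - b)\<^sup>2 \<le> 2 * (a * a + b * b)"
    using zero_le_power2[of "a + b"] by (simp add: power2_eq_square algebra_simps)
  have double: "x \<le> \<bar>y\<bar> \<Longrightarrow> x \<le> 2 * \<bar>y\<bar>" for x y :: real by linarith
  have pos: "0 \<le> a * a" "0 \<le> b * b" by auto
  consider "0 \<le> a" "0 \<le> b" | "a < 0" "b < 0" | "0 \<le> a" "b < 0" | "a < 0" "0 \<le> b" by linarith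
  then show ?thesis
  proof cases
    case 1
    have e: "\<bar>a * \<bar>a\<bar> - b * \<bar>b\<bar>\<bar> = \<bar>a * a - b * b\<bar>" using 1 by simp
    show ?thesis unfolding e by (rule double[OF same[OF 1]])
  next
    case 2
    have e: "\<bar>a * \<bar>a\<bar> - b * \<bar>b\<bar>\<bar> = \<bar>a * a - b * b\<bar>" using 2 by (simp add: abs_minus_commute)
    have "(a - b)\<^sup>2 \<le> \<bar>a * a - b * b\<bar>"
      using same[of "- a" "- b"] 2 by (simp add: power2_commute[of a b])
    then show ?thesis unfolding e by (rule double)
  next
    case 3 then show ?thesis using opp pos by simp
  next
    case 4 then show ?thesis using opp pos by simp
  qed
qed

lemma translation_L2:
  assumes h: "sqint {A..B} h" and "e > 0"
  shows "\<exists>d>0. \<forall>s\<in>{A+1..B}. \<forall>s'\<in>{A+1..B}. \<bar>s - s'\<bar> < d \<longrightarrow>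
           integral {0..1} (\<lambda>x. (h (s - x) - h (s' - x))\<^sup>2) < e"
proof -
  define q where "q x = h x * \<bar>h x\<bar>" for x
  have "sqint {A..B} (\<lambda>x. \<bar>h x\<bar>)" using h absint_abs unfolding sqint_def by auto
  from sqint_mult[OF h this] have q: "q absolutely_integrable_on {A..B}" by (simp add: q_def[abs_def])
  have "e / 2 > 0" using \<open>e > 0\<close> by simp
  from translation_L1[OF q this] obtain d where d: "d > 0"
    "\<And>s s'. s \<in> {A+1..B} \<Longrightarrow> s' \<in> {A+1..B} \<Longrightarrow> \<bar>s - s'\<bar> < d \<Longrightarrow>
       integral {0..1} (\<lambda>x. \<bar>q (s - x) - q (s' - x)\<bar>) < e / 2" by blast
  show ?thesis
  proof (intro exI[of _ d] conjI ballI impI d(1))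
    fix s s' assume s: "s \<in> {A+1..B}" "s' \<in> {A+1..B}" "\<bar>s - s'\<bar> < d"
    have hw: "sqint {0..1} (\<lambda>x. h (u - x))" if "u \<in> {A+1..B}" for u
      by (rule sqint_window, rule sqint_subinterval[OF h]) (use that in auto)
    have qw: "(\<lambda>x. q (u - x)) absolutely_integrable_on {0..1}" if "u \<in> {A+1..B}" for u
      by (rule absint_window, rule absolutely_integrable_on_subinterval[OF q]) (use that in auto)
    have "integral {0..1} (\<lambda>x. (h (s - x) - h (s' - x))\<^sup>2) \<le> integral {0..1} (\<lambda>x. 2 * \<bar>q (s - x) - q (s' - x)\<bar>)"
    proof (rule integral_le)
      show "(\<lambda>x. (h (s - x) - h (s' - x))\<^sup>2) integrable_on {0..1}"
        using sqint_diff[OF hw[OF s(1)] hw[OF s(2)]] unfolding sqint_def by (auto intro: absint_imp_integrable)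
      show "(\<lambda>x. 2 * \<bar>q (s - x) - q (s' - x)\<bar>) integrable_on {0..1}"
        by (intro integrable_on_mult_right absint_imp_integrable absint_abs set_integral_diff(1) qw s)
    qed (auto simp: q_def square_diff_le)
    also have "\<dots> = 2 * integral {0..1} (\<lambda>x. \<bar>q (s - x) - q (s' - x)\<bar>)" by simp
    also have "\<dots> < e" using d(2)[OF s] by simp
    finally show "integral {0..1} (\<lambda>x. (h (s - x) - h (s' - x))\<^sup>2) < e" .
  qed
qed

section \<open>Solutions of the delay equation and the change of time\<close>

lemma window_continuous:
  fixes f :: "real \<Rightarrow> real"
  assumes "\<And>S. f absolutely_integrable_on {-1..S}"
  shows "continuous_on {0..} (\<lambda>s. integral {s - 1..s} f)"
proof (rule continuous_on_halflineI)
  fix b :: real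
  show "continuous_on {0..b} (\<lambda>s. integral {s - 1..s} f)"
  proof (cases "0 \<le> b")
    case True
    have "continuous_on {0..b} (\<lambda>s. integral {0 - 1..0} f + integral {0..s} (\<lambda>\<sigma>. f \<sigma> - f (\<sigma> - 1)))"
      by (intro continuous_intros indefinite_integral_continuous_1 absint_imp_integrable window_increment(2)[OF assms] True) simp
    then show ?thesis
      by (rule continuous_on_eq) (use window_increment(1)[OF assms, of 0] in simp)
  qed simp
qed

text \<open>
  The fixed point is sought for the primitive \<open>G\<close> of \<open>h\<close>, which is continuous although \<open>h\<close> is not;
  the recursion then recovers \<open>h\<close> from \<open>G\<close>.
\<close>

lemma delay_solution_exists:
  fixes F h0 :: "real \<Rightarrow> real"
  assumes h0: "sqint {-1..0} h0"
    and F: "\<And>x y. \<bar>F x - F y\<bar> \<le> L * \<bar>x - y\<bar>" and FB: "\<And>x. \<bar>F x\<bar> \<le> B" and k: "\<bar>k\<bar> \<le> 1"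
  obtains h where "\<And>S. sqint {-1..S} h" "\<And>s. s < 0 \<Longrightarrow> h s = h0 s"
    "\<And>s. 0 \<le> s \<Longrightarrow> h s = k * h (s - 1) + (1 - k) * F (integral {s - 1..s} h)"
proof -
  have L: "L \<ge> 0" using F[of 1 0] by simp
  have Fc: "continuous_on UNIV F" by (rule lipschitz_imp_continuous[OF F])
  have h0i: "h0 integrable_on {-1..0}" using h0 unfolding sqint_def by (auto intro: absint_imp_integrable)
  define P where "P s = integral {-1..s} h0" for s
  define G0 where "G0 s = P (max (-1) (min s 0)) - P 0" for s
  have Pc: "continuous_on {-1..0} P" unfolding P_def by (rule indefinite_integral_continuous_1[OF h0i])
  have G0c: "continuous_on UNIV G0"
    unfolding G0_def
    by (intro continuous_intros continuous_on_compose2[OF Pc]) (auto intro!: continuous_intros)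
  have "bounded (P ` {-1..0})" by (simp add: Pc compact_continuous_image compact_imp_bounded)
  then obtain b where b: "\<And>s. s \<in> {-1..0} \<Longrightarrow> \<bar>P s\<bar> \<le> b" unfolding bounded_iff by (metis imageI real_norm_def)
  have G0b: "\<bar>G0 s\<bar> \<le> 2 * b" for s
    unfolding G0_def using b[of "max (-1) (min s 0)"] b[of 0] abs_triangle_ineq4[of "P (max (-1) (min s 0))" "P 0"] by auto
  have G00: "G0 s = 0" if "s \<ge> 0" for s using that by (simp add: G0_def max_def min_def)
  obtain G where Gc: "continuous_on UNIV G" and Gn: "\<And>s. s \<le> 0 \<Longrightarrow> G s = G0 s"
    and G: "\<And>s. 0 \<le> s \<Longrightarrow> G s = k * (G (s - 1) - G (-1)) + (1 - k) * integral {0..s} (\<lambda>\<sigma>. F (G \<sigma> - G (\<sigma> - 1)))"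
    using delay_primitive_exists[OF G0c G00 G0b F FB k] by blast
  define w where "w \<sigma> = F (G \<sigma> - G (\<sigma> - 1))" for \<sigma>
  have wc: "continuous_on {0..} w"
    unfolding w_def
    by (intro continuous_on_compose2[OF Fc] continuous_intros continuous_on_subset[OF Gc]
        continuous_on_compose2[OF Gc]) auto
  define h where "h = delay_profile h0 k w"
  have hs: "sqint {-1..S} h" for S unfolding h_def by (rule delay_profile_sqint[OF h0 wc])
  have Gi: "integral {-1..s} h = G s - G (-1)" if "-1 \<le> s" for s
    unfolding h_def
  proof (rule delay_profile_integral[OF h0 wc _ _ _ that])
    show "G s = G (- 1) + integral {- 1..s} h0" if "-1 \<le> s" "s \<le> 0" for s
      using that Gn[of s] Gn[of "-1"] by (simp add: G0_def max_def min_def P_def)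
    show "G 0 = 0" using Gn[of 0] G00[of 0] by simp
    show "G s = k * (G (s - 1) - G (- 1)) + (1 - k) * integral {0..s} w" if "0 \<le> s" for s
      using G[OF that] by (simp add: w_def[abs_def])
  qed
  have win: "integral {s - 1..s} h = G s - G (s - 1)" if "0 \<le> s" for s
  proof -
    have "integral {s - 1..s} h = integral {-1..s} h - integral {-1..s - 1} h"
      by (rule integral_split) (use hs that in \<open>auto simp: sqint_def intro: absint_imp_integrable\<close>)
    then show ?thesis using Gi[of s] Gi[of "s - 1"] that by simp
  qed
  show thesis
  proof (rule that[of h])
    show "h s = h0 s" if "s < 0" for s using that by (simp add: h_def delay_profile.simps)
    show "h s = k * h (s - 1) + (1 - k) * F (integral {s - 1..s} h)" if "0 \<le> s" for s
      using that win[OF that] by (simp add: h_def w_def delay_profile.simps[of h0 k w s])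
  qed (rule hs)
qed

lemma time_change:
  fixes p :: "real \<Rightarrow> real"
  assumes p: "continuous_on UNIV p" and c: "c > 0" and pc: "\<And>s. c \<le> p s"
  obtains A B where "\<And>s. (A has_real_derivative p s) (at s)" "A 0 = 0"
    "\<And>t. A (B t) = t" "\<And>s. B (A s) = s" "\<And>t. (B has_real_derivative 1 / p (B t)) (at t)" "B 0 = 0"
    "strict_mono A" "strict_mono B"
proof -
  obtain A where A0: "A 0 = 0" and A: "\<And>s. (A has_real_derivative p s) (at s)"
    using continuous_antiderivative[OF p] by blast
  have lower: "c * (t - s) \<le> A t - A s" if "s \<le> t" for s t
  proof (cases "s = t")
    case False
    then have "s < t" using that by simp
    from MVT2[OF this A] obtain z where "A t - A s = (t - s) * p z" by blast
    then show ?thesis using pc[of z] that by (simp add: mult.commute[of c] mult_left_mono)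
  qed simp
  have Am: "strict_mono A"
  proof (rule strict_monoI)
    fix s t :: real assume "s < t"
    then show "A s < A t" using lower[of s t] mult_pos_pos[OF c, of "t - s"] by linarith
  qed
  have Ac: "continuous_on S A" for S
    using A by (meson DERIV_continuous_on has_field_derivative_at_within)
  have "\<exists>s. A s = t" for t
  proof -
    have "\<exists>s. - (\<bar>t\<bar> / c) \<le> s \<and> s \<le> \<bar>t\<bar> / c \<and> A s = t"
    proof (rule IVT')
      show "A (- (\<bar>t\<bar> / c)) \<le> t" using lower[of "- (\<bar>t\<bar> / c)" 0] c by (simp add: A0)
      show "t \<le> A (\<bar>t\<bar> / c)" using lower[of 0 "\<bar>t\<bar> / c"] c by (simp add: A0)
      show "- (\<bar>t\<bar> / c) \<le> \<bar>t\<bar> / c"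
        using c divide_nonneg_pos[of "\<bar>t\<bar>" c] by linarith
    qed (rule Ac)
    then show ?thesis by blast
  qed
  then obtain B where AB: "\<And>t. A (B t) = t" by metis
  have inj: "A s = A t \<Longrightarrow> s = t" for s t using strict_mono_eq[OF Am] by blast
  have BA: "B (A s) = s" for s by (rule inj) (rule AB)
  have Bm: "strict_mono B"
    by (rule strict_monoI) (metis AB Am strict_mono_less)
  have Bc: "isCont B t" for t
  proof -
    have "isCont B (A (B t))"
      by (rule isCont_inverse_function[where d=1]) (auto simp: BA intro: DERIV_isCont[OF A])
    then show ?thesis by (simp add: AB)
  qed
  have "(B has_real_derivative inverse (p (B t))) (at t)" for t
    by (rule DERIV_inverse_function[where f=A and a="t - 1" and b="t + 1"])
      (use A pc[of "B t"] c AB Bc in auto)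
  then show thesis
    using that[of A B] A A0 AB BA Bm Am by (metis inverse_eq_divide)
qed

section \<open>Weak solutions from profiles\<close>

lemma profile_C0_L2:
  fixes g \<xi> :: "real \<Rightarrow> real"
  assumes g: "\<And>S. sqint {-1..S} g" and \<xi>: "continuous_on {0..} \<xi>" and \<xi>0: "\<And>t. 0 \<le> t \<Longrightarrow> 0 \<le> \<xi> t"
  shows "C0_L2 (\<lambda>t x. g (\<xi> t - x))"
  unfolding C0_L2_def
proof (intro conjI allI impI)
  have win: "sqint {0..1} (\<lambda>x. g (\<xi> t - x))" if "0 \<le> t" for t
    by (rule sqint_window, rule sqint_subinterval[OF g]) (use \<xi>0[OF that] in auto)
  show "L2_on {0<..<1} (\<lambda>x. g (\<xi> t - x))" if "0 \<le> t" for t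
    using win[OF that] by (simp add: L2_on_open_iff_sqint)
  fix s :: real assume s: "0 \<le> s"
  show "((\<lambda>t. norm_L2 {0<..<1} (\<lambda>x. g (\<xi> t - x) - g (\<xi> s - x))) \<longlongrightarrow> 0) (at s within {0..})"
  proof (rule tendstoI)
    fix e :: real assume e: "e > 0"
    define B where "B = \<xi> s + 1"
    have "e\<^sup>2 > 0" using e by simp
    from translation_L2[OF g[of B] this] obtain d where d: "d > 0"
      "\<And>u u'. u \<in> {-1+1..B} \<Longrightarrow> u' \<in> {-1+1..B} \<Longrightarrow> \<bar>u - u'\<bar> < d \<Longrightarrow>
         integral {0..1} (\<lambda>x. (g (u - x) - g (u' - x))\<^sup>2) < e\<^sup>2" by blast
    have "min d 1 > 0" using d(1) by simp
    then obtain a where a: "a > 0" "\<And>t. t \<in> {0..} \<Longrightarrow> dist t s < a \<Longrightarrow> dist (\<xi> t) (\<xi> s) < min d 1"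
      using \<xi> s unfolding continuous_on_iff by (metis atLeast_iff)
    have "norm_L2 {0<..<1} (\<lambda>x. g (\<xi> t - x) - g (\<xi> s - x)) < e" if t: "t \<in> {0..}" "dist t s < a" for t
    proof -
      have "dist (\<xi> t) (\<xi> s) < min d 1" by (rule a(2)[OF t])
      then have c: "\<bar>\<xi> t - \<xi> s\<bar> < d" "\<bar>\<xi> t - \<xi> s\<bar> < 1" by (auto simp: dist_real_def)
      have "integral {0..1} (\<lambda>x. (g (\<xi> t - x) - g (\<xi> s - x))\<^sup>2) < e\<^sup>2"
        by (rule d(2)) (use \<xi>0[OF s] \<xi>0[of t] t c in \<open>auto simp: B_def\<close>)
      then have "sqrt (integral {0..1} (\<lambda>x. (g (\<xi> t - x) - g (\<xi> s - x))\<^sup>2)) < sqrt (e\<^sup>2)"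
        by (rule real_sqrt_less_mono)
      moreover have "sqint {0..1} (\<lambda>x. g (\<xi> t - x) - g (\<xi> s - x))"
        using t by (intro sqint_diff win s) auto
      ultimately show ?thesis using e by (simp add: norm_L2_eq)
    qed
    moreover have "0 \<le> norm_L2 {0<..<1} f" for f by (simp add: norm_L2_def integral_nonneg_AE)
    ultimately show "\<forall>\<^sub>F t in at s within {0..}. dist (norm_L2 {0<..<1} (\<lambda>x. g (\<xi> t - x) - g (\<xi> s - x))) 0 < e"
      unfolding eventually_at using a(1) by (intro exI[of _ a]) simp
  qed
qed

text \<open>
  The outflux is the velocity times the value \<open>g (\<xi> t - 1)\<close> of the profile at the right end, and the
  delay equation at \<open>s = \<xi> t\<close>, multiplied by the velocity, is the boundary law.  The weak formulation
  is then the transport identity.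
\<close>

lemma weak_solution_of_profile:
  fixes g \<xi> \<Lambda> \<rho>0 :: "real \<Rightarrow> real" and r k :: real
  assumes g: "\<And>S. sqint {-1..S} g" and \<rho>0: "\<And>x. x \<in> {0<..<1} \<Longrightarrow> \<rho>0 x = g (- x)"
    and \<Lambda>: "continuous_on UNIV \<Lambda>" "\<And>w. \<Lambda> w > 0"
    and \<xi>0: "\<xi> 0 = 0"
    and \<xi>: "\<And>t. 0 \<le> t \<Longrightarrow> (\<xi> has_real_derivative \<Lambda> (integral {\<xi> t - 1..\<xi> t} g)) (at t)"
    and delay: "\<And>s. 0 \<le> s \<Longrightarrow> g s = k * g (s - 1) + (1 - k) * r * \<Lambda> r / \<Lambda> (integral {s - 1..s} g)"
  shows "weak_solution \<Lambda> r k \<rho>0 (\<lambda>t x. g (\<xi> t - x))"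
proof -
  define w where "w s = integral {s - 1..s} g" for s
  define v where "v t = \<Lambda> (w (\<xi> t))" for t
  have gai: "g absolutely_integrable_on {-1..S}" for S using g by (simp add: sqint_def)
  have g2ai: "(\<lambda>x. (g x)\<^sup>2) absolutely_integrable_on {-1..S}" for S using g by (simp add: sqint_def)
  have \<xi>d: "(\<xi> has_real_derivative v t) (at t within {0..\<tau>})" if "t \<in> {0..\<tau>}" for t \<tau>
    using \<xi>[of t] that by (auto simp: v_def w_def intro: has_field_derivative_at_within)
  have \<xi>c: "continuous_on {0..} \<xi>"
    by (intro continuous_on_halflineI) (meson DERIV_continuous_on \<xi>d)
  have vpos: "v t > 0" for t by (simp add: v_def \<Lambda>(2))
  have \<xi>nn: "0 \<le> \<xi> t" "t \<le> \<tau> \<Longrightarrow> \<xi> t \<le> \<xi> \<tau>" if t: "0 \<le> t" for t \<tau>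
  proof -
    have img: "\<xi> ` {0..\<tau>} = {\<xi> 0..\<xi> \<tau>}" if "0 \<le> \<tau>" for \<tau>
      using positive_derivative_bijection(2)[OF \<xi>d vpos that] .
    show "0 \<le> \<xi> t" using img[OF t] t \<xi>0 by auto
    show "\<xi> t \<le> \<xi> \<tau>" if "t \<le> \<tau>" using img[of \<tau>] t that by force
  qed
  have wc: "continuous_on {0..} w" unfolding w_def by (rule window_continuous[OF gai])
  have vc: "continuous_on {0..\<tau>} v" for \<tau>
    unfolding v_def
    by (intro continuous_on_compose2[OF \<Lambda>(1)] continuous_on_compose2[OF wc] continuous_on_subset[OF \<xi>c])
      (use \<xi>nn in auto)
  have mass: "total_mass (\<lambda>t x. g (\<xi> t - x)) t = w (\<xi> t)" if "0 \<le> t" for t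
  proof -
    have "(\<lambda>x. g (\<xi> t - x)) absolutely_integrable_on {0..1}"
      by (rule absint_window, rule absolutely_integrable_on_subinterval[OF gai[of "\<xi> t"]]) (use \<xi>nn[OF that] in auto)
    then show ?thesis unfolding total_mass_def w_def by (simp add: LINT_eq_integral_open integral_window)
  qed
  define y where "y t = v t * g (\<xi> t - 1)" for t
  have subst: "(\<lambda>t. v t * q (\<xi> t - 1)) absolutely_integrable_on {0..\<tau>}"
    if "\<And>S. q absolutely_integrable_on {-1..S}" "0 \<le> \<tau>" for q :: "real \<Rightarrow> real" and \<tau>
  proof (rule absint_increasing_substitution(1)[where \<xi>="\<lambda>t. \<xi> t - 1"])
    show "((\<lambda>t. \<xi> t - 1) has_real_derivative v t) (at t within {0..\<tau>})" if "t \<in> {0..\<tau>}" for t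
      using \<xi>d[OF that] by (auto intro!: derivative_eq_intros)
    show "q absolutely_integrable_on {\<xi> 0 - 1..\<xi> \<tau> - 1}"
      using that(1) by (simp add: \<xi>0)
  qed (use vpos that in auto)
  have yai: "y absolutely_integrable_on {0..\<tau>}" if "0 \<le> \<tau>" for \<tau>
    unfolding y_def by (rule subst[OF gai that])
  have "sqint {0..\<tau>} y" if "0 \<le> \<tau>" for \<tau>
  proof -
    have "(\<lambda>t. v t * (v t * (g (\<xi> t - 1))\<^sup>2)) absolutely_integrable_on {0..\<tau>}"
      by (intro absint_mult_continuous vc subst[OF g2ai that])
    moreover have "(\<lambda>t. v t * (v t * (g (\<xi> t - 1))\<^sup>2)) = (\<lambda>t. (y t)\<^sup>2)"
      by (auto simp: y_def power2_eq_square)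
    ultimately show ?thesis using yai[OF that] by (simp add: sqint_def)
  qed
  then have yL2: "L2_loc y" unfolding L2_loc_def by (simp add: L2_on_iff_sqint)
  have weak: "- (LINT t|lebesgue_on {0..\<tau>}. LINT x|lebesgue_on {0<..<1}.
               g (\<xi> t - x) * (\<phi>t t x + \<Lambda> (total_mass (\<lambda>t x. g (\<xi> t - x)) t) * \<phi>x t x))
          - (LINT x|lebesgue_on {0<..<1}. \<rho>0 x * \<phi> 0 x)
          + (LINT t|lebesgue_on {0..\<tau>}.
               y t * \<phi> t 1 - (k * y t + (1 - k) * r * \<Lambda> r) * \<phi> t 0) = 0"
    if \<tau>: "\<tau> > 0" and C1: "C1_rect \<tau> \<phi> \<phi>t \<phi>x" and end0: "\<forall>x\<in>{0..1}. \<phi> \<tau> x = 0" for \<tau> \<phi> \<phi>t \<phi>x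
  proof -
    let ?R = "{0..\<tau>} \<times> {0..1::real}"
    define J where "J t = integral {0..1} (\<lambda>x. g (\<xi> t - x) * (\<phi>t t x + v t * \<phi>x t x))" for t
    have tc: "continuous_on ?R (\<lambda>(t, x). \<phi>t t x)" and xc: "continuous_on ?R (\<lambda>(t, x). \<phi>x t x)"
      using C1 unfolding C1_rect_def by auto
    note \<phi>c = C1_rectD(1)[OF C1]
    have fc: "continuous_on ?R (\<lambda>(t, x). \<phi>t t x + v t * \<phi>x t x)"
      using tc xc continuous_on_fst_snd(1)[OF vc] by (auto simp: split_beta intro!: continuous_intros)
    have \<xi>r: "\<xi> t \<in> {-1 + 1..\<xi> \<tau>}" if "t \<in> {0..\<tau>}" for t using \<xi>nn(1)[of t] \<xi>nn(2)[of t \<tau>] that by auto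
    have \<xi>c': "continuous_on {0..\<tau>} \<xi>" by (rule continuous_on_subset[OF \<xi>c]) auto
    have Jc: "continuous_on {0..\<tau>} J"
      unfolding J_def by (rule transport_integral_continuous(1)[OF gai \<xi>c' _ fc]) (rule \<xi>r)
    have inner: "(\<lambda>x. g (\<xi> t - x) * (\<phi>t t x + v t * \<phi>x t x)) absolutely_integrable_on {0..1}" if "t \<in> {0..\<tau>}" for t
      by (rule transport_integral_continuous(2)[OF gai \<xi>c' _ fc that]) (rule \<xi>r)
    have "(LINT t|lebesgue_on {0..\<tau>}. LINT x|lebesgue_on {0<..<1}.
               g (\<xi> t - x) * (\<phi>t t x + \<Lambda> (total_mass (\<lambda>t x. g (\<xi> t - x)) t) * \<phi>x t x))
        = (LINT t|lebesgue_on {0..\<tau>}. J t)"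
    proof (rule Bochner_Integration.integral_cong[OF refl])
      fix t assume "t \<in> space (lebesgue_on {0..\<tau>})"
      then have t: "t \<in> {0..\<tau>}" by simp
      then show "(LINT x|lebesgue_on {0<..<1}. g (\<xi> t - x) * (\<phi>t t x + \<Lambda> (total_mass (\<lambda>t x. g (\<xi> t - x)) t) * \<phi>x t x)) = J t"
        using LINT_eq_integral_open[OF inner[OF t]] by (simp add: mass v_def J_def)
    qed
    also have "\<dots> = integral {0..\<tau>} J"
      by (intro LINT_eq_integral absolutely_integrable_continuous_real Jc)
    finally have 1: "(LINT t|lebesgue_on {0..\<tau>}. LINT x|lebesgue_on {0<..<1}.
               g (\<xi> t - x) * (\<phi>t t x + \<Lambda> (total_mass (\<lambda>t x. g (\<xi> t - x)) t) * \<phi>x t x)) = integral {0..\<tau>} J" .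
    have D: "(\<lambda>x. g (- x) * \<phi> 0 x) absolutely_integrable_on {0..1}"
    proof -
      have "(\<lambda>x. \<phi> 0 x * g (0 - x)) absolutely_integrable_on {0..1}"
        by (intro absint_mult_continuous continuous_on_slices(1)[OF \<phi>c] absint_window) (use \<tau> gai in auto)
      then show ?thesis by (simp add: mult.commute)
    qed
    have "(LINT x|lebesgue_on {0<..<1}. \<rho>0 x * \<phi> 0 x) = (LINT x|lebesgue_on {0<..<1}. g (- x) * \<phi> 0 x)"
      by (rule Bochner_Integration.integral_cong[OF refl]) (simp add: \<rho>0)
    also have "\<dots> = integral {0..1} (\<lambda>x. g (- x) * \<phi> 0 x)" by (rule LINT_eq_integral_open[OF D])
    finally have 2: "(LINT x|lebesgue_on {0<..<1}. \<rho>0 x * \<phi> 0 x) = integral {0..1} (\<lambda>x. g (- x) * \<phi> 0 x)" .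
    define b where "b t = y t * \<phi> t 1 - (k * y t + (1 - k) * r * \<Lambda> r) * \<phi> t 0" for t
    have bai: "b absolutely_integrable_on {0..\<tau>}"
    proof -
      have "(\<lambda>t. \<phi> t 1 * y t) absolutely_integrable_on {0..\<tau>}"
        using \<tau> by (intro absint_mult_continuous continuous_on_slices(2)[OF \<phi>c] yai) auto
      moreover have "(\<lambda>t. (k * \<phi> t 0) * y t) absolutely_integrable_on {0..\<tau>}"
        using \<tau> by (intro absint_mult_continuous continuous_intros continuous_on_slices(2)[OF \<phi>c] yai) auto
      moreover have "(\<lambda>t. (1 - k) * r * \<Lambda> r * \<phi> t 0) absolutely_integrable_on {0..\<tau>}"
        using \<tau> by (intro absolutely_integrable_continuous_real continuous_intros continuous_on_slices(2)[OF \<phi>c]) auto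
      ultimately have "(\<lambda>t. (\<phi> t 1 * y t - (k * \<phi> t 0) * y t) - (1 - k) * r * \<Lambda> r * \<phi> t 0) absolutely_integrable_on {0..\<tau>}"
        by (intro set_integral_diff(1))
      moreover have "(\<lambda>t. (\<phi> t 1 * y t - (k * \<phi> t 0) * y t) - (1 - k) * r * \<Lambda> r * \<phi> t 0) = b"
        by (auto simp: b_def algebra_simps)
      ultimately show ?thesis by simp
    qed
    have "integral {0..\<tau>} b = integral {0..\<tau>} (\<lambda>t. v t * (g (\<xi> t - 1) * \<phi> t 1 - g (\<xi> t) * \<phi> t 0))"
    proof (rule integral_cong)
      fix t assume t: "t \<in> {0..\<tau>}"
      have "v t * g (\<xi> t) = k * y t + (1 - k) * r * \<Lambda> r"
        using delay[of "\<xi> t"] \<xi>nn[of t] t \<Lambda>(2)[of "w (\<xi> t)"] by (simp add: v_def y_def w_def field_simps)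
      then show "b t = v t * (g (\<xi> t - 1) * \<phi> t 1 - g (\<xi> t) * \<phi> t 0)"
        by (simp add: b_def y_def right_diff_distrib mult.assoc[symmetric])
    qed
    also have "\<dots> = integral {0..\<tau>} J + integral {0..1} (\<lambda>x. g (- x) * \<phi> 0 x)"
      using transport_identity[OF less_imp_le[OF \<tau>] \<xi>0 \<xi>d vc vpos gai C1] end0 unfolding J_def by simp
    finally have "(LINT t|lebesgue_on {0..\<tau>}. b t) = integral {0..\<tau>} J + integral {0..1} (\<lambda>x. g (- x) * \<phi> 0 x)"
      by (simp add: LINT_eq_integral[OF bai])
    then show ?thesis unfolding 1 2 b_def by simp
  qed
  show ?thesis
    unfolding weak_solution_def
    using profile_C0_L2[OF g \<xi>c \<xi>nn(1)] yL2 weak by blast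
qed

section \<open>Testing along characteristics\<close>

text \<open>
  By Lebesgue's differentiation theorem, \<open>f x\<close> is for almost every \<open>x\<close> the limit of the averages of \<open>f\<close>
  over \<open>[x, x + h]\<close>, and these vanish.
\<close>

lemma AE_zero_of_primitive_zero:
  fixes f :: "real \<Rightarrow> real"
  assumes f: "f integrable_on {0..1}" and zero: "\<And>x. x \<in> {0..1} \<Longrightarrow> integral {0..x} f = 0"
  shows "AE x in lebesgue_on {0<..<1}. f x = 0"
proof -
  define F where "F x = (if x \<in> {0..1} then f x else 0)" for x
  have "F integrable_on UNIV" unfolding F_def using f integrable_restrict_UNIV by blast
  then have "F integrable_on cbox a b" for a b
    by (rule integrable_on_subcbox) auto
  then obtain N where N: "negligible N" and lim: "\<And>x e. x \<notin> N \<Longrightarrow> 0 < e \<Longrightarrow>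
      \<exists>d>0. \<forall>h. 0 < h \<and> h < d \<longrightarrow> norm (integral (cbox x (x + h *\<^sub>R One)) F /\<^sub>R h ^ DIM(real) - F x) < e"
    by (rule integrable_ccontinuous_explicit[of F]) blast
  have "f x = 0" if x: "x \<in> {0<..<1}" "x \<notin> N" for x
  proof (rule ccontr)
    assume nz: "f x \<noteq> 0"
    then obtain d where d: "d > 0" "\<And>h. 0 < h \<Longrightarrow> h < d \<Longrightarrow> \<bar>integral {x..x + h} F / h - F x\<bar> < \<bar>f x\<bar>"
      using lim[OF x(2), of "\<bar>f x\<bar>"] by (auto simp: divide_inverse mult.commute)
    define h where "h = min (d / 2) (1 - x)"
    have h: "0 < h" "h < d" "x + h \<le> 1" using d(1) x by (auto simp: h_def)
    have "integral {x..x + h} F = integral {x..x + h} f"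
      by (rule integral_cong) (use x h in \<open>auto simp: F_def\<close>)
    also have "\<dots> = integral {0..x + h} f - integral {0..x} f"
      by (rule integral_split) (use x h in \<open>auto intro: integrable_on_subinterval[OF f]\<close>)
    also have "\<dots> = 0" using zero[of x] zero[of "x + h"] x h by simp
    finally show False using d(2)[OF h(1,2)] x by (simp add: F_def)
  qed
  moreover have "AE x in lebesgue. x \<notin> N"
    using N by (simp add: negligible_iff_null_sets AE_not_in)
  ultimately show ?thesis
    by (subst AE_restrict_space_iff) (auto elim!: eventually_mono)
qed

lemma zero_of_zero_primitive:
  fixes q :: "real \<Rightarrow> real"
  assumes q: "continuous_on {0..T} q" and T: "0 < T" and zero: "\<And>\<tau>. \<tau> \<in> {0..T} \<Longrightarrow> integral {0..\<tau>} q = 0"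
    and \<tau>: "\<tau> \<in> {0..T}"
  shows "q \<tau> = 0"
proof -
  have "((\<lambda>x. integral {0..x} q) has_vector_derivative q \<tau>) (at \<tau> within {0..T})"
    by (rule integral_has_vector_derivative[OF q \<tau>])
  then have "((\<lambda>x. 0) has_vector_derivative q \<tau>) (at \<tau> within {0..T})"
    by (rule has_vector_derivative_transform[OF \<tau>, rotated]) (use zero in simp)
  then show ?thesis
    using vector_derivative_unique_within_closed_interval[of 0 T \<tau> "\<lambda>x. 0::real" "q \<tau>" 0] T \<tau> by simp
qed

text \<open>
  For the primitive \<open>P\<close> of \<open>f\<close>, the product \<open>P t * (t - \<tau>)\<close> vanishes at both ends of the interval.
  The chain rule applies to it because twice the product is \<open>(P t + (t - \<tau>))\<^sup>2 - (P t)\<^sup>2 - (t - \<tau>)\<^sup>2\<close>.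
\<close>

lemma integral_by_parts_linear:
  fixes f :: "real \<Rightarrow> real"
  assumes f: "f absolutely_integrable_on {0..\<tau>}" and \<tau>: "0 \<le> \<tau>"
  shows "(\<lambda>t. (\<tau> - t) * f t) absolutely_integrable_on {0..\<tau>}"
    and "integral {0..\<tau>} (\<lambda>t. (\<tau> - t) * f t) = integral {0..\<tau>} (\<lambda>t. integral {0..t} f)"
proof -
  show ai: "(\<lambda>t. (\<tau> - t) * f t) absolutely_integrable_on {0..\<tau>}"
    by (intro absint_mult_continuous f continuous_intros)
  define P where "P t = integral {0..t} f" for t
  have Pc: "continuous_on {0..\<tau>} P"
    unfolding P_def by (rule indefinite_integral_continuous_1[OF absint_imp_integrable[OF f]])
  have sq: "((\<lambda>x::real. x\<^sup>2) has_real_derivative 2 * x) (at x)" for x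
    by (auto intro!: derivative_eq_intros)
  have lip: "\<bar>2 * x - 2 * y\<bar> \<le> 2 * \<bar>x - y\<bar>" for x y :: real by (simp add: abs_if)
  have f1: "(\<lambda>t. f t + 1) absolutely_integrable_on {0..\<tau>}"
    by (intro set_integral_add(1) f absolutely_integrable_continuous_real continuous_intros)
  have Q: "P s + (s - \<tau>) = (P 0 + (0 - \<tau>)) + integral {0..s} (\<lambda>t. f t + 1)" if "s \<in> {0..\<tau>}" for s
  proof -
    have "f integrable_on {0..s}"
      by (rule integrable_on_subinterval[OF absint_imp_integrable[OF f]]) (use that in auto)
    from has_integral_add[OF integrable_integral[OF this] has_integral_const_real[of 1 0 s]]
    show ?thesis using that by (simp add: P_def integral_unique)
  qed
  note c1 = absint_chain_rule[where p=f and a=0 and b=\<tau> and \<Phi>="\<lambda>x. x\<^sup>2" and F="\<lambda>x. 2 * x" and L=2 and m=P,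
      OF f \<tau> sq lip]
  have c2: "(\<lambda>s. 2 * (P s + (s - \<tau>)) * (f s + 1)) absolutely_integrable_on {0..\<tau>}"
    "integral {0..\<tau>} (\<lambda>s. 2 * (P s + (s - \<tau>)) * (f s + 1)) = (P \<tau> + (\<tau> - \<tau>))\<^sup>2 - (P 0 + (0 - \<tau>))\<^sup>2"
    by (rule absint_chain_rule[where p="\<lambda>t. f t + 1" and a=0 and b=\<tau> and \<Phi>="\<lambda>x. x\<^sup>2" and F="\<lambda>x. 2 * x" and L=2
      and m="\<lambda>t. P t + (t - \<tau>)", OF f1 \<tau> sq lip]; rule Q; assumption)+
  have c1': "(\<lambda>s. 2 * P s * f s) absolutely_integrable_on {0..\<tau>}"
    "integral {0..\<tau>} (\<lambda>s. 2 * P s * f s) = (P \<tau>)\<^sup>2"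
    using c1 by (simp_all add: P_def)
  have c3: "((\<lambda>t. 2 * (t - \<tau>)) has_integral (\<tau> - \<tau>)\<^sup>2 - (0 - \<tau>)\<^sup>2) {0..\<tau>}"
    by (rule fundamental_theorem_of_calculus[OF \<tau>], unfold has_real_derivative_iff_has_vector_derivative[symmetric])
      (auto intro!: derivative_eq_intros)
  have "((\<lambda>t. 2 * (P t + (t - \<tau>)) * (f t + 1) - 2 * P t * f t - 2 * (t - \<tau>)) has_integral
      ((P \<tau> + (\<tau> - \<tau>))\<^sup>2 - (P 0 + (0 - \<tau>))\<^sup>2) - (P \<tau>)\<^sup>2 - ((\<tau> - \<tau>)\<^sup>2 - (0 - \<tau>)\<^sup>2)) {0..\<tau>}"
    using integrable_integral[OF absint_imp_integrable[OF c2(1)]] integrable_integral[OF absint_imp_integrable[OF c1'(1)]]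
    unfolding c2(2) c1'(2) by (intro has_integral_diff c3)
  moreover have "(\<lambda>t. 2 * (P t + (t - \<tau>)) * (f t + 1) - 2 * P t * f t - 2 * (t - \<tau>))
      = (\<lambda>t. 2 * (P t - (\<tau> - t) * f t))"
    by (auto simp: algebra_simps)
  moreover have "((P \<tau> + (\<tau> - \<tau>))\<^sup>2 - (P 0 + (0 - \<tau>))\<^sup>2) - (P \<tau>)\<^sup>2 - ((\<tau> - \<tau>)\<^sup>2 - (0 - \<tau>)\<^sup>2) = 0"
    by (simp add: P_def)
  ultimately have "((\<lambda>t. 2 * (P t - (\<tau> - t) * f t)) has_integral 0) {0..\<tau>}" by simp
  moreover have "((\<lambda>t. 2 * (P t - (\<tau> - t) * f t)) has_integral
      2 * (integral {0..\<tau>} P - integral {0..\<tau>} (\<lambda>t. (\<tau> - t) * f t))) {0..\<tau>}"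
    by (intro has_integral_mult_right has_integral_diff integrable_integral integrable_continuous_interval Pc
        absint_imp_integrable ai)
  ultimately have "0 = 2 * (integral {0..\<tau>} P - integral {0..\<tau>} (\<lambda>t. (\<tau> - t) * f t))"
    by (rule has_integral_unique)
  then show "integral {0..\<tau>} (\<lambda>t. (\<tau> - t) * f t) = integral {0..\<tau>} (\<lambda>t. integral {0..t} f)"
    by (simp add: P_def[abs_def])
qed

lemma C0_L2_pairing:
  assumes \<rho>: "C0_L2 \<rho>" and f: "continuous_on ({0..T} \<times> {0..1}) (\<lambda>(t, x). f t x)"
  shows "continuous_on {0..T} (\<lambda>t. integral {0..1} (\<lambda>x. \<rho> t x * f t x))"
    and "\<And>t. t \<in> {0..T} \<Longrightarrow> (\<lambda>x. \<rho> t x * f t x) absolutely_integrable_on {0..1}"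
proof -
  have \<rho>s: "sqint {0..1} (\<rho> t)" if "0 \<le> t" for t
    using \<rho> that unfolding C0_L2_def by (simp add: L2_on_open_iff_sqint)
  then have R: "\<rho> t absolutely_integrable_on {0..1}" if "t \<in> {0..T}" for t
    using that unfolding sqint_def by auto
  have cont: "\<exists>d>0. \<forall>t\<in>{0..T}. \<bar>t - s\<bar> < d \<longrightarrow> integral {0..1} (\<lambda>x. \<bar>\<rho> t x - \<rho> s x\<bar>) < e"
    if s: "s \<in> {0..T}" and e: "e > 0" for s e
  proof -
    have "((\<lambda>t. norm_L2 {0<..<1} (\<lambda>x. \<rho> t x - \<rho> s x)) \<longlongrightarrow> 0) (at s within {0..})"
      using \<rho> s unfolding C0_L2_def by auto
    then have "\<forall>\<^sub>F t in at s within {0..}. norm_L2 {0<..<1} (\<lambda>x. \<rho> t x - \<rho> s x) < e"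
      using e by (rule order_tendstoD)
    then obtain d where d: "d > 0" "\<And>t. t \<in> {0..} \<Longrightarrow> t \<noteq> s \<Longrightarrow> dist t s < d \<Longrightarrow>
        norm_L2 {0<..<1} (\<lambda>x. \<rho> t x - \<rho> s x) < e"
      unfolding eventually_at by blast
    have "integral {0..1} (\<lambda>x. \<bar>\<rho> t x - \<rho> s x\<bar>) < e" if t: "t \<in> {0..T}" "\<bar>t - s\<bar> < d" for t
    proof (cases "t = s")
      case False
      have ds: "sqint {0..1} (\<lambda>x. \<rho> t x - \<rho> s x)" using s t by (intro sqint_diff \<rho>s) auto
      then have "sqint {0..0 + 1} (\<lambda>x. \<bar>\<rho> t x - \<rho> s x\<bar>)" using absint_abs unfolding sqint_def by auto
      from cauchy_schwarz_unit[OF this]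
      have "integral {0..1} (\<lambda>x. \<bar>\<rho> t x - \<rho> s x\<bar>) \<le> norm_L2 {0<..<1} (\<lambda>x. \<rho> t x - \<rho> s x)"
        unfolding norm_L2_eq[OF ds] by (intro real_le_rsqrt) simp
      also have "\<dots> < e" using d(2)[of t] t False by (simp add: dist_real_def)
      finally show ?thesis .
    qed (use e in simp)
    then show ?thesis using d(1) by blast
  qed
  show "continuous_on {0..T} (\<lambda>t. integral {0..1} (\<lambda>x. \<rho> t x * f t x))"
    by (rule L1_continuous_pairing(1)[OF _ _ f]) (fact R cont)+
  show "(\<lambda>x. \<rho> t x * f t x) absolutely_integrable_on {0..1}" if "t \<in> {0..T}" for t
    by (rule L1_continuous_pairing(2)[OF _ _ f that]) (fact R cont)+
qed

text \<open>
  A function of \<open>x - \<xi> t\<close> is constant along characteristics, so the transport terms cancel when it is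
  used as a test function.  The factor \<open>\<tau> - t\<close> makes it vanish at the final time.  After an integration
  by parts in time, the weak formulation states that the difference of the two sides below, which is
  continuous in time, has integral zero over \<open>[0, \<tau>]\<close> for every \<open>\<tau>\<close>; hence it vanishes.
\<close>

lemma weak_solution_along_characteristics:
  fixes y \<xi> v \<psi> \<psi>' \<rho>0 \<Lambda> :: "real \<Rightarrow> real" and \<rho> :: "real \<Rightarrow> real \<Rightarrow> real"
  assumes \<rho>: "C0_L2 \<rho>" and \<rho>0: "\<rho>0 absolutely_integrable_on {0..1}" and T: "0 < T"
    and y: "y absolutely_integrable_on {0..T}"
    and weak: "\<And>\<tau> \<phi> \<phi>t \<phi>x. \<tau> > 0 \<Longrightarrow> C1_rect \<tau> \<phi> \<phi>t \<phi>x \<Longrightarrow> (\<forall>x\<in>{0..1}. \<phi> \<tau> x = 0) \<Longrightarrow>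
          - (LINT t|lebesgue_on {0..\<tau>}. LINT x|lebesgue_on {0<..<1}.
               \<rho> t x * (\<phi>t t x + \<Lambda> (total_mass \<rho> t) * \<phi>x t x))
          - (LINT x|lebesgue_on {0<..<1}. \<rho>0 x * \<phi> 0 x)
          + (LINT t|lebesgue_on {0..\<tau>}. y t * \<phi> t 1 - (k * y t + c) * \<phi> t 0) = 0"
    and v: "continuous_on UNIV v" "\<And>t. t \<in> {0..T} \<Longrightarrow> v t = \<Lambda> (total_mass \<rho> t)"
    and \<xi>: "\<And>t. (\<xi> has_real_derivative v t) (at t)" and \<xi>0: "\<xi> 0 = 0"
    and \<psi>: "\<And>z. (\<psi> has_real_derivative \<psi>' z) (at z)" and \<psi>': "continuous_on UNIV \<psi>'"
    and \<tau>: "\<tau> \<in> {0..T}"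
  shows "integral {0..1} (\<lambda>x. \<rho> \<tau> x * \<psi> (x - \<xi> \<tau>)) = integral {0..1} (\<lambda>x. \<rho>0 x * \<psi> x)
      - integral {0..\<tau>} (\<lambda>t. y t * \<psi> (1 - \<xi> t)) + integral {0..\<tau>} (\<lambda>t. (k * y t + c) * \<psi> (- \<xi> t))"
proof -
  have \<psi>c: "continuous_on X \<psi>" for X using \<psi> by (meson DERIV_continuous_on has_field_derivative_at_within)
  have \<xi>c: "continuous_on X \<xi>" for X using \<xi> by (meson DERIV_continuous_on has_field_derivative_at_within)
  have comp: "continuous_on X (\<lambda>z. \<psi> (g z))" "continuous_on X (\<lambda>z. \<psi>' (g z))"
    if "continuous_on X g" for g :: "'b::topological_space \<Rightarrow> real" and X
    by (rule continuous_on_compose2[OF \<psi>c[of UNIV] that] continuous_on_compose2[OF \<psi>' that]; simp)+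
  have compv: "continuous_on X (\<lambda>z. v (g z))" "continuous_on X (\<lambda>z. \<xi> (g z))"
    if "continuous_on X g" for g :: "'b::topological_space \<Rightarrow> real" and X
    by (rule continuous_on_compose2[OF v(1) that] continuous_on_compose2[OF \<xi>c[of UNIV] that]; simp)+
  define m where "m t = integral {0..1} (\<lambda>x. \<rho> t x * \<psi> (x - \<xi> t))" for t
  define c0 where "c0 = integral {0..1} (\<lambda>x. \<rho>0 x * \<psi> x)"
  define f where "f t = y t * \<psi> (1 - \<xi> t) - (k * y t + c) * \<psi> (- \<xi> t)" for t
  define F where "F t = integral {0..t} f" for t
  have \<psi>2: "continuous_on ({0..T} \<times> {0..1}) (\<lambda>(t, x). \<psi> (x - \<xi> t))"
    unfolding split_beta by (intro comp continuous_intros compv)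
  note mc = C0_L2_pairing(1)[OF \<rho> \<psi>2, folded m_def]
  have mi: "(\<lambda>x. \<rho> t x * \<psi> (x - \<xi> t)) absolutely_integrable_on {0..1}" if "t \<in> {0..T}" for t
    by (rule C0_L2_pairing(2)[OF \<rho> \<psi>2 that])
  have ysub: "y absolutely_integrable_on {0..t}" if "t \<in> {0..T}" for t
    by (rule absolutely_integrable_on_subinterval[OF y]) (use that in auto)
  have f1: "(\<lambda>t. y t * \<psi> (1 - \<xi> t)) absolutely_integrable_on {0..t}" if "t \<in> {0..T}" for t
    using absint_mult_continuous[OF comp(1) ysub[OF that], of "\<lambda>t. 1 - \<xi> t"]
    by (simp add: mult.commute continuous_intros \<xi>c)
  have f2: "(\<lambda>t. (k * y t + c) * \<psi> (- \<xi> t)) absolutely_integrable_on {0..t}" if "t \<in> {0..T}" for t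
  proof -
    have "(\<lambda>t. k * y t + c) absolutely_integrable_on {0..t}"
      by (intro set_integral_add(1) set_integrable_mult_right ysub that absolutely_integrable_continuous_real continuous_intros)
    from absint_mult_continuous[OF comp(1) this, of "\<lambda>t. - \<xi> t"] show ?thesis
      by (simp add: mult.commute continuous_intros \<xi>c)
  qed
  have fi: "f absolutely_integrable_on {0..t}" if "t \<in> {0..T}" for t
    unfolding f_def by (intro set_integral_diff(1) f1 f2 that)
  have Fc: "continuous_on {0..T} F"
    unfolding F_def using T by (intro indefinite_integral_continuous_1 absint_imp_integrable fi) auto
  have key: "integral {0..\<tau>} (\<lambda>t. m t - c0 + F t) = 0" if \<tau>: "\<tau> \<in> {0..T}" for \<tau>
  proof (cases "\<tau> = 0")
    case False
    then have \<tau>0: "0 < \<tau>" using \<tau> by auto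
    define \<phi> where "\<phi> t x = (\<tau> - t) * \<psi> (x - \<xi> t)" for t x
    define \<phi>t where "\<phi>t t x = - \<psi> (x - \<xi> t) - (\<tau> - t) * (\<psi>' (x - \<xi> t) * v t)" for t x
    define \<phi>x where "\<phi>x t x = (\<tau> - t) * \<psi>' (x - \<xi> t)" for t x
    have C1: "C1_rect \<tau> \<phi> \<phi>t \<phi>x"
      unfolding C1_rect_def
    proof (intro conjI ballI)
      show "continuous_on ({0..\<tau>} \<times> {0..1}) (\<lambda>(t, x). \<phi>t t x)"
        unfolding \<phi>t_def split_beta by (intro continuous_intros comp compv)
      show "continuous_on ({0..\<tau>} \<times> {0..1}) (\<lambda>(t, x). \<phi>x t x)"
        unfolding \<phi>x_def split_beta by (intro continuous_intros comp compv)
      fix t x :: real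
      have d\<xi>: "((\<lambda>z. \<xi> (fst z)) has_derivative (\<lambda>z. v t * fst z)) (at (t, x) within {0..\<tau>} \<times> {0..1})"
        by (rule has_derivative_compose[of fst fst "(t, x)" _ \<xi> "\<lambda>h. v t * h", simplified])
          (use \<xi>[of t] in \<open>auto simp: has_field_derivative_def intro!: derivative_eq_intros\<close>)
      have "((\<lambda>z. snd z - \<xi> (fst z)) has_derivative (\<lambda>z. snd z - v t * fst z)) (at (t, x) within {0..\<tau>} \<times> {0..1})"
        by (intro has_derivative_diff d\<xi> has_derivative_snd has_derivative_ident)
      from has_derivative_compose[OF this, of \<psi> "\<lambda>h. \<psi>' (x - \<xi> t) * h"]
      have d\<psi>: "((\<lambda>z. \<psi> (snd z - \<xi> (fst z))) has_derivative (\<lambda>z. \<psi>' (x - \<xi> t) * (snd z - v t * fst z)))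
          (at (t, x) within {0..\<tau>} \<times> {0..1})"
        using \<psi>[of "x - \<xi> t"] by (simp add: has_field_derivative_def)
      have "((\<lambda>z. \<tau> - fst z) has_derivative (\<lambda>z. - fst z)) (at (t, x) within {0..\<tau>} \<times> {0..1})"
        by (auto intro!: derivative_eq_intros)
      from has_derivative_mult[OF this d\<psi>]
      have "((\<lambda>z. (\<tau> - fst z) * \<psi> (snd z - \<xi> (fst z))) has_derivative
          (\<lambda>z. (\<tau> - t) * (\<psi>' (x - \<xi> t) * (snd z - v t * fst z)) + - fst z * \<psi> (x - \<xi> t)))
          (at (t, x) within {0..\<tau>} \<times> {0..1})" by simp
      moreover have "(\<lambda>z. (\<tau> - fst z) * \<psi> (snd z - \<xi> (fst z))) = (\<lambda>(s, z). \<phi> s z)"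
        by (auto simp: \<phi>_def)
      moreover have "(\<lambda>z. (\<tau> - t) * (\<psi>' (x - \<xi> t) * (snd z - v t * fst z)) + - fst z * \<psi> (x - \<xi> t))
          = (\<lambda>(h, j). \<phi>t t x * h + \<phi>x t x * j)"
        by (auto simp: \<phi>t_def \<phi>x_def algebra_simps)
      ultimately show "((\<lambda>(s, z). \<phi> s z) has_derivative (\<lambda>(h, j). \<phi>t t x * h + \<phi>x t x * j))
          (at (t, x) within {0..\<tau>} \<times> {0..1})" by simp
    qed
    have sub: "{0..\<tau>} \<subseteq> {0..T}" using \<tau> by auto
    have "(LINT t|lebesgue_on {0..\<tau>}. LINT x|lebesgue_on {0<..<1}.
             \<rho> t x * (\<phi>t t x + \<Lambda> (total_mass \<rho> t) * \<phi>x t x)) = (LINT t|lebesgue_on {0..\<tau>}. - m t)"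
    proof (rule Bochner_Integration.integral_cong[OF refl])
      fix t assume "t \<in> space (lebesgue_on {0..\<tau>})"
      then have t: "t \<in> {0..T}" using sub by auto
      have "(\<lambda>x. \<rho> t x * (\<phi>t t x + \<Lambda> (total_mass \<rho> t) * \<phi>x t x)) = (\<lambda>x. - (\<rho> t x * \<psi> (x - \<xi> t)))"
        using v(2)[OF t] by (auto simp: \<phi>t_def \<phi>x_def algebra_simps)
      then show "(LINT x|lebesgue_on {0<..<1}. \<rho> t x * (\<phi>t t x + \<Lambda> (total_mass \<rho> t) * \<phi>x t x)) = - m t"
        using LINT_eq_integral_open[OF mi[OF t]] by (simp add: m_def)
    qed
    also have "\<dots> = - integral {0..\<tau>} m"
      using LINT_eq_integral[OF absolutely_integrable_continuous_real[OF continuous_on_subset[OF mc sub]]] by simp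
    finally have 1: "(LINT t|lebesgue_on {0..\<tau>}. LINT x|lebesgue_on {0<..<1}.
             \<rho> t x * (\<phi>t t x + \<Lambda> (total_mass \<rho> t) * \<phi>x t x)) = - integral {0..\<tau>} m" .
    have r0: "(\<lambda>x. \<rho>0 x * \<psi> x) absolutely_integrable_on {0..1}"
      using absint_mult_continuous[OF \<psi>c \<rho>0] by (simp add: mult.commute)
    have "(LINT x|lebesgue_on {0<..<1}. \<rho>0 x * \<phi> 0 x) = (LINT x|lebesgue_on {0<..<1}. \<tau> * (\<rho>0 x * \<psi> x))"
      by (simp add: \<phi>_def \<xi>0 mult.left_commute)
    also have "\<dots> = \<tau> * c0" using LINT_eq_integral_open[OF r0] by (simp add: c0_def)
    finally have 2: "(LINT x|lebesgue_on {0<..<1}. \<rho>0 x * \<phi> 0 x) = \<tau> * c0" .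
    note bp = integral_by_parts_linear[OF fi[OF \<tau>] less_imp_le[OF \<tau>0]]
    have "(\<lambda>t. y t * \<phi> t 1 - (k * y t + c) * \<phi> t 0) = (\<lambda>t. (\<tau> - t) * f t)"
      by (auto simp: \<phi>_def f_def algebra_simps)
    then have 3: "(LINT t|lebesgue_on {0..\<tau>}. y t * \<phi> t 1 - (k * y t + c) * \<phi> t 0) = integral {0..\<tau>} F"
      using LINT_eq_integral[OF bp(1)] bp(2) by (simp add: F_def[abs_def])
    have "integral {0..\<tau>} m - \<tau> * c0 + integral {0..\<tau>} F = 0"
      using weak[OF \<tau>0 C1] unfolding 1 2 3 by (simp add: \<phi>_def)
    moreover have "((\<lambda>t. m t - c0 + F t) has_integral integral {0..\<tau>} m - \<tau> * c0 + integral {0..\<tau>} F) {0..\<tau>}"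
      using has_integral_const_real[of c0 0 \<tau>] \<tau>0
      by (intro has_integral_add has_integral_diff integrable_integral integrable_continuous_interval
          continuous_on_subset[OF mc sub] continuous_on_subset[OF Fc sub]) auto
    ultimately show ?thesis by (simp add: integral_unique)
  qed simp
  have "m \<tau> - c0 + F \<tau> = 0"
    by (rule zero_of_zero_primitive[where q="\<lambda>t. m t - c0 + F t", OF _ T key \<tau>]) (intro continuous_intros mc Fc)
  moreover have "F \<tau> = integral {0..\<tau>} (\<lambda>t. y t * \<psi> (1 - \<xi> t)) - integral {0..\<tau>} (\<lambda>t. (k * y t + c) * \<psi> (- \<xi> t))"
    unfolding F_def f_def
    by (intro Henstock_Kurzweil_Integration.integral_diff absint_imp_integrable f1 f2 \<tau>)
  ultimately show ?thesis by (simp add: m_def c0_def)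
qed

text \<open>
  The value at \<open>0\<close> is that of the pointwise limit of the functions \<open>soft_step n\<close>.
\<close>

definition step :: "real \<Rightarrow> real" where
  "step z = (if z < 0 then 1 else if z = 0 then 1 / 2 else 0)"

text \<open>
  The arctangent gives a smooth transition with no pieces to be glued.
\<close>

definition soft_step :: "nat \<Rightarrow> real \<Rightarrow> real" where
  "soft_step n z = 1 / 2 - arctan (real n * z) / pi"

lemma soft_step_deriv:
  "(soft_step n has_real_derivative - (real n / (1 + (real n * z)\<^sup>2)) / pi) (at z)"
proof -
  have "((\<lambda>z. 1 / 2 - arctan (real n * z) / pi) has_real_derivative
      (0 - inverse (1 + (real n * z)\<^sup>2) * (real n * 1) / pi)) (at z)"
    by (intro DERIV_diff DERIV_const DERIV_cdivide DERIV_chain2[OF DERIV_arctan] DERIV_cmult DERIV_ident)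
  moreover have "0 - inverse (1 + (real n * z)\<^sup>2) * (real n * 1) / pi = - (real n / (1 + (real n * z)\<^sup>2)) / pi"
    by (simp add: divide_inverse)
  moreover have "soft_step n = (\<lambda>z. 1 / 2 - arctan (real n * z) / pi)"
    by (simp add: soft_step_def[abs_def])
  ultimately show ?thesis by (simp only:)
qed

lemma soft_step_bound: "\<bar>soft_step n z\<bar> \<le> 1"
proof -
  have "\<bar>arctan (real n * z)\<bar> \<le> pi / 2" using arctan_bounded[of "real n * z"] by auto
  then have "\<bar>arctan (real n * z) / pi\<bar> \<le> 1 / 2" by (simp add: field_simps)
  then show ?thesis unfolding soft_step_def by linarith
qed

lemma soft_step_tendsto: "(\<lambda>n. soft_step n z) \<longlonglongrightarrow> step z"
proof -
  have pos: "(\<lambda>n. arctan (real n * z)) \<longlonglongrightarrow> pi / 2" if "z > 0" for z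
  proof (rule filterlim_compose[OF tendsto_arctan_at_top])
    show "filterlim (\<lambda>n. real n * z) at_top sequentially"
      using that by (intro filterlim_at_top_mult_tendsto_pos[OF tendsto_const _ filterlim_real_sequentially])
  qed
  consider "z > 0" | "z = 0" | "z < 0" by linarith
  then show ?thesis
  proof cases
    case 1
    have "(\<lambda>n. 1 / 2 - arctan (real n * z) / pi) \<longlonglongrightarrow> 1 / 2 - pi / 2 / pi"
      by (intro tendsto_intros pos 1) simp
    then show ?thesis using 1 by (simp add: soft_step_def step_def)
  next
    case 2
    then show ?thesis by (simp add: soft_step_def step_def)
  next
    case 3
    have "(\<lambda>n. arctan (real n * (- z))) \<longlonglongrightarrow> pi / 2" using 3 by (intro pos) simp
    then have "(\<lambda>n. - arctan (real n * (- z))) \<longlonglongrightarrow> - (pi / 2)" by (rule tendsto_minus)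
    then have "(\<lambda>n. arctan (real n * z)) \<longlonglongrightarrow> - (pi / 2)" by (simp add: arctan_minus)
    then have "(\<lambda>n. 1 / 2 - arctan (real n * z) / pi) \<longlonglongrightarrow> 1 / 2 - - (pi / 2) / pi"
      by (intro tendsto_intros) simp_all
    then show ?thesis using 3 by (simp add: soft_step_def step_def)
  qed
qed

lemma soft_step_integral_tendsto:
  fixes q u :: "real \<Rightarrow> real"
  assumes q: "q absolutely_integrable_on {a..b}" and u: "continuous_on {a..b} u"
  shows "(\<lambda>n. integral {a..b} (\<lambda>x. q x * soft_step n (u x))) \<longlonglongrightarrow> integral {a..b} (\<lambda>x. q x * step (u x))"
proof (rule dominated_convergence(2)[where h="\<lambda>x. \<bar>q x\<bar>"])
  have sc: "continuous_on UNIV (soft_step n)" for n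
    using soft_step_deriv by (meson DERIV_continuous_on has_field_derivative_at_within)
  show "(\<lambda>x. q x * soft_step n (u x)) integrable_on {a..b}" for n
    using absint_mult_continuous[OF continuous_on_compose2[OF sc u subset_UNIV] q]
    by (auto simp: mult.commute intro: absint_imp_integrable)
  show "(\<lambda>x. \<bar>q x\<bar>) integrable_on {a..b}" by (rule absint_imp_integrable[OF absint_abs[OF q]])
  show "norm (q x * soft_step n (u x)) \<le> \<bar>q x\<bar>" for n x
    using mult_left_mono[OF soft_step_bound[of n "u x"], of "\<bar>q x\<bar>"] by (simp add: abs_mult)
  show "(\<lambda>n. q x * soft_step n (u x)) \<longlonglongrightarrow> q x * step (u x)" for x
    by (intro tendsto_intros soft_step_tendsto)
qed

lemma integral_step:
  fixes f :: "real \<Rightarrow> real"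
  shows "integral {a..b} (\<lambda>x. f x * step (x - c)) = integral {a..max a (min b c)} f"
proof -
  have "integral {a..b} (\<lambda>x. f x * step (x - c)) = integral {a..b} (\<lambda>x. if x \<in> {a..c} then f x else 0)"
    by (rule integral_spike[of "{c}"]) (auto simp: step_def)
  also have "\<dots> = integral ({a..c} \<inter> {a..b}) f"
    by (rule Henstock_Kurzweil_Integration.integral_restrict_Int)
  also have "\<dots> = integral {a..max a (min b c)} f"
  proof (cases "a \<le> min b c")
    case True
    then have "{a..c} \<inter> {a..b} = {a..max a (min b c)}" by auto
    then show ?thesis by (simp only:)
  next
    case False
    then have e: "{a..c} \<inter> {a..b} = {}" "max a (min b c) = a" by auto
    show ?thesis unfolding e by simp
  qed
  finally show ?thesis .
qed

lemma integral_step_reversed: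
  fixes f \<xi> \<theta> :: "real \<Rightarrow> real"
  assumes f: "f integrable_on {0..\<tau>}" and \<xi>: "strict_mono \<xi>" and inv: "\<And>s. \<xi> (\<theta> s) = s"
  shows "integral {0..\<tau>} (\<lambda>t. f t * step (c - \<xi> t)) = integral {0..\<tau>} f - integral {0..max 0 (min \<tau> (\<theta> c))} f"
proof -
  have *: "f t * step (c - \<xi> t) = f t - f t * step (t - \<theta> c)" for t
    using strict_mono_less[OF \<xi>, of t "\<theta> c"] strict_mono_eq[OF \<xi>, of t "\<theta> c"] by (auto simp: inv step_def)
  have "(\<lambda>x. if x \<in> {0..\<theta> c} then f x else 0) integrable_on {0..\<tau>}"
  proof -
    have "f integrable_on {0..min \<tau> (\<theta> c)}"
      by (rule integrable_on_subinterval[OF f]) auto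
    moreover have "{0..\<theta> c} \<inter> {0..\<tau>} = {0..min \<tau> (\<theta> c)}" by auto
    ultimately show ?thesis by (simp only: integrable_restrict_Int)
  qed
  then have "(\<lambda>t. f t * step (t - \<theta> c)) integrable_on {0..\<tau>}"
    by (rule integrable_spike[of _ _ "{\<theta> c}"]) (auto simp: step_def)
  then show ?thesis
    unfolding * integral_step[symmetric, of 0 \<tau> "\<theta> c"] by (rule Henstock_Kurzweil_Integration.integral_diff[OF f])
qed

section \<open>Uniqueness of weak solutions\<close>

text \<open>
  Let \<open>s\<close> be the distance travelled along characteristics up to time \<open>\<theta> s\<close>, and let \<open>\<Gamma> s\<close> be the mass
  that has entered by then, continued to negative \<open>s\<close> by the initial mass.  Testing with the indicator
  of a half-line in the variable that is constant along characteristics shows that the mass in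
  \<open>[0, x]\<close> is what entered over the last stretch of length \<open>x\<close>, an increment of \<open>\<Gamma>\<close>.  In
  particular the total mass is \<open>\<Gamma> s - \<Gamma> (s - 1)\<close>, which gives the formula for \<open>\<theta>\<close>, and the mass that
  has left is \<open>\<Gamma> (s - 1) - \<Gamma> (-1)\<close>, which turns the boundary law into the equation for \<open>\<Gamma>\<close>.
\<close>

lemma weak_solution_flux_primitive:
  fixes \<Lambda> \<rho>0 :: "real \<Rightarrow> real" and \<rho> :: "real \<Rightarrow> real \<Rightarrow> real"
  assumes ws: "weak_solution \<Lambda> r k \<rho>0 \<rho>" and \<rho>0: "\<rho>0 absolutely_integrable_on {0..1}"
    and \<Lambda>: "continuous_on UNIV \<Lambda>" "\<And>w. \<Lambda> w > 0" and T: "0 < T"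
  obtains S \<Gamma> \<theta> where "0 < S" "continuous_on {-1..S} \<Gamma>"
    "\<And>s. -1 \<le> s \<Longrightarrow> s \<le> 0 \<Longrightarrow> \<Gamma> s = - integral {0..- s} \<rho>0"
    "\<And>s. 0 \<le> s \<Longrightarrow> s \<le> S \<Longrightarrow> \<theta> s = integral {0..s} (\<lambda>\<sigma>. 1 / \<Lambda> (\<Gamma> \<sigma> - \<Gamma> (\<sigma> - 1)))"
    "\<And>s. 0 \<le> s \<Longrightarrow> s \<le> S \<Longrightarrow> \<Gamma> s = k * (\<Gamma> (s - 1) - \<Gamma> (-1)) + (1 - k) * r * \<Lambda> r * \<theta> s"
    "\<And>\<tau>. 0 \<le> \<tau> \<Longrightarrow> \<tau> \<le> T \<Longrightarrow> \<exists>s. 0 \<le> s \<and> s \<le> S \<and> \<theta> s = \<tau> \<and>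
        (\<forall>x\<in>{0..1}. integral {0..x} (\<rho> \<tau>) = \<Gamma> s - \<Gamma> (s - x))"
    "strict_mono \<theta>"
proof -
  define c where "c = (1 - k) * r * \<Lambda> r"
  obtain y where \<rho>: "C0_L2 \<rho>" and yL: "L2_loc y"
    and weak: "\<And>\<tau> \<phi> \<phi>t \<phi>x. \<tau> > 0 \<Longrightarrow> C1_rect \<tau> \<phi> \<phi>t \<phi>x \<Longrightarrow> (\<forall>x\<in>{0..1}. \<phi> \<tau> x = 0) \<Longrightarrow>
          - (LINT t|lebesgue_on {0..\<tau>}. LINT x|lebesgue_on {0<..<1}.
               \<rho> t x * (\<phi>t t x + \<Lambda> (total_mass \<rho> t) * \<phi>x t x))
          - (LINT x|lebesgue_on {0<..<1}. \<rho>0 x * \<phi> 0 x)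
          + (LINT t|lebesgue_on {0..\<tau>}. y t * \<phi> t 1 - (k * y t + c) * \<phi> t 0) = 0"
    using ws unfolding weak_solution_def c_def by blast
  have y: "y absolutely_integrable_on {0..T}"
    using yL T unfolding L2_loc_def by (simp add: L2_on_iff_sqint sqint_def)
  have \<rho>i: "\<rho> t absolutely_integrable_on {0..1}" if "0 \<le> t" for t
    using \<rho> that unfolding C0_L2_def by (simp add: L2_on_open_iff_sqint sqint_def)
  define W where "W = total_mass \<rho>"
  have W_eq: "W t = integral {0..1} (\<rho> t)" if "0 \<le> t" for t
    unfolding W_def total_mass_def by (rule LINT_eq_integral_open[OF \<rho>i[OF that]])
  have "continuous_on {0..T} (\<lambda>t. integral {0..1} (\<lambda>x. \<rho> t x * 1))"
    by (rule C0_L2_pairing(1)[OF \<rho>]) (simp add: split_beta)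
  then have Wc: "continuous_on {0..T} W"
    by (rule continuous_on_eq) (simp add: W_eq)
  define v where "v t = \<Lambda> (W (max 0 (min T t)))" for t
  have vc: "continuous_on UNIV v"
    unfolding v_def using T
    by (intro continuous_on_compose2[OF \<Lambda>(1)] continuous_on_compose2[OF Wc] continuous_intros) auto
  have "continuous_on {0..T} v" by (rule continuous_on_subset[OF vc]) simp
  then obtain t0 where t0: "t0 \<in> {0..T}" "\<And>t. t \<in> {0..T} \<Longrightarrow> v t0 \<le> v t"
    using continuous_attains_inf[OF compact_Icc, of 0 T v] T by auto
  have vlow: "v t0 \<le> v t" for t
  proof -
    have "v t = v (max 0 (min T t))" using T by (simp add: v_def)
    then show ?thesis using t0(2)[of "max 0 (min T t)"] T by simp
  qed
  have v0: "v t0 > 0" by (simp add: v_def \<Lambda>(2))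
  obtain \<xi> \<theta> where \<xi>: "\<And>t. (\<xi> has_real_derivative v t) (at t)" "\<xi> 0 = 0"
    and inv: "\<And>s. \<xi> (\<theta> s) = s" "\<And>t. \<theta> (\<xi> t) = t"
    and \<theta>: "\<And>s. (\<theta> has_real_derivative 1 / v (\<theta> s)) (at s)" "\<theta> 0 = 0"
    and mono: "strict_mono \<xi>" "strict_mono \<theta>"
    using time_change[OF vc v0 vlow] by metis
  have \<xi>c: "continuous_on X \<xi>" for X using \<xi>(1) by (meson DERIV_continuous_on has_field_derivative_at_within)
  have \<theta>c: "continuous_on X \<theta>" for X using \<theta>(1) by (meson DERIV_continuous_on has_field_derivative_at_within)
  have vW: "v t = \<Lambda> (total_mass \<rho> t)" if "t \<in> {0..T}" for t
    using that by (simp add: v_def W_def)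
  have char: "integral {0..1} (\<lambda>x. \<rho> \<tau> x * \<psi> (x - \<xi> \<tau>)) = integral {0..1} (\<lambda>x. \<rho>0 x * \<psi> x)
      - integral {0..\<tau>} (\<lambda>t. y t * \<psi> (1 - \<xi> t)) + integral {0..\<tau>} (\<lambda>t. (k * y t + c) * \<psi> (- \<xi> t))"
    if "\<And>z. (\<psi> has_real_derivative \<psi>' z) (at z)" "continuous_on UNIV \<psi>'" "\<tau> \<in> {0..T}" for \<psi> \<psi>' \<tau>
  proof (rule weak_solution_along_characteristics[where T=T and v=v and \<psi>'=\<psi>' and \<Lambda>=\<Lambda>])
  qed (fact weak vW \<rho> \<rho>0 T y vc \<xi> that)+
  define u where "u t = k * y t + c" for t
  define U where "U t = integral {0..t} u" for t
  define R where "R x = integral {0..x} \<rho>0" for x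
  have sub: "q absolutely_integrable_on {0..\<tau>}" if "q absolutely_integrable_on {0..T}" "\<tau> \<in> {0..T}"
    for q :: "real \<Rightarrow> real" and \<tau>
    by (rule absolutely_integrable_on_subinterval[OF that(1)]) (use that(2) in auto)
  have u: "u absolutely_integrable_on {0..T}"
    unfolding u_def
    by (intro set_integral_add(1) set_integrable_mult_right y absolutely_integrable_continuous_real continuous_intros)
  define S where "S = \<xi> T"
  have S0: "0 < S" using strict_mono_less[OF mono(1), of 0 T] T by (simp add: S_def \<xi>(2))
  have \<theta>S: "\<theta> S = T" by (simp add: S_def inv)
  define \<Gamma> where "\<Gamma> s = U (\<theta> (max s 0)) - R (max 0 (- s))" for s
  have \<theta>r: "\<theta> s \<in> {0..T}" if "0 \<le> s" "s \<le> S" for s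
    using strict_mono_less_eq[OF mono(2), of 0 s] strict_mono_less_eq[OF mono(2), of s S] that
    by (simp add: \<theta>(2) \<theta>S)
  have Uc: "continuous_on {0..T} U"
    unfolding U_def by (rule indefinite_integral_continuous_1[OF absint_imp_integrable[OF u]])
  have Rc: "continuous_on {0..1} R"
    unfolding R_def by (rule indefinite_integral_continuous_1[OF absint_imp_integrable[OF \<rho>0]])
  have \<Gamma>c: "continuous_on {-1..S} \<Gamma>"
    unfolding \<Gamma>_def
    by (intro continuous_intros continuous_on_compose2[OF Uc] continuous_on_compose2[OF Rc]
        continuous_on_compose2[OF \<theta>c[of UNIV]]) (use \<theta>r S0 in \<open>auto simp: image_subset_iff\<close>)
  have U0: "U 0 = 0" and R0: "R 0 = 0" by (simp_all add: U_def R_def)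
  \<comment> \<open>Let the test function tend to the indicator of a half-line in the variable that is constant along characteristics.\<close>
  have prim: "integral {0..x} (\<rho> \<tau>) = \<Gamma> (\<xi> \<tau>) - \<Gamma> (\<xi> \<tau> - x)" if \<tau>: "\<tau> \<in> {0..T}" and x: "x \<in> {0..1}" for \<tau> x
  proof -
    define a where "a = x - \<xi> \<tau>"
    have \<xi>\<tau>: "0 \<le> \<xi> \<tau>" using strict_mono_less_eq[OF mono(1), of 0 \<tau>] \<tau> \<xi>(2) by simp
    define L where "L n = integral {0..1} (\<lambda>x. \<rho> \<tau> x * soft_step n (x - \<xi> \<tau> - a))" for n
    have L_eq: "L n = integral {0..1} (\<lambda>x. \<rho>0 x * soft_step n (x - a))
      - integral {0..\<tau>} (\<lambda>t. y t * soft_step n (1 - \<xi> t - a)) + integral {0..\<tau>} (\<lambda>t. u t * soft_step n (- \<xi> t - a))" for n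
      unfolding L_def u_def
    proof (rule char[where \<psi>="\<lambda>z. soft_step n (z - a)"
          and \<psi>'="\<lambda>z. - (real n / (1 + (real n * (z - a))\<^sup>2)) / pi", OF _ _ \<tau>])
      show "((\<lambda>z. soft_step n (z - a)) has_real_derivative - (real n / (1 + (real n * (z - a))\<^sup>2)) / pi) (at z)" for z
      proof -
        have "((\<lambda>z. z - a) has_real_derivative 1) (at z)" by (auto intro!: derivative_eq_intros)
        from DERIV_chain2[OF soft_step_deriv this] show ?thesis by simp
      qed
      have "1 + (real n * (z - a))\<^sup>2 \<noteq> 0" for z
        using zero_le_power2[of "real n * (z - a)"] by linarith
      then show "continuous_on UNIV (\<lambda>z. - (real n / (1 + (real n * (z - a))\<^sup>2)) / pi)"
        by (intro continuous_intros) auto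
    qed
    have lim1: "L \<longlonglongrightarrow> integral {0..1} (\<lambda>x. \<rho> \<tau> x * step (x - \<xi> \<tau> - a))"
      unfolding L_def using \<tau> by (intro soft_step_integral_tendsto \<rho>i continuous_intros) auto
    have lim2: "L \<longlonglongrightarrow> integral {0..1} (\<lambda>x. \<rho>0 x * step (x - a))
      - integral {0..\<tau>} (\<lambda>t. y t * step (1 - \<xi> t - a)) + integral {0..\<tau>} (\<lambda>t. u t * step (- \<xi> t - a))"
      unfolding L_eq
      by (intro tendsto_intros soft_step_integral_tendsto \<rho>0 sub[OF y \<tau>] sub[OF u \<tau>] continuous_intros \<xi>c)
    have eq: "integral {0..1} (\<lambda>x. \<rho> \<tau> x * step (x - \<xi> \<tau> - a)) = integral {0..1} (\<lambda>x. \<rho>0 x * step (x - a))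
      - integral {0..\<tau>} (\<lambda>t. y t * step (1 - \<xi> t - a)) + integral {0..\<tau>} (\<lambda>t. u t * step (- \<xi> t - a))"
      by (rule LIMSEQ_unique[OF lim1 lim2])
    have e1: "integral {0..1} (\<lambda>x. \<rho> \<tau> x * step (x - \<xi> \<tau> - a)) = integral {0..x} (\<rho> \<tau>)"
      using integral_step[of 0 1 "\<rho> \<tau>" x] x by (simp add: a_def)
    have e2: "integral {0..1} (\<lambda>x. \<rho>0 x * step (x - a)) = R (max 0 a)"
      using integral_step[of 0 1 \<rho>0 a] x \<xi>\<tau> by (simp add: R_def a_def)
    have yi: "y integrable_on {0..\<tau>}" and ui: "u integrable_on {0..\<tau>}"
      using sub[OF y \<tau>] sub[OF u \<tau>] by (auto intro: absint_imp_integrable)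
    have "\<theta> (1 - a) \<ge> \<theta> (\<xi> \<tau>)" using x by (intro monoD[OF strict_mono_mono[OF mono(2)]]) (simp add: a_def)
    then have m1: "max 0 (min \<tau> (\<theta> (1 - a))) = \<tau>" using \<tau> by (simp add: inv)
    have "integral {0..\<tau>} (\<lambda>t. y t * step (1 - \<xi> t - a)) = integral {0..\<tau>} (\<lambda>t. y t * step ((1 - a) - \<xi> t))"
      by (simp add: algebra_simps)
    also have "\<dots> = 0"
      unfolding integral_step_reversed[OF yi mono(1) inv(1)] m1 by simp
    finally have e3: "integral {0..\<tau>} (\<lambda>t. y t * step (1 - \<xi> t - a)) = 0" .
    have "\<theta> (- a) \<le> \<theta> (\<xi> \<tau>)" using x by (intro monoD[OF strict_mono_mono[OF mono(2)]]) (simp add: a_def)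
    then have "min \<tau> (\<theta> (- a)) = \<theta> (- a)" by (simp add: inv)
    moreover have "max 0 (\<theta> (- a)) = \<theta> (max (- a) 0)"
      using strict_mono_less_eq[OF mono(2), of 0 "- a"] \<theta>(2) by (auto simp: max_def)
    ultimately have m2: "max 0 (min \<tau> (\<theta> (- a))) = \<theta> (max (- a) 0)" by simp
    have "integral {0..\<tau>} (\<lambda>t. u t * step (- \<xi> t - a)) = integral {0..\<tau>} (\<lambda>t. u t * step (- a - \<xi> t))"
    proof -
      have "- \<xi> t - a = - a - \<xi> t" for t by simp
      then show ?thesis by (simp only:)
    qed
    also have "\<dots> = U \<tau> - U (\<theta> (max (- a) 0))"
      unfolding integral_step_reversed[OF ui mono(1) inv(1)] m2 by (simp add: U_def)
    finally have e4: "integral {0..\<tau>} (\<lambda>t. u t * step (- \<xi> t - a)) = U \<tau> - U (\<theta> (max (- a) 0))" .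
    have "integral {0..x} (\<rho> \<tau>) = R (max 0 a) + U \<tau> - U (\<theta> (max (- a) 0))"
      using eq unfolding e1 e2 e3 e4 by simp
    moreover have "\<Gamma> (\<xi> \<tau>) = U \<tau>" using \<xi>\<tau> by (simp add: \<Gamma>_def inv R0)
    moreover have "\<Gamma> (\<xi> \<tau> - x) = U (\<theta> (max (- a) 0)) - R (max 0 a)" by (simp add: \<Gamma>_def a_def)
    ultimately show ?thesis by simp
  qed
  \<comment> \<open>Conservation of mass, from the constant test function.\<close>
  have massbal: "W \<tau> = R 1 - integral {0..\<tau>} y + U \<tau>" if \<tau>: "\<tau> \<in> {0..T}" for \<tau>
    using char[where \<psi>="\<lambda>_. 1" and \<psi>'="\<lambda>_. 0", OF _ _ \<tau>] W_eq[of \<tau>] \<tau>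
    by (simp add: R_def U_def[abs_def] u_def[abs_def])
  have W\<Gamma>: "W (\<theta> s) = \<Gamma> s - \<Gamma> (s - 1)" if "0 \<le> s" "s \<le> S" for s
    using prim[OF \<theta>r[OF that], of 1] W_eq[of "\<theta> s"] \<theta>r[OF that] by (simp add: inv)
  have eq: "\<Gamma> s = k * (\<Gamma> (s - 1) - \<Gamma> (-1)) + (1 - k) * r * \<Lambda> r * \<theta> s" if s: "0 \<le> s" "s \<le> S" for s
  proof -
    let ?\<tau> = "\<theta> s"
    have \<tau>: "?\<tau> \<in> {0..T}" by (rule \<theta>r[OF s])
    have "(u has_integral (k * integral {0..?\<tau>} y + ?\<tau> * c)) {0..?\<tau>}"
      unfolding u_def using has_integral_const_real[of c 0 ?\<tau>] \<tau>
      by (intro has_integral_add has_integral_mult_right integrable_integral absint_imp_integrable sub[OF y \<tau>]) auto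
    then have "U ?\<tau> = k * integral {0..?\<tau>} y + c * ?\<tau>" by (simp add: U_def integral_unique mult.commute)
    moreover have "integral {0..?\<tau>} y = \<Gamma> (s - 1) - \<Gamma> (-1)"
    proof -
      have "\<Gamma> s = U ?\<tau>" using s by (simp add: \<Gamma>_def R0)
      moreover have "\<Gamma> (-1) = - R 1" by (simp add: \<Gamma>_def \<theta>(2) U0)
      ultimately show ?thesis using massbal[OF \<tau>] W\<Gamma>[OF s] by simp
    qed
    moreover have "\<Gamma> s = U ?\<tau>" using s by (simp add: \<Gamma>_def R0)
    ultimately show ?thesis by (simp add: c_def)
  qed
  have time: "\<theta> s = integral {0..s} (\<lambda>\<sigma>. 1 / \<Lambda> (\<Gamma> \<sigma> - \<Gamma> (\<sigma> - 1)))" if s: "0 \<le> s" "s \<le> S" for s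
  proof -
    have "((\<lambda>\<sigma>. 1 / v (\<theta> \<sigma>)) has_integral \<theta> s - \<theta> 0) {0..s}"
      by (rule fundamental_theorem_of_calculus[OF s(1)])
        (use \<theta>(1) in \<open>auto simp flip: has_real_derivative_iff_has_vector_derivative intro: has_field_derivative_at_within\<close>)
    then have "integral {0..s} (\<lambda>\<sigma>. 1 / v (\<theta> \<sigma>)) = \<theta> s" by (simp add: integral_unique \<theta>(2))
    moreover have "integral {0..s} (\<lambda>\<sigma>. 1 / v (\<theta> \<sigma>)) = integral {0..s} (\<lambda>\<sigma>. 1 / \<Lambda> (\<Gamma> \<sigma> - \<Gamma> (\<sigma> - 1)))"
    proof (rule integral_cong)
      fix \<sigma> assume "\<sigma> \<in> {0..s}"
      then have \<sigma>: "0 \<le> \<sigma>" "\<sigma> \<le> S" using s by auto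
      show "1 / v (\<theta> \<sigma>) = 1 / \<Lambda> (\<Gamma> \<sigma> - \<Gamma> (\<sigma> - 1))"
        using vW[OF \<theta>r[OF \<sigma>]] W\<Gamma>[OF \<sigma>] by (simp add: W_def)
    qed
    ultimately show ?thesis by simp
  qed
  show thesis
  proof (rule that[of S \<Gamma> \<theta>])
    show "\<Gamma> s = - integral {0..- s} \<rho>0" if "-1 \<le> s" "s \<le> 0" for s
      using that by (simp add: \<Gamma>_def \<theta>(2) U0 R_def max_def)
    show "\<exists>s. 0 \<le> s \<and> s \<le> S \<and> \<theta> s = \<tau> \<and> (\<forall>x\<in>{0..1}. integral {0..x} (\<rho> \<tau>) = \<Gamma> s - \<Gamma> (s - x))"
      if "0 \<le> \<tau>" "\<tau> \<le> T" for \<tau>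
    proof (intro exI[of _ "\<xi> \<tau>"] conjI ballI)
      show "0 \<le> \<xi> \<tau>" using strict_mono_less_eq[OF mono(1), of 0 \<tau>] that \<xi>(2) by simp
      show "\<xi> \<tau> \<le> S" using strict_mono_less_eq[OF mono(1), of \<tau> T] that by (simp add: S_def)
      show "integral {0..x} (\<rho> \<tau>) = \<Gamma> (\<xi> \<tau>) - \<Gamma> (\<xi> \<tau> - x)" if "x \<in> {0..1}" for x
        by (rule prim) (use that \<open>0 \<le> \<tau>\<close> \<open>\<tau> \<le> T\<close> in auto)
    qed (simp add: inv)
  qed (use S0 \<Gamma>c time eq mono(2) in auto)
qed

text \<open>
  The functions \<open>\<Gamma>\<close> of two weak solutions satisfy the same fixed point equation with the same
  history, so they and the clocks \<open>\<theta>\<close> agree as far as both are defined.  The solution that has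
  travelled the shorter distance at the final time lies within this range; as the clocks are
  strictly monotone, both solutions have travelled equally far at time \<open>t\<close>, and their masses in
  \<open>[0, x]\<close> agree for all \<open>x\<close>.
\<close>

lemma weak_solution_unique:
  fixes \<Lambda> \<rho>0 :: "real \<Rightarrow> real"
  assumes ws: "weak_solution \<Lambda> r k \<rho>0 \<rho>" "weak_solution \<Lambda> r k \<rho>0 \<rho>'"
    and \<rho>0: "\<rho>0 absolutely_integrable_on {0..1}"
    and \<Lambda>: "continuous_on UNIV \<Lambda>" "\<And>w. \<Lambda> w > 0"
    and lip: "\<And>M. \<exists>L\<ge>0. \<forall>x y. \<bar>x\<bar> \<le> M \<and> \<bar>y\<bar> \<le> M \<longrightarrow> \<bar>1 / \<Lambda> x - 1 / \<Lambda> y\<bar> \<le> L * \<bar>x - y\<bar>"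
    and k: "\<bar>k\<bar> \<le> 1" and t: "0 \<le> t"
  shows "AE x in lebesgue_on {0<..<1}. \<rho>' t x = \<rho> t x"
proof -
  have T: "0 < t + 1" using t by simp
  obtain S \<Gamma> \<theta> where 1: "0 < S" "continuous_on {-1..S} \<Gamma>"
    "\<And>s. -1 \<le> s \<Longrightarrow> s \<le> 0 \<Longrightarrow> \<Gamma> s = - integral {0..- s} \<rho>0"
    "\<And>s. 0 \<le> s \<Longrightarrow> s \<le> S \<Longrightarrow> \<theta> s = integral {0..s} (\<lambda>\<sigma>. 1 / \<Lambda> (\<Gamma> \<sigma> - \<Gamma> (\<sigma> - 1)))"
    "\<And>s. 0 \<le> s \<Longrightarrow> s \<le> S \<Longrightarrow> \<Gamma> s = k * (\<Gamma> (s - 1) - \<Gamma> (-1)) + (1 - k) * r * \<Lambda> r * \<theta> s"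
    and P: "\<And>\<tau>. 0 \<le> \<tau> \<Longrightarrow> \<tau> \<le> t + 1 \<Longrightarrow> \<exists>s. 0 \<le> s \<and> s \<le> S \<and> \<theta> s = \<tau> \<and>
        (\<forall>x\<in>{0..1}. integral {0..x} (\<rho> \<tau>) = \<Gamma> s - \<Gamma> (s - x))" and mono: "strict_mono \<theta>"
    by (rule weak_solution_flux_primitive[OF ws(1) \<rho>0 \<Lambda> T]) blast
  obtain S' \<Gamma>' \<theta>' where 2: "0 < S'" "continuous_on {-1..S'} \<Gamma>'"
    "\<And>s. -1 \<le> s \<Longrightarrow> s \<le> 0 \<Longrightarrow> \<Gamma>' s = - integral {0..- s} \<rho>0"
    "\<And>s. 0 \<le> s \<Longrightarrow> s \<le> S' \<Longrightarrow> \<theta>' s = integral {0..s} (\<lambda>\<sigma>. 1 / \<Lambda> (\<Gamma>' \<sigma> - \<Gamma>' (\<sigma> - 1)))"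
    "\<And>s. 0 \<le> s \<Longrightarrow> s \<le> S' \<Longrightarrow> \<Gamma>' s = k * (\<Gamma>' (s - 1) - \<Gamma>' (-1)) + (1 - k) * r * \<Lambda> r * \<theta>' s"
    and P': "\<And>\<tau>. 0 \<le> \<tau> \<Longrightarrow> \<tau> \<le> t + 1 \<Longrightarrow> \<exists>s. 0 \<le> s \<and> s \<le> S' \<and> \<theta>' s = \<tau> \<and>
        (\<forall>x\<in>{0..1}. integral {0..x} (\<rho>' \<tau>) = \<Gamma>' s - \<Gamma>' (s - x))" and mono': "strict_mono \<theta>'"
    by (rule weak_solution_flux_primitive[OF ws(2) \<rho>0 \<Lambda> T]) blast
  define Z where "Z = min S S'"
  have Z: "0 < Z" "Z \<le> S" "Z \<le> S'" using 1(1) 2(1) by (auto simp: Z_def)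
  have Gc: "continuous_on {-1..Z} \<Gamma>" and Gc': "continuous_on {-1..Z} \<Gamma>'"
    using Z by (auto intro: continuous_on_subset[OF 1(2)] continuous_on_subset[OF 2(2)])
  have "bounded (\<Gamma> ` {-1..Z})" "bounded (\<Gamma>' ` {-1..Z})"
    by (simp_all add: Gc Gc' compact_continuous_image compact_imp_bounded)
  then obtain b b' where b: "\<And>s. s \<in> {-1..Z} \<Longrightarrow> \<bar>\<Gamma> s\<bar> \<le> b" "\<And>s. s \<in> {-1..Z} \<Longrightarrow> \<bar>\<Gamma>' s\<bar> \<le> b'"
    unfolding bounded_iff by (metis imageI real_norm_def)
  define M where "M = 2 * max b b'"
  obtain L where L: "L \<ge> 0" "\<And>x y. \<bar>x\<bar> \<le> M \<Longrightarrow> \<bar>y\<bar> \<le> M \<Longrightarrow> \<bar>1 / \<Lambda> x - 1 / \<Lambda> y\<bar> \<le> L * \<bar>x - y\<bar>"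
    using lip[of M] by blast
  define f where "f \<sigma> = r * \<Lambda> r * (1 / \<Lambda> (\<Gamma> \<sigma> - \<Gamma> (\<sigma> - 1)))" for \<sigma>
  define f' where "f' \<sigma> = r * \<Lambda> r * (1 / \<Lambda> (\<Gamma>' \<sigma> - \<Gamma>' (\<sigma> - 1)))" for \<sigma>
  have \<Lambda>n: "\<Lambda> w \<noteq> 0" for w using \<Lambda>(2)[of w] by simp
  have fc: "continuous_on {0..Z} f" "continuous_on {0..Z} f'"
    unfolding f_def f'_def
    by (intro continuous_intros continuous_on_compose2[OF \<Lambda>(1)] continuous_on_compose2[OF Gc]
        continuous_on_compose2[OF Gc'] continuous_on_subset[OF Gc] continuous_on_subset[OF Gc']; auto simp: \<Lambda>n)+
  have same: "\<Gamma> s = \<Gamma>' s" if s: "-1 \<le> s" "s \<le> Z" for s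
  proof (rule delay_primitive_unique[OF Gc Gc' _ fc _ k _ _ _ s])
    show "\<Gamma> s = \<Gamma>' s" if "-1 \<le> s" "s \<le> 0" for s using 1(3)[OF that] 2(3)[OF that] by simp
    show "0 \<le> \<bar>r * \<Lambda> r\<bar> * L" using L(1) by simp
    show "\<bar>f \<sigma> - f' \<sigma>\<bar> \<le> \<bar>r * \<Lambda> r\<bar> * L * (\<bar>\<Gamma> \<sigma> - \<Gamma>' \<sigma>\<bar> + \<bar>\<Gamma> (\<sigma> - 1) - \<Gamma>' (\<sigma> - 1)\<bar>)"
      if \<sigma>: "0 \<le> \<sigma>" "\<sigma> \<le> Z" for \<sigma>
    proof -
      let ?a = "\<Gamma> \<sigma> - \<Gamma> (\<sigma> - 1)" and ?b = "\<Gamma>' \<sigma> - \<Gamma>' (\<sigma> - 1)"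
      have "\<bar>?a\<bar> \<le> M" "\<bar>?b\<bar> \<le> M"
        using b(1)[of \<sigma>] b(1)[of "\<sigma> - 1"] b(2)[of \<sigma>] b(2)[of "\<sigma> - 1"] \<sigma> by (auto simp: M_def)
      then have "\<bar>1 / \<Lambda> ?a - 1 / \<Lambda> ?b\<bar> \<le> L * \<bar>?a - ?b\<bar>" by (rule L(2))
      also have "\<dots> \<le> L * (\<bar>\<Gamma> \<sigma> - \<Gamma>' \<sigma>\<bar> + \<bar>\<Gamma> (\<sigma> - 1) - \<Gamma>' (\<sigma> - 1)\<bar>)"
        using L(1) by (intro mult_left_mono) auto
      finally have "\<bar>r * \<Lambda> r\<bar> * \<bar>1 / \<Lambda> ?a - 1 / \<Lambda> ?b\<bar>
          \<le> \<bar>r * \<Lambda> r\<bar> * (L * (\<bar>\<Gamma> \<sigma> - \<Gamma>' \<sigma>\<bar> + \<bar>\<Gamma> (\<sigma> - 1) - \<Gamma>' (\<sigma> - 1)\<bar>))"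
        by (intro mult_left_mono) auto
      then show ?thesis
        unfolding f_def f'_def right_diff_distrib[symmetric] abs_mult[of "r * \<Lambda> r"] by (simp only: mult.assoc)
    qed
    show "\<Gamma> s = k * (\<Gamma> (s - 1) - \<Gamma> (- 1)) + (1 - k) * integral {0..s} f" if "0 \<le> s" "s \<le> Z" for s
    proof -
      have "integral {0..s} f = r * \<Lambda> r * integral {0..s} (\<lambda>\<sigma>. 1 / \<Lambda> (\<Gamma> \<sigma> - \<Gamma> (\<sigma> - 1)))"
        unfolding f_def by (rule integral_mult_right)
      also have "\<dots> = r * \<Lambda> r * \<theta> s" using 1(4)[of s] that Z by simp
      finally show ?thesis using 1(5)[of s] that Z by simp
    qed
    show "\<Gamma>' s = k * (\<Gamma>' (s - 1) - \<Gamma>' (- 1)) + (1 - k) * integral {0..s} f'" if "0 \<le> s" "s \<le> Z" for s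
    proof -
      have "integral {0..s} f' = r * \<Lambda> r * integral {0..s} (\<lambda>\<sigma>. 1 / \<Lambda> (\<Gamma>' \<sigma> - \<Gamma>' (\<sigma> - 1)))"
        unfolding f'_def by (rule integral_mult_right)
      also have "\<dots> = r * \<Lambda> r * \<theta>' s" using 2(4)[of s] that Z by simp
      finally show ?thesis using 2(5)[of s] that Z by simp
    qed
  qed
  have \<theta>same: "\<theta> s = \<theta>' s" if s: "0 \<le> s" "s \<le> Z" for s
  proof -
    have "\<theta> s = integral {0..s} (\<lambda>\<sigma>. 1 / \<Lambda> (\<Gamma> \<sigma> - \<Gamma> (\<sigma> - 1)))" using 1(4)[of s] s Z by simp
    also have "\<dots> = integral {0..s} (\<lambda>\<sigma>. 1 / \<Lambda> (\<Gamma>' \<sigma> - \<Gamma>' (\<sigma> - 1)))"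
      by (rule integral_cong) (use same s in auto)
    also have "\<dots> = \<theta>' s" using 2(4)[of s] s Z by simp
    finally show ?thesis .
  qed
  obtain s where s: "0 \<le> s" "s \<le> S" "\<theta> s = t" "\<forall>x\<in>{0..1}. integral {0..x} (\<rho> t) = \<Gamma> s - \<Gamma> (s - x)"
    using P[of t] t by auto
  obtain s' where s': "0 \<le> s'" "s' \<le> S'" "\<theta>' s' = t" "\<forall>x\<in>{0..1}. integral {0..x} (\<rho>' t) = \<Gamma>' s' - \<Gamma>' (s' - x)"
    using P'[of t] t by auto
  have ss: "s = s' \<and> s \<le> Z"
  proof (cases "S \<le> S'")
    case True
    then have "\<theta>' s = t" using \<theta>same[of s] s by (simp add: Z_def)
    then show ?thesis using strict_mono_eq[OF mono', of s s'] s s' True by (simp add: Z_def)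
  next
    case False
    then have "\<theta> s' = t" using \<theta>same[of s'] s' by (simp add: Z_def)
    then show ?thesis using strict_mono_eq[OF mono, of s s'] s s' False by (simp add: Z_def)
  qed
  have prims: "integral {0..x} (\<rho>' t) = integral {0..x} (\<rho> t)" if x: "x \<in> {0..1}" for x
    using s(4) s'(4) x ss same[of s] same[of "s - x"] s(1) by auto
  have \<rho>i: "\<rho> t integrable_on {0..1}" "\<rho>' t integrable_on {0..1}"
    using ws t unfolding weak_solution_def C0_L2_def
    by (auto simp: L2_on_open_iff_sqint sqint_def intro: absint_imp_integrable)
  have "AE x in lebesgue_on {0<..<1}. \<rho>' t x - \<rho> t x = 0"
  proof (rule AE_zero_of_primitive_zero)
    show "(\<lambda>x. \<rho>' t x - \<rho> t x) integrable_on {0..1}" by (intro integrable_diff \<rho>i)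
    show "integral {0..x} (\<lambda>x. \<rho>' t x - \<rho> t x) = 0" if "x \<in> {0..1}" for x
    proof -
      have "integral {0..x} (\<lambda>x. \<rho>' t x - \<rho> t x) = integral {0..x} (\<rho>' t) - integral {0..x} (\<rho> t)"
        using that by (intro Henstock_Kurzweil_Integration.integral_diff integrable_on_subinterval[OF \<rho>i(1)]
            integrable_on_subinterval[OF \<rho>i(2)]) auto
      then show ?thesis using prims[OF that] by simp
    qed
  qed
  then show ?thesis by simp
qed

section \<open>Exponential stability\<close>

lemma abs_clamp_diff_le:
  fixes d x y :: real
  assumes "0 \<le> d"
  shows "\<bar>max (- d) (min d x) - max (- d) (min d y)\<bar> \<le> \<bar>x - y\<bar>"
  using assms by (auto simp: max_def min_def)

lemma derivative_bound_lipschitz: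
  fixes f f' :: "real \<Rightarrow> real"
  assumes f: "\<And>x. (f has_real_derivative f' x) (at x)" and f': "continuous_on UNIV f'"
  shows "\<exists>L\<ge>0. \<forall>x y. \<bar>x\<bar> \<le> M \<and> \<bar>y\<bar> \<le> M \<longrightarrow> \<bar>f x - f y\<bar> \<le> L * \<bar>x - y\<bar>"
proof -
  have "bounded (f' ` {-M..M})"
    by (simp add: compact_continuous_image compact_imp_bounded continuous_on_subset[OF f'])
  then obtain L where L: "L > 0" "\<And>x. x \<in> {-M..M} \<Longrightarrow> \<bar>f' x\<bar> \<le> L"
    unfolding bounded_pos by (metis imageI real_norm_def)
  have "\<bar>f x - f y\<bar> \<le> L * \<bar>x - y\<bar>" if "\<bar>x\<bar> \<le> M" "\<bar>y\<bar> \<le> M" for x y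
    using field_differentiable_bound[of "{-M..M}" f f' L x y] L that f
    by (auto simp: abs_le_iff intro: has_field_derivative_at_within)
  then show ?thesis using L(1) by (intro exI[of _ L]) auto
qed

text \<open>
  As \<open>F' 0 < 1\<close>, the quotient \<open>F x / x\<close> stays below some \<open>\<theta> < 1\<close> near \<open>0\<close>.  Continuing \<open>F\<close> by its
  boundary values outside \<open>[- \<delta>, \<delta>]\<close> makes this bound and the Lipschitz bound global, without a
  change for arguments in \<open>[- \<delta>, \<delta>]\<close>.
\<close>

lemma sector_truncation:
  fixes F F' :: "real \<Rightarrow> real"
  assumes F': "\<And>x. (F has_real_derivative F' x) (at x)" and F'c: "continuous_on UNIV F'"
    and F0: "F 0 = 0" and F'1: "F' 0 < 1"
  shows "\<exists>\<delta>>0. \<exists>\<theta> L Ft. 0 \<le> \<theta> \<and> \<theta> < 1 \<and> (\<forall>x y. \<bar>Ft x - Ft y\<bar> \<le> L * \<bar>x - y\<bar>) \<and>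
    (\<forall>x. \<bar>Ft x\<bar> \<le> L * \<delta>) \<and> (\<forall>x. x * Ft x \<le> \<theta> * x\<^sup>2) \<and> (\<forall>x. \<bar>x\<bar> \<le> \<delta> \<longrightarrow> Ft x = F x)"
proof -
  define \<theta> where "\<theta> = (1 + max 0 (F' 0)) / 2"
  have \<theta>: "0 \<le> \<theta>" "\<theta> < 1" "F' 0 < \<theta>" using F'1 by (auto simp: \<theta>_def max_def)
  have "((\<lambda>x. F x / x) \<longlongrightarrow> F' 0) (at 0)"
    using F'[of 0] F0 by (simp add: has_field_derivative_iff)
  then have "\<forall>\<^sub>F x in at 0. F x / x < \<theta>" using \<theta>(3) by (rule order_tendstoD)
  then obtain \<delta>0 where \<delta>0: "\<delta>0 > 0" "\<And>x. x \<noteq> 0 \<Longrightarrow> \<bar>x\<bar> < \<delta>0 \<Longrightarrow> F x / x < \<theta>"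
    unfolding eventually_at by (auto simp: dist_real_def)
  define \<delta> where "\<delta> = \<delta>0 / 2"
  have \<delta>: "\<delta> > 0" using \<delta>0(1) by (simp add: \<delta>_def)
  have sector0: "x * F x \<le> \<theta> * x\<^sup>2" if "\<bar>x\<bar> \<le> \<delta>" for x
  proof (cases "x = 0")
    case False
    then have "F x / x \<le> \<theta>" using \<delta>0 that by (intro less_imp_le) (auto simp: \<delta>_def)
    then have "F x / x * x\<^sup>2 \<le> \<theta> * x\<^sup>2" by (intro mult_right_mono) auto
    then show ?thesis using False by (simp add: power2_eq_square mult.commute)
  qed simp
  define cl where "cl x = max (- \<delta>) (min \<delta> x)" for x
  have clb: "\<bar>cl x\<bar> \<le> \<delta>" for x using \<delta> by (auto simp: cl_def)
  have clid: "cl x = x" if "\<bar>x\<bar> \<le> \<delta>" for x using that by (auto simp: cl_def)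
  define Ft where "Ft x = F (cl x)" for x
  obtain L where L: "L \<ge> 0" "\<And>x y. \<bar>x\<bar> \<le> \<delta> \<Longrightarrow> \<bar>y\<bar> \<le> \<delta> \<Longrightarrow> \<bar>F x - F y\<bar> \<le> L * \<bar>x - y\<bar>"
    using derivative_bound_lipschitz[OF F' F'c, of \<delta>] by blast
  have FtL: "\<bar>Ft x - Ft y\<bar> \<le> L * \<bar>x - y\<bar>" for x y
  proof -
    have "\<bar>Ft x - Ft y\<bar> \<le> L * \<bar>cl x - cl y\<bar>" unfolding Ft_def by (intro L(2) clb)
    also have "\<dots> \<le> L * \<bar>x - y\<bar>"
      unfolding cl_def using \<delta> L(1) by (intro mult_left_mono abs_clamp_diff_le) auto
    finally show ?thesis .
  qed
  have FtB: "\<bar>Ft x\<bar> \<le> L * \<delta>" for x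
  proof -
    have "\<bar>F (cl x) - F 0\<bar> \<le> L * \<bar>cl x - 0\<bar>" using \<delta> by (intro L(2) clb) auto
    also have "\<dots> \<le> L * \<delta>" using clb L(1) by (intro mult_left_mono) auto
    finally show ?thesis by (simp add: Ft_def F0)
  qed
  have sector: "x * Ft x \<le> \<theta> * x\<^sup>2" for x
  proof (cases "x = 0")
    case False
    \<comment> \<open>\<open>x\<close> and \<open>cl x\<close> have the same sign and \<open>\<bar>cl x\<bar> \<le> \<bar>x\<bar>\<close>.\<close>
    obtain a where a: "a \<ge> 1" "x = a * cl x"
    proof (rule that)
      have c0: "cl x \<noteq> 0" using False \<delta> by (auto simp: cl_def max_def min_def)
      then show "x = (x / cl x) * cl x" by simp
      show "1 \<le> x / cl x" using \<delta> c0 by (auto simp: cl_def max_def min_def divide_simps split: if_splits)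
    qed
    have "x * Ft x = a * (cl x * F (cl x))" using a(2) by (simp add: Ft_def mult.assoc)
    also have "\<dots> \<le> a * (\<theta> * (cl x)\<^sup>2)" using a(1) by (intro mult_left_mono sector0 clb) auto
    also have "\<dots> \<le> a * (\<theta> * (cl x)\<^sup>2) * a" 
      using mult_left_mono[OF a(1), of "a * (\<theta> * (cl x)\<^sup>2)"] a(1) \<theta>(1) by simp
    also have "\<dots> = \<theta> * (a * cl x)\<^sup>2" by (simp add: power2_eq_square)
    finally show ?thesis using a(2) by simp
  qed simp
  have "\<forall>x. \<bar>x\<bar> \<le> \<delta> \<longrightarrow> Ft x = F x" by (simp add: Ft_def clid)
  then show ?thesis using \<delta> \<theta>(1,2) FtL FtB sector by blast
qed

theorem theorem4p2:
  fixes \<Lambda> :: "real \<Rightarrow> real" and r d k :: real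
  assumes "\<Lambda> C1_differentiable_on UNIV"
    and "\<And>w. \<Lambda> w > 0"
    and "d = r * deriv \<Lambda> r / \<Lambda> r"
    and "d > -1"
    and "k \<in> {-1<..<1}"
  shows "\<exists>\<epsilon>>0. \<exists>C>0. \<exists>\<alpha>>0. \<forall>\<rho>0.
           L2_on {0<..<1} \<rho>0 \<and> norm_L2 {0<..<1} (\<lambda>x. \<rho>0 x - r) \<le> \<epsilon> \<longrightarrow>
           (\<exists>\<rho>. weak_solution \<Lambda> r k \<rho>0 \<rho> \<and>
                (\<forall>\<rho>'. weak_solution \<Lambda> r k \<rho>0 \<rho>' \<longrightarrow>
                   (\<forall>t\<ge>0. AE x in lebesgue_on {0<..<1}. \<rho>' t x = \<rho> t x)) \<and>
                (\<forall>t\<ge>0. norm_L2 {0<..<1} (\<lambda>x. \<rho> t x - r)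
                   \<le> C * exp (- \<alpha> * t) * norm_L2 {0<..<1} (\<lambda>x. \<rho>0 x - r)))"
proof -
  note \<Lambda>pos = assms(2)
  obtain \<Lambda>' where \<Lambda>': "\<And>x. (\<Lambda> has_real_derivative \<Lambda>' x) (at x)" "continuous_on UNIV \<Lambda>'"
    using assms(1) unfolding C1_differentiable_on_def has_real_derivative_iff_has_vector_derivative by auto
  have \<Lambda>c: "continuous_on UNIV \<Lambda>" using \<Lambda>'(1) by (meson DERIV_continuous_on has_field_derivative_at_within)
  have \<Lambda>n: "\<Lambda> w \<noteq> 0" for w using \<Lambda>pos[of w] by simp
  have d: "d = r * \<Lambda>' r / \<Lambda> r" using assms(3) DERIV_imp_deriv[OF \<Lambda>'(1)] by simp
  have k: "\<bar>k\<bar> < 1" using assms(5) by auto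
  have inv': "((\<lambda>w. 1 / \<Lambda> w) has_real_derivative - (\<Lambda>' w / (\<Lambda> w)\<^sup>2)) (at w)" for w
    using \<Lambda>n by (auto intro!: derivative_eq_intros \<Lambda>'(1) simp: power2_eq_square)
  have inv'c: "continuous_on UNIV (\<lambda>w. - (\<Lambda>' w / (\<Lambda> w)\<^sup>2))"
    by (intro continuous_intros \<Lambda>'(2) \<Lambda>c) (auto simp: \<Lambda>n)
  note lip_inv = derivative_bound_lipschitz[OF inv' inv'c]
  define F where "F x = r * (\<Lambda> r / \<Lambda> (r + x) - 1)" for x
  define F' where "F' x = r * \<Lambda> r * (- (\<Lambda>' (r + x) / (\<Lambda> (r + x))\<^sup>2))" for x
  have F': "(F has_real_derivative F' x) (at x)" for x
  proof -
    have "((\<lambda>x. 1 / \<Lambda> (r + x)) has_real_derivative - (\<Lambda>' (r + x) / (\<Lambda> (r + x))\<^sup>2) * 1) (at x)"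
      by (rule DERIV_chain2[OF inv']) (auto intro!: derivative_eq_intros)
    from DERIV_cmult[OF this, of "r * \<Lambda> r"]
    have "((\<lambda>x. r * \<Lambda> r * (1 / \<Lambda> (r + x)) - r) has_real_derivative F' x - 0) (at x)"
      unfolding F'_def by (intro DERIV_diff DERIV_const) simp
    moreover have "(\<lambda>x. r * \<Lambda> r * (1 / \<Lambda> (r + x)) - r) = F" by (auto simp: F_def algebra_simps)
    ultimately show ?thesis by simp
  qed
  have F'c: "continuous_on UNIV F'"
    unfolding F'_def
    by (intro continuous_intros continuous_on_compose2[OF \<Lambda>'(2)] continuous_on_compose2[OF \<Lambda>c]) (auto simp: \<Lambda>n)
  have F0: "F 0 = 0" by (simp add: F_def \<Lambda>n)
  have F'0: "F' 0 = - d" by (simp add: F'_def d power2_eq_square \<Lambda>n)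
  \<comment> \<open>Here \<open>d > -1\<close> enters: the slope \<open>- d\<close> of \<open>F\<close> at \<open>0\<close> is less than \<open>1\<close>.\<close>
  have "F' 0 < 1" using F'0 assms(4) by simp
  from sector_truncation[OF F' F'c F0 this] obtain \<delta> \<theta> L Ft where \<delta>: "\<delta> > 0" and \<theta>: "0 \<le> \<theta>" "\<theta> < 1"
    and FtL: "\<And>x y. \<bar>Ft x - Ft y\<bar> \<le> L * \<bar>x - y\<bar>" and FtB: "\<And>x. \<bar>Ft x\<bar> \<le> L * \<delta>"
    and sector: "\<And>x. x * Ft x \<le> \<theta> * x\<^sup>2" and FtF: "\<And>x. \<bar>x\<bar> \<le> \<delta> \<Longrightarrow> Ft x = F x"
    by blast
  have Ft0: "Ft 0 = 0" using \<delta> FtF[of 0] by (simp add: F0)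
  obtain C \<alpha> where C: "C > 0" and \<alpha>: "\<alpha> > 0"
    and decay: "\<And>h s. (\<And>S. sqint {-1..S} h) \<Longrightarrow>
        (\<And>s. 0 \<le> s \<Longrightarrow> h s = k * h (s - 1) + (1 - k) * Ft (integral {s - 1..s} h)) \<Longrightarrow> 0 \<le> s \<Longrightarrow>
        integral {s - 1..s} (\<lambda>x. (h x)\<^sup>2) \<le> C * exp (- \<alpha> * s) * integral {-1..0} (\<lambda>x. (h x)\<^sup>2)"
    using delay_decay[OF FtL Ft0 sector \<theta> k] by blast
  obtain x1 where x1: "x1 \<in> {r - \<delta>..r + \<delta>}" "\<And>x. x \<in> {r - \<delta>..r + \<delta>} \<Longrightarrow> \<Lambda> x1 \<le> \<Lambda> x"
    using continuous_attains_inf[OF compact_Icc _ continuous_on_subset[OF \<Lambda>c], of "r - \<delta>" "r + \<delta>"] \<delta> by auto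
  obtain x2 where x2: "x2 \<in> {r - \<delta>..r + \<delta>}" "\<And>x. x \<in> {r - \<delta>..r + \<delta>} \<Longrightarrow> \<Lambda> x \<le> \<Lambda> x2"
    using continuous_attains_sup[OF compact_Icc _ continuous_on_subset[OF \<Lambda>c], of "r - \<delta>" "r + \<delta>"] \<delta> by auto
  \<comment> \<open>Initial data of size \<open>\<delta> / sqrt C\<close> keep \<open>m\<close> in \<open>[- \<delta>, \<delta>]\<close>, where \<open>Ft\<close> is \<open>F\<close>.  The velocity is at least \<open>\<Lambda> x1\<close>,
    and half of the rate is lost in passing from squared norms to norms.\<close>
  show ?thesis
  proof (rule exI[of _ "\<delta> / sqrt C"], rule conjI, use \<delta> C in simp,
      rule exI[of _ "sqrt C"], rule conjI, use C in simp,
      rule exI[of _ "\<alpha> * \<Lambda> x1 / 2"], rule conjI, use \<alpha> \<Lambda>pos in simp, intro allI impI)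
    fix \<rho>0 assume "L2_on {0<..<1} \<rho>0 \<and> norm_L2 {0<..<1} (\<lambda>x. \<rho>0 x - r) \<le> \<delta> / sqrt C"
    then have \<rho>0: "sqint {0..1} \<rho>0" and small: "norm_L2 {0<..<1} (\<lambda>x. \<rho>0 x - r) \<le> \<delta> / sqrt C"
      by (auto simp: L2_on_open_iff_sqint)
    have dev: "sqint {0..1} (\<lambda>x. \<rho>0 x - r)" by (intro sqint_diff \<rho>0 sqint_continuous continuous_intros)
    define h0 where "h0 s = \<rho>0 (- s) - r" for s
    have h0: "sqint {-1..0} h0"
      using dev absolutely_integrable_reflect_real[where f="\<lambda>x. \<rho>0 x - r" and a=0 and b=1]
        absolutely_integrable_reflect_real[where f="\<lambda>x. (\<rho>0 x - r)\<^sup>2" and a=0 and b=1]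
      unfolding sqint_def h0_def by simp
    obtain h where h: "\<And>S. sqint {-1..S} h" and hneg: "\<And>s. s < 0 \<Longrightarrow> h s = h0 s"
      and hdelay: "\<And>s. 0 \<le> s \<Longrightarrow> h s = k * h (s - 1) + (1 - k) * Ft (integral {s - 1..s} h)"
      using delay_solution_exists[OF h0 FtL FtB less_imp_le[OF k]] by blast
    have hai: "h absolutely_integrable_on {-1..S}" for S using h by (simp add: sqint_def)
    define m where "m s = integral {s - 1..s} h" for s
    define N0 where "N0 = norm_L2 {0<..<1} (\<lambda>x. \<rho>0 x - r)"
    have N0: "integral {-1..0} (\<lambda>x. (h x)\<^sup>2) = N0\<^sup>2" "N0 \<ge> 0"
    proof -
      have "integral {-1..0} (\<lambda>x. (h x)\<^sup>2) = integral {-1..-0} (\<lambda>x. (\<rho>0 (- x) - r)\<^sup>2)"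
        by (simp, rule integral_spike[of "{0}"]) (auto simp: hneg h0_def)
      also have "\<dots> = integral {0..1} (\<lambda>x. (\<rho>0 x - r)\<^sup>2)"
        by (rule Henstock_Kurzweil_Integration.integral_reflect_real)
      finally have e: "integral {-1..0} (\<lambda>x. (h x)\<^sup>2) = integral {0..1} (\<lambda>x. (\<rho>0 x - r)\<^sup>2)" .
      have "0 \<le> integral {0..1} (\<lambda>x. (\<rho>0 x - r)\<^sup>2)"
        using dev unfolding sqint_def by (intro integral_nonneg) (auto intro: absint_imp_integrable)
      then show "integral {-1..0} (\<lambda>x. (h x)\<^sup>2) = N0\<^sup>2" "N0 \<ge> 0"
        unfolding e N0_def norm_L2_eq[OF dev] by simp_all
    qed
    have E: "integral {s - 1..s} (\<lambda>x. (h x)\<^sup>2) \<le> C * exp (- \<alpha> * s) * N0\<^sup>2" if "0 \<le> s" for s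
      using decay[OF h hdelay that] unfolding N0 .
    have m\<delta>: "\<bar>m s\<bar> \<le> \<delta>" if s: "0 \<le> s" for s
    proof -
      have "(m s)\<^sup>2 \<le> integral {s - 1..s} (\<lambda>x. (h x)\<^sup>2)"
        using cauchy_schwarz_unit[of "s - 1" h] sqint_subinterval[OF h, of "s - 1" s s] s by (simp add: m_def)
      also have "\<dots> \<le> C * exp (- \<alpha> * s) * N0\<^sup>2" by (rule E[OF s])
      also have "\<dots> \<le> C * 1 * N0\<^sup>2" using C \<alpha> s by (intro mult_right_mono mult_left_mono) auto
      also have "\<dots> \<le> C * 1 * (\<delta> / sqrt C)\<^sup>2"
        using small N0(2) C unfolding N0_def by (intro mult_left_mono power_mono) auto
      also have "\<dots> = \<delta>\<^sup>2" using C by (simp add: power_divide)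
      finally show ?thesis using \<delta> by (simp add: abs_le_square_iff[symmetric])
    qed
    define g where "g s = r + h s" for s
    have g: "sqint {-1..S} g" for S
      unfolding g_def by (intro sqint_add h sqint_continuous continuous_intros)
    have gm: "integral {s - 1..s} g = r + m s" if "0 \<le> s" for s
    proof -
      have "h integrable_on {s - 1..s}"
        by (rule absint_imp_integrable, rule absolutely_integrable_on_subinterval[OF hai[of s]]) (use that in auto)
      then have "(g has_integral (1 *\<^sub>R r + m s)) {s - 1..s}"
        unfolding g_def m_def using has_integral_const_real[of r "s - 1" s]
        by (intro has_integral_add integrable_integral) auto
      then show ?thesis by (simp add: integral_unique)
    qed
    have gdelay: "g s = k * g (s - 1) + (1 - k) * r * \<Lambda> r / \<Lambda> (integral {s - 1..s} g)" if s: "0 \<le> s" for s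
      using hdelay[OF s] m\<delta>[OF s] unfolding gm[OF s]
      by (simp add: g_def m_def[symmetric] FtF F_def algebra_simps)
    have mc: "continuous_on {0..} m" unfolding m_def by (rule window_continuous[OF hai])
    \<comment> \<open>Inverting the time change \<open>dt = ds / \<Lambda>(W)\<close>.\<close>
    define p where "p s = 1 / \<Lambda> (r + m (max 0 s))" for s
    have pc: "continuous_on UNIV p"
      unfolding p_def
      by (intro continuous_intros continuous_on_compose2[OF \<Lambda>c] continuous_on_compose2[OF mc]) (auto simp: \<Lambda>n)
    have range: "r + m (max 0 s) \<in> {r - \<delta>..r + \<delta>}" for s using m\<delta>[of "max 0 s"] by auto
    have plow: "1 / \<Lambda> x2 \<le> p s" for s
      unfolding p_def using x2(2)[OF range] \<Lambda>pos by (intro divide_left_mono mult_pos_pos) auto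
    have p0: "1 / \<Lambda> x2 > 0" using \<Lambda>pos by simp
    obtain \<xi> where \<xi>: "\<And>t. (\<xi> has_real_derivative 1 / p (\<xi> t)) (at t)" "\<xi> 0 = 0"
      using time_change[OF pc p0 plow] by metis
    have \<xi>low: "\<Lambda> x1 * t \<le> \<xi> t" if t: "0 \<le> t" for t
    proof (cases "t = 0")
      case False
      then have "0 < t" using t by simp
      from MVT2[OF this, of \<xi> "\<lambda>t. 1 / p (\<xi> t)"] \<xi> obtain z where "\<xi> t = t * (1 / p (\<xi> z))" by auto
      moreover have "\<Lambda> x1 \<le> 1 / p (\<xi> z)" unfolding p_def using x1(2)[OF range] by simp
      ultimately show ?thesis using t mult_left_mono[of "\<Lambda> x1" "1 / p (\<xi> z)" t] by (simp add: mult.commute)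
    qed (simp add: \<xi>(2))
    have \<xi>nn: "0 \<le> \<xi> t" if "0 \<le> t" for t
      using \<xi>low[OF that] mult_nonneg_nonneg[OF less_imp_le[OF \<Lambda>pos[of x1]] that] by linarith
    have \<xi>': "(\<xi> has_real_derivative \<Lambda> (integral {\<xi> t - 1..\<xi> t} g)) (at t)" if "0 \<le> t" for t
      using \<xi>(1)[of t] \<xi>nn[OF that] by (simp add: p_def gm max_def)
    define \<rho> where "\<rho> t x = g (\<xi> t - x)" for t x
    have ws: "weak_solution \<Lambda> r k \<rho>0 \<rho>"
      unfolding \<rho>_def
      by (rule weak_solution_of_profile[OF g _ \<Lambda>c \<Lambda>pos \<xi>(2) \<xi>' gdelay]) (auto simp: g_def hneg h0_def)
    have "norm_L2 {0<..<1} (\<lambda>x. \<rho> t x - r) \<le> sqrt C * exp (- (\<alpha> * \<Lambda> x1 / 2) * t) * N0" if t: "0 \<le> t" for t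
    proof -
      have e: "(\<lambda>x. \<rho> t x - r) = (\<lambda>x. h (\<xi> t - x))" by (simp add: \<rho>_def g_def)
      have hw: "sqint {0..1} (\<lambda>x. h (\<xi> t - x))"
        by (rule sqint_window, rule sqint_subinterval[OF h]) (use \<xi>nn[OF t] in auto)
      have "integral {0..1} (\<lambda>x. (h (\<xi> t - x))\<^sup>2) = integral {\<xi> t - 1..\<xi> t} (\<lambda>x. (h x)\<^sup>2)"
        by (rule integral_window[of "\<lambda>x. (h x)\<^sup>2"])
      also have "\<dots> \<le> C * exp (- \<alpha> * \<xi> t) * N0\<^sup>2" by (rule E[OF \<xi>nn[OF t]])
      also have "\<dots> \<le> C * exp (- \<alpha> * (\<Lambda> x1 * t)) * N0\<^sup>2"
        using C \<alpha> \<xi>low[OF t] by (intro mult_right_mono mult_left_mono) auto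
      also have "\<dots> = (sqrt C * exp (- (\<alpha> * \<Lambda> x1 / 2) * t) * N0)\<^sup>2"
        using C by (simp add: power_mult_distrib exp_double[symmetric] mult_ac)
      finally have "sqrt (integral {0..1} (\<lambda>x. (h (\<xi> t - x))\<^sup>2)) \<le> sqrt C * exp (- (\<alpha> * \<Lambda> x1 / 2) * t) * N0"
        using C N0(2) by (intro real_le_lsqrt) (auto intro!: mult_nonneg_nonneg)
      then show ?thesis unfolding e norm_L2_eq[OF hw] .
    qed
    moreover have "AE x in lebesgue_on {0<..<1}. \<rho>' t x = \<rho> t x"
      if "weak_solution \<Lambda> r k \<rho>0 \<rho>'" "0 \<le> t" for \<rho>' t
      using weak_solution_unique[OF ws that(1) _ \<Lambda>c \<Lambda>pos lip_inv less_imp_le[OF k] that(2)] \<rho>0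
      by (simp add: sqint_def)
    ultimately show "\<exists>\<rho>. weak_solution \<Lambda> r k \<rho>0 \<rho> \<and>
                (\<forall>\<rho>'. weak_solution \<Lambda> r k \<rho>0 \<rho>' \<longrightarrow>
                   (\<forall>t\<ge>0. AE x in lebesgue_on {0<..<1}. \<rho>' t x = \<rho> t x)) \<and>
                (\<forall>t\<ge>0. norm_L2 {0<..<1} (\<lambda>x. \<rho> t x - r)
                   \<le> sqrt C * exp (- (\<alpha> * \<Lambda> x1 / 2) * t) * norm_L2 {0<..<1} (\<lambda>x. \<rho>0 x - r))"
      using ws unfolding N0_def by blast
  qed
qed

end
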